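(* Let $\lambda_1, \lambda_2, \ldots, \lambda_n \in \mathbb G$ and $w_1, w_2, \ldots, w_n \in \overline{\mathbb D}$. There is a function $f \in H^\infty(\mathbb G)$ with $\|f\|_\infty \le 1$ and $f(\lambda_i) = w_i$ for $i = 1,2,\ldots,n$ if and only if for every admissible kernel $k$ on $\mathbb G$ the $n\times n$ matrix $$\left(\left(\, (1 - w_i\overline{w_j})\, k(\lambda_i,\lambda_j) \,\right)\right)_{i,j=1}^n$$ is positive semi-definite.
   Context: $\mathbb D$ is the open unit disk and $\mathbb G = \{(z_1+z_2, z_1z_2) : |z_1|<1, |z_2|<1\} \subseteq \mathbb C^2$ is the open symmetrized bidisk. $H^\infty(\mathbb G)$ is the algebra of bounded holomorphic functions on $\mathbb G$ with the supremum norm $\|\cdot\|_\infty$. A kernel on $\mathbb G$ is a function $k : \mathbb G \times \mathbb G \to \mathbb C$ such that $\sum_{i,j=1}^m c_i\bar c_j k(z_i,z_j) > 0$ for every positive integer $m$, all distinct points $z_1,\ldots,z_m \in \mathbb G$ and all scalars $c_1,\ldots,c_m$ not all zero. Given a kernel $k$, $H_k$ denotes its reproducing kernel Hilbert space of functions on $\mathbb G$: it contains the functions $k(\cdot,w)$, $w \in \mathbb G$, they form a total set, and $f(z) = \langle f, k(\cdot,z)\rangle$ for all $f \in H_k$, $z \in \mathbb G$. A $\Gamma$-contraction is a pair $(S,P)$ of commuting bounded operators on a Hilbert space such that $\|f(S,P)\| \le \sup_{\mathbb G}|f|$ for all polynomials $f$ in two variables. A kernel $k$ on $\mathbb G$ is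 admissible if the pair $(M_s,M_p)$ of multiplication operators $(M_sf)(s,p) = s f(s,p)$, $(M_pf)(s,p) = p f(s,p)$ on $H_k$ is a $\Gamma$-contraction on $H_k$ (in particular $M_s$ and $M_p$ are bounded on $H_k$). *)

theory Defs
  imports
    "HOL-Analysis.Analysis"
    "HOL-Computational_Algebra.Polynomial"
    "HOL-Library.Function_Algebras"
    "HOL-Library.Complex_Order"
begin

text \<open>
  The order on \<^typ>\<open>complex\<close> is that of \<^theory>\<open>HOL-Library.Complex_Order\<close>: for complex \<open>z\<close>,
  \<open>0 \<le> z\<close> (resp. \<open>0 < z\<close>) says that \<open>z\<close> is real and nonnegative (resp. positive).
\<close>

subsection \<open>The open symmetrized bidisk and its bounded holomorphic functions\<close>

definition sym_bidisk :: "(complex \<times> complex) set" where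
  "sym_bidisk = {(z1 + z2, z1 * z2) | z1 z2. cmod z1 < 1 \<and> cmod z2 < 1}"

text \<open>Only used for open \<open>A\<close>: at every point of \<open>A\<close> there is a complex-linear total derivative.\<close>

definition holomorphic2_on :: "(complex \<times> complex \<Rightarrow> complex) \<Rightarrow> (complex \<times> complex) set \<Rightarrow> bool" where
  "holomorphic2_on f A \<longleftrightarrow>
     (\<forall>z\<in>A. \<exists>a b. (f has_derivative (\<lambda>h. a * fst h + b * snd h)) (at z))"

definition sup_norm :: "(complex \<times> complex \<Rightarrow> complex) \<Rightarrow> real" where
  "sup_norm f = (SUP z\<in>sym_bidisk. cmod (f z))"

definition H_infinity :: "(complex \<times> complex \<Rightarrow> complex) set" where
  "H_infinity = {f. holomorphic2_on f sym_bidisk \<and> bounded (f ` sym_bidisk)}"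

subsection \<open>Polynomials in two variables\<close>

text \<open>
  A polynomial in the variables \<open>s\<close> and \<open>p\<close> is an element of \<open>C[s][p]\<close>:
  \<open>coeff (coeff f j) i\<close> is the coefficient of \<open>s^i p^j\<close>.
\<close>

definition eval2 :: "complex poly poly \<Rightarrow> complex \<times> complex \<Rightarrow> complex" where
  "eval2 f z = (\<Sum>j\<le>degree f. \<Sum>i\<le>degree (coeff f j). coeff (coeff f j) i * (fst z ^ i * snd z ^ j))"

lemma eval2_eq_poly: "eval2 f (s, p) = poly (poly f [:p:]) s"
  by (simp add: eval2_def poly_altdef[of f] poly_sum poly_altdef[of "coeff f _"]
        sum_distrib_right mult.assoc)

subsection \<open>Complex Hilbert spaces and Gamma-contractions\<close>

text \<open>
  A Hilbert space is given by a carrier \<open>H\<close>, a linear subspace of an ambient complex vector space,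
  and an inner product \<open>ip\<close> on it, linear in its first argument.
\<close>

locale complex_hilbert_space = vector_space scale
  for scale :: "complex \<Rightarrow> 'v::ab_group_add \<Rightarrow> 'v" (infixr "*\<^sub>C" 75) +
  fixes H :: "'v set" and ip :: "'v \<Rightarrow> 'v \<Rightarrow> complex"
  assumes subspace_carrier: "subspace H"
    and ip_add_left: "\<lbrakk>x \<in> H; y \<in> H; z \<in> H\<rbrakk> \<Longrightarrow> ip (x + y) z = ip x z + ip y z"
    and ip_scale_left: "\<lbrakk>x \<in> H; y \<in> H\<rbrakk> \<Longrightarrow> ip (c *\<^sub>C x) y = c * ip x y"
    and ip_commute: "\<lbrakk>x \<in> H; y \<in> H\<rbrakk> \<Longrightarrow> ip y x = cnj (ip x y)"
    and ip_pos: "\<lbrakk>x \<in> H; x \<noteq> 0\<rbrakk> \<Longrightarrow> 0 < ip x x"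
    and complete_carrier:
      "\<lbrakk>\<And>n. X n \<in> H;
        \<And>e. 0 < e \<Longrightarrow> \<exists>N. \<forall>m\<ge>N. \<forall>n\<ge>N. sqrt (Re (ip (X m - X n) (X m - X n))) < e\<rbrakk>
       \<Longrightarrow> \<exists>x\<in>H. (\<lambda>n. sqrt (Re (ip (X n - x) (X n - x)))) \<longlonglongrightarrow> 0"
begin

definition hnorm :: "'v \<Rightarrow> real" where
  "hnorm x = sqrt (Re (ip x x))"

definition total :: "'v set \<Rightarrow> bool" where
  "total A \<longleftrightarrow> A \<subseteq> H \<and> (\<forall>x\<in>H. \<forall>e>0. \<exists>y\<in>span A. hnorm (x - y) < e)"

definition bounded_operator :: "('v \<Rightarrow> 'v) \<Rightarrow> bool" where
  "bounded_operator T \<longleftrightarrow>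
     T \<in> H \<rightarrow> H \<and>
     (\<forall>x\<in>H. \<forall>y\<in>H. T (x + y) = T x + T y) \<and>
     (\<forall>c. \<forall>x\<in>H. T (c *\<^sub>C x) = c *\<^sub>C T x) \<and>
     (\<exists>B. \<forall>x\<in>H. hnorm (T x) \<le> B * hnorm x)"

definition operator_norm :: "('v \<Rightarrow> 'v) \<Rightarrow> real" where
  "operator_norm T = (SUP x\<in>{x \<in> H. hnorm x \<le> 1}. hnorm (T x))"

definition eval2_operator :: "complex poly poly \<Rightarrow> ('v \<Rightarrow> 'v) \<Rightarrow> ('v \<Rightarrow> 'v) \<Rightarrow> 'v \<Rightarrow> 'v" where
  "eval2_operator f S P x =
     (\<Sum>j\<le>degree f. \<Sum>i\<le>degree (coeff f j). coeff (coeff f j) i *\<^sub>C (S ^^ i) ((P ^^ j) x))"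

definition Gamma_contraction :: "('v \<Rightarrow> 'v) \<Rightarrow> ('v \<Rightarrow> 'v) \<Rightarrow> bool" where
  "Gamma_contraction S P \<longleftrightarrow>
     bounded_operator S \<and> bounded_operator P \<and> (\<forall>x\<in>H. S (P x) = P (S x)) \<and>
     (\<forall>f. operator_norm (eval2_operator f S P) \<le> sup_norm (eval2 f))"

end

subsection \<open>Kernels, their Hilbert spaces, and admissibility\<close>

type_synonym kernel = "complex \<times> complex \<Rightarrow> complex \<times> complex \<Rightarrow> complex"

definition is_kernel :: "kernel \<Rightarrow> bool" where
  "is_kernel k \<longleftrightarrow>
     (\<forall>(m::nat) z c. 0 < m \<and> z ` {1..m} \<subseteq> sym_bidisk \<and> inj_on z {1..m} \<and> (\<exists>i\<in>{1..m}. c i \<noteq> 0)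
        \<longrightarrow> 0 < (\<Sum>i=1..m. \<Sum>j=1..m. c i * cnj (c j) * k (z i) (z j)))"

text \<open>
  Functions on the symmetrized bidisk are represented by functions on \<open>complex \<times> complex\<close> that
  vanish off it.  \<open>kernel_fun k w\<close> is \<open>k(\<cdot>,w)\<close> in this representation.
\<close>

definition kernel_fun :: "kernel \<Rightarrow> complex \<times> complex \<Rightarrow> complex \<times> complex \<Rightarrow> complex" where
  "kernel_fun k w = (\<lambda>z. if z \<in> sym_bidisk then k z w else 0)"

definition scale_fun :: "complex \<Rightarrow> ('a \<Rightarrow> complex) \<Rightarrow> 'a \<Rightarrow> complex" where
  "scale_fun c f = (\<lambda>z. c * f z)"

lemma vector_space_scale_fun: "vector_space scale_fun"
  by unfold_locales (auto simp: scale_fun_def fun_eq_iff algebra_simps)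

definition is_rkhs ::
  "kernel \<Rightarrow> (complex \<times> complex \<Rightarrow> complex) set
    \<Rightarrow> ((complex \<times> complex \<Rightarrow> complex) \<Rightarrow> (complex \<times> complex \<Rightarrow> complex) \<Rightarrow> complex) \<Rightarrow> bool" where
  "is_rkhs k H ip \<longleftrightarrow>
     complex_hilbert_space scale_fun H ip \<and>
     (\<forall>f\<in>H. \<forall>z. z \<notin> sym_bidisk \<longrightarrow> f z = 0) \<and>
     complex_hilbert_space.total scale_fun H ip (kernel_fun k ` sym_bidisk) \<and>
     (\<forall>f\<in>H. \<forall>z\<in>sym_bidisk. f z = ip f (kernel_fun k z))"

definition mult_s :: "(complex \<times> complex \<Rightarrow> complex) \<Rightarrow> complex \<times> complex \<Rightarrow> complex" where
  "mult_s f = (\<lambda>(s, p). s * f (s, p))"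

definition mult_p :: "(complex \<times> complex \<Rightarrow> complex) \<Rightarrow> complex \<times> complex \<Rightarrow> complex" where
  "mult_p f = (\<lambda>(s, p). p * f (s, p))"

text \<open>
  By the Moore--Aronszajn theorem every kernel has exactly one reproducing kernel Hilbert space
  (\<open>ip\<close> being unique on \<open>H\<close>), so the existential quantifier below just names it.
\<close>

definition admissible :: "kernel \<Rightarrow> bool" where
  "admissible k \<longleftrightarrow>
     is_kernel k \<and>
     (\<exists>H ip. is_rkhs k H ip \<and>
        complex_hilbert_space.Gamma_contraction scale_fun H ip mult_s mult_p)"

subsection \<open>Positive semi-definite matrices\<close>

definition pos_semidef :: "nat \<Rightarrow> (nat \<Rightarrow> nat \<Rightarrow> complex) \<Rightarrow> bool" where
  "pos_semidef n A \<longleftrightarrow> (\<forall>x. 0 \<le> (\<Sum>i=1..n. \<Sum>j=1..n. cnj (x i) * A i j * x j))"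

end

theory Submission imports Defs "HOL-Complex_Analysis.Complex_Analysis"
begin

text \<open>
  The argument is soft. Write \<open>polyball\<close> for the set of polynomial functions that are bounded by 1 on the
  symmetrized bidisk \<open>G\<close>. Two facts are combined: the closure of \<open>polyball\<close> under pointwise limits on
  finite sets consists of the values of the unit ball of \<open>H\<^sup>\<infinity>(G)\<close>, and on a finite set \<open>L\<close> a function
  is such a limit iff it satisfies the Pick condition for all admissible kernels.
  
  The first fact is analysis in two variables. A function in the unit ball of \<open>H\<^sup>\<infinity>(G)\<close> is expanded along
  the discs \<open>c \<mapsto> (c s, c\<^sup>2 p)\<close>. The Taylor coefficients are weighted homogeneous, which forces them to be
  polynomials, and a partial sum at a radius \<open>c < 1\<close> is uniformly close to \<open>f (c s, c\<^sup>2 p)\<close>; this gives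
  \<open>polyball_approx\<close>. Conversely a sequence in \<open>polyball\<close> has a pointwise convergent subsequence with a
  holomorphic limit (\<open>montel_two_variables\<close>).
  
  That \<open>polyball\<close> satisfies the Pick condition is the usual adjoint computation: multiplication by \<open>g\<close> is a
  contraction, and its adjoint acts diagonally on the kernel functions (\<open>pos_semidef_polyball\<close>). By passing
  to limits this settles necessity.
  
  For sufficiency the point is that a kernel on \<open>G\<close> need not be continuous. If \<open>K\<close> is a positive matrix on
  \<open>L\<close> such that \<open>(1 - g g\<^sup>*) K\<close> is positive for all \<open>g\<close> in \<open>polyball\<close>, then extending \<open>K\<close> by 0 and adding
  a small multiple of the identity kernel gives an admissible kernel on \<open>G\<close> (\<open>admissible_atomic_kernel\<close>);
  its Hilbert space comes from the Moore-Aronszajn construction. So the Pick condition says that the matrix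
  \<open>1 - W W\<^sup>*\<close> is nonnegative on the dual of the cone generated by the matrices \<open>(1 - g g\<^sup>*) v v\<^sup>*\<close>.
  A Hahn-Banach argument (\<open>cone_functional\<close>) puts \<open>1 - r\<^sup>2 W W\<^sup>*\<close> into the cone for every \<open>r < 1\<close>:
  \<open>1 - r\<^sup>2 W W\<^sup>* = \<Sum> (1 - g\<^sub>l g\<^sub>l\<^sup>*) v\<^sub>l v\<^sub>l\<^sup>*\<close>. A lurking isometry turns this identity into a
  transfer function built from the \<open>g\<^sub>l\<close>, whose iterates, averaged, are elements of \<open>polyball\<close> that
  converge to \<open>r W\<close> on \<open>L\<close> (\<open>realization\<close>). Letting \<open>r\<close> tend to 1 and extracting a convergent
  subsequence gives the interpolating function.
\<close>

section \<open>Finitely supported coefficients and the energy of a kernel\<close>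

definition fin_supp :: "'a set \<Rightarrow> ('a \<Rightarrow> complex) set" where
  "fin_supp D = {c. finite {x. c x \<noteq> 0} \<and> {x. c x \<noteq> 0} \<subseteq> D}"

definition pairing :: "('a \<Rightarrow> complex) \<Rightarrow> ('a \<Rightarrow> complex) \<Rightarrow> complex" where
  "pairing f c = (\<Sum>x | c x \<noteq> 0. f x * cnj (c x))"

definition kernel_sum :: "'a set \<Rightarrow> ('a \<Rightarrow> 'a \<Rightarrow> complex) \<Rightarrow> ('a \<Rightarrow> complex) \<Rightarrow> 'a \<Rightarrow> complex" where
  "kernel_sum D k c z = (if z \<in> D then \<Sum>x | c x \<noteq> 0. k z x * c x else 0)"

text \<open>
  The energy of \<open>c\<close> is the squared norm of \<open>\<Sum> c x * k(\<cdot>,x)\<close> in the Hilbert space of \<open>k\<close>.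
\<close>

definition energy :: "'a set \<Rightarrow> ('a \<Rightarrow> 'a \<Rightarrow> complex) \<Rightarrow> ('a \<Rightarrow> complex) \<Rightarrow> real" where
  "energy D k c = Re (pairing (kernel_sum D k c) c)"

lemma Re_of_real_times: "Re (complex_of_real r * z) = r * Re z"
  by simp

lemma cnj_times_self: "cnj z * z = complex_of_real ((cmod z)\<^sup>2)"
  by (simp only: complex_norm_square mult.commute)

lemma pairing_superset:
  assumes "finite A" "{x. c x \<noteq> 0} \<subseteq> A"
  shows "pairing f c = (\<Sum>x\<in>A. f x * cnj (c x))"
  unfolding pairing_def by (rule sum.mono_neutral_left) (use assms in auto)

lemma kernel_sum_superset:
  assumes "finite A" "{x. c x \<noteq> 0} \<subseteq> A" "z \<in> D"
  shows "kernel_sum D k c z = (\<Sum>x\<in>A. k z x * c x)"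
proof -
  have "(\<Sum>x | c x \<noteq> 0. k z x * c x) = (\<Sum>x\<in>A. k z x * c x)"
    by (rule sum.mono_neutral_left) (use assms in auto)
  then show ?thesis using assms(3) by (simp add: kernel_sum_def)
qed

lemma energy_superset:
  assumes "finite A" "{x. c x \<noteq> 0} \<subseteq> A" "A \<subseteq> D"
  shows "energy D k c = Re (\<Sum>z\<in>A. \<Sum>x\<in>A. k z x * c x * cnj (c z))"
proof -
  have "pairing (kernel_sum D k c) c = (\<Sum>z\<in>A. (\<Sum>x\<in>A. k z x * c x) * cnj (c z))"
    unfolding pairing_superset[OF assms(1,2)]
    by (rule sum.cong) (use assms in \<open>auto simp: kernel_sum_superset\<close>)
  then show ?thesis by (simp add: energy_def sum_distrib_right)
qed

lemma fin_suppD: "c \<in> fin_supp D \<Longrightarrow> finite {x. c x \<noteq> 0}" "c \<in> fin_supp D \<Longrightarrow> {x. c x \<noteq> 0} \<subseteq> D"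
  by (auto simp: fin_supp_def)

lemma fin_supp_add:
  assumes "c \<in> fin_supp D" "d \<in> fin_supp D"
  shows "c + d \<in> fin_supp D"
proof -
  have sub: "{x. (c + d) x \<noteq> 0} \<subseteq> {x. c x \<noteq> 0} \<union> {x. d x \<noteq> 0}" by auto
  have "finite ({x. c x \<noteq> 0} \<union> {x. d x \<noteq> 0})" using assms by (simp add: fin_supp_def)
  from finite_subset[OF sub this] show ?thesis using sub assms unfolding fin_supp_def by blast
qed

lemma fin_supp_mult: "c \<in> fin_supp D \<Longrightarrow> (\<lambda>x. a x * c x) \<in> fin_supp D"
  unfolding fin_supp_def by (auto intro: finite_subset[of _ "{x. c x \<noteq> 0}"])

lemma fin_supp_scale: "c \<in> fin_supp D \<Longrightarrow> scale_fun a c \<in> fin_supp D"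
  unfolding scale_fun_def by (rule fin_supp_mult)

lemma fin_supp_uminus: "c \<in> fin_supp D \<Longrightarrow> - c \<in> fin_supp D"
  unfolding fin_supp_def by auto

lemma fin_supp_diff: "c \<in> fin_supp D \<Longrightarrow> d \<in> fin_supp D \<Longrightarrow> c - d \<in> fin_supp D"
  using fin_supp_add[of c D "-d"] fin_supp_uminus[of d D] by simp

lemma fin_supp_0: "0 \<in> fin_supp D" by (simp add: fin_supp_def)

lemma pairing_add_left: "pairing (f + g) c = pairing f c + pairing g c"
  by (simp add: pairing_def sum.distrib algebra_simps)

lemma pairing_diff_left: "pairing (f - g) c = pairing f c - pairing g c"
  by (simp add: pairing_def sum_subtractf algebra_simps)

lemma pairing_scale_left: "pairing (scale_fun a f) c = a * pairing f c"
  by (simp add: pairing_def scale_fun_def sum_distrib_left algebra_simps)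

lemma pairing_0_left: "pairing 0 c = 0"
  by (simp add: pairing_def)

lemma pairing_add_right:
  assumes "c \<in> fin_supp D" "d \<in> fin_supp D"
  shows "pairing f (c + d) = pairing f c + pairing f d"
proof -
  let ?A = "{x. c x \<noteq> 0} \<union> {x. d x \<noteq> 0}"
  have f: "finite ?A" using assms by (auto simp: fin_supp_def)
  show ?thesis
    by (subst (1 2 3) pairing_superset[OF f]) (auto simp: sum.distrib algebra_simps)
qed

lemma pairing_mult_right:
  assumes "c \<in> fin_supp D"
  shows "pairing f (\<lambda>x. a x * c x) = pairing (\<lambda>x. cnj (a x) * f x) c"
  by (subst (1 2) pairing_superset[OF fin_suppD(1)[OF assms]]) (auto intro!: sum.cong)

lemma pairing_scale_right:
  assumes "c \<in> fin_supp D"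
  shows "pairing f (scale_fun a c) = cnj a * pairing f c"
  unfolding scale_fun_def pairing_mult_right[OF assms]
  by (simp add: pairing_def sum_distrib_left algebra_simps)

lemma pairing_diff_right:
  assumes "c \<in> fin_supp D" "d \<in> fin_supp D"
  shows "pairing f (c - d) = pairing f c - pairing f d"
proof -
  have "pairing f (c - d + d) = pairing f (c - d) + pairing f d"
    by (rule pairing_add_right[of _ D]) (use assms fin_supp_diff in auto)
  then show ?thesis by simp
qed

lemma kernel_sum_add:
  assumes "c \<in> fin_supp D" "d \<in> fin_supp D"
  shows "kernel_sum D k (c + d) = kernel_sum D k c + kernel_sum D k d"
proof
  fix z
  let ?A = "{x. c x \<noteq> 0} \<union> {x. d x \<noteq> 0}"
  have f: "finite ?A" using assms by (auto simp: fin_supp_def)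
  show "kernel_sum D k (c + d) z = (kernel_sum D k c + kernel_sum D k d) z"
  proof (cases "z \<in> D")
    case True
    show ?thesis unfolding plus_fun_apply
      by (subst (1 2 3) kernel_sum_superset[OF f _ True]) (auto simp: sum.distrib algebra_simps)
  qed (simp add: kernel_sum_def)
qed

lemma kernel_sum_scale:
  assumes "c \<in> fin_supp D"
  shows "kernel_sum D k (scale_fun a c) = scale_fun a (kernel_sum D k c)"
proof
  fix z
  show "kernel_sum D k (scale_fun a c) z = scale_fun a (kernel_sum D k c) z"
  proof (cases "z \<in> D")
    case True
    show ?thesis unfolding scale_fun_def
      by (subst (1 2) kernel_sum_superset[OF fin_suppD(1)[OF assms] _ True])
        (auto simp: sum_distrib_left algebra_simps)
  qed (simp add: kernel_sum_def scale_fun_def)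
qed

lemma kernel_sum_diff:
  assumes "c \<in> fin_supp D" "d \<in> fin_supp D"
  shows "kernel_sum D k (c - d) = kernel_sum D k c - kernel_sum D k d"
proof -
  have "kernel_sum D k (c - d + d) = kernel_sum D k (c - d) + kernel_sum D k d"
    by (rule kernel_sum_add) (use assms fin_supp_diff in auto)
  then show ?thesis by simp
qed

lemma energy_scale:
  assumes "c \<in> fin_supp D"
  shows "energy D k (scale_fun a c) = (cmod a)\<^sup>2 * energy D k c"
proof -
  have "pairing (kernel_sum D k (scale_fun a c)) (scale_fun a c) = (a * cnj a) * pairing (kernel_sum D k c) c"
    by (simp add: kernel_sum_scale[OF assms] pairing_scale_left pairing_scale_right[OF assms])
  also have "\<dots> = of_real ((cmod a)\<^sup>2) * pairing (kernel_sum D k c) c"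
    by (simp only: complex_norm_square)
  finally show ?thesis unfolding energy_def by simp
qed

lemma kernel_sum_0: "kernel_sum D k 0 = 0"
  by (auto simp: kernel_sum_def fun_eq_iff)

section \<open>The reproducing kernel Hilbert space of a kernel\<close>

text \<open>
  The Moore-Aronszajn space is described by a variational formula instead of a completion. The squared
  norm of \<open>f\<close> is \<open>SUP c. 2 Re \<langle>f, k\<^sub>c\<rangle> - \<parallel>k\<^sub>c\<parallel>\<^sup>2\<close>, where \<open>k\<^sub>c = \<Sum> c x * k(\<cdot>,x)\<close> and
  \<open>\<langle>f, k\<^sub>c\<rangle> = \<Sum> f x * cnj (c x)\<close>; the space consists of the functions for which this is finite. Closure
  under addition, completeness, and the action of multipliers all follow by manipulating the
  competitors \<open>c\<close>.
\<close>

locale psd_kernel =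
  fixes D :: "'a set" and k :: "'a \<Rightarrow> 'a \<Rightarrow> complex"
  assumes herm: "x \<in> D \<Longrightarrow> y \<in> D \<Longrightarrow> k y x = cnj (k x y)"
    and psd: "c \<in> fin_supp D \<Longrightarrow> 0 \<le> energy D k c"
begin

abbreviation "F \<equiv> fin_supp D"
abbreviation "K \<equiv> kernel_sum D k"
abbreviation "E \<equiv> energy D k"

lemma pairing_kernel_sum_commute:
  assumes "c \<in> F" "d \<in> F"
  shows "pairing (K c) d = cnj (pairing (K d) c)"
proof -
  let ?A = "{x. c x \<noteq> 0} \<union> {x. d x \<noteq> 0}"
  have f: "finite ?A" and sub: "?A \<subseteq> D" using assms by (auto simp: fin_supp_def)
  have "pairing (K c) d = (\<Sum>z\<in>?A. \<Sum>x\<in>?A. k z x * c x * cnj (d z))"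
    using sub by (subst pairing_superset[OF f])
      (auto simp: kernel_sum_superset[OF f] sum_distrib_right intro!: sum.cong)
  also have "\<dots> = (\<Sum>x\<in>?A. \<Sum>z\<in>?A. cnj (k x z * d z * cnj (c x)))"
    by (subst sum.swap) (use sub in \<open>auto simp: algebra_simps intro!: sum.cong herm\<close>)
  also have "\<dots> = cnj (pairing (K d) c)"
    using sub by (subst pairing_superset[OF f])
      (auto simp: kernel_sum_superset[OF f] sum_distrib_right intro!: sum.cong)
  finally show ?thesis .
qed

lemma energy_add:
  assumes "c \<in> F" "d \<in> F"
  shows "E (c + d) = E c + E d + 2 * Re (pairing (K c) d)"
  using pairing_kernel_sum_commute[OF assms(2,1)]
  by (simp add: energy_def kernel_sum_add[OF assms] pairing_add_left pairing_add_right[OF assms])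

definition gain :: "('a \<Rightarrow> complex) \<Rightarrow> ('a \<Rightarrow> complex) \<Rightarrow> real" where
  "gain f c = 2 * Re (pairing f c) - E c"

definition norm_sq :: "('a \<Rightarrow> complex) \<Rightarrow> real" where
  "norm_sq f = (SUP c\<in>F. gain f c)"

definition carrier :: "('a \<Rightarrow> complex) set" where
  "carrier = {f. (\<forall>z. z \<notin> D \<longrightarrow> f z = 0) \<and> bdd_above (gain f ` F)}"

lemma gain_0: "gain f 0 = 0"
  by (simp add: gain_def energy_def kernel_sum_0 pairing_def)

lemma carrierI:
  assumes "\<And>z. z \<notin> D \<Longrightarrow> f z = 0" "\<And>c. c \<in> F \<Longrightarrow> gain f c \<le> B"
  shows "f \<in> carrier" "norm_sq f \<le> B"
proof -
  show "f \<in> carrier" using assms unfolding carrier_def bdd_above_def by blast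
  show "norm_sq f \<le> B" unfolding norm_sq_def
    by (rule cSUP_least) (use assms fin_supp_0 in auto)
qed

lemma gain_le: "f \<in> carrier \<Longrightarrow> c \<in> F \<Longrightarrow> gain f c \<le> norm_sq f"
  unfolding norm_sq_def carrier_def by (rule cSUP_upper) auto

lemma norm_sq_nonneg: "f \<in> carrier \<Longrightarrow> 0 \<le> norm_sq f"
  using gain_le[OF _ fin_supp_0] by (simp add: gain_0)

text \<open>
  Subtracting \<open>k\<^sub>c\<close> from \<open>f\<close> merely translates the competitors by \<open>c\<close>. Hence the norm of
  \<open>f - k\<^sub>c\<close> is known exactly, and near maximizers of the gain are good approximations of \<open>f\<close>.
\<close>

lemma gain_shift:
  assumes "c \<in> F" "d \<in> F"
  shows "gain (f - K c) d = gain f (c + d) - gain f c"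
  using energy_add[OF assms]
  by (simp add: gain_def pairing_diff_left pairing_add_right[OF assms])

lemma carrier_minus_kernel_sum:
  assumes "f \<in> carrier" "c \<in> F"
  shows "f - K c \<in> carrier" "norm_sq (f - K c) = norm_sq f - gain f c"
proof -
  have off: "(f - K c) z = 0" if "z \<notin> D" for z
    using assms that by (auto simp: carrier_def kernel_sum_def)
  have le: "gain (f - K c) d \<le> norm_sq f - gain f c" if "d \<in> F" for d
    using gain_shift[OF assms(2) that, of f] gain_le[OF assms(1) fin_supp_add[OF assms(2) that]] by simp
  show m: "f - K c \<in> carrier" using carrierI(1)[OF off le] .
  have "norm_sq f \<le> norm_sq (f - K c) + gain f c"
  proof (rule carrierI(2))
    fix d assume d: "d \<in> F"
    have "gain (f - K c) (d - c) \<le> norm_sq (f - K c)" by (rule gain_le[OF m]) (use d assms fin_supp_diff in auto)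
    then show "gain f d \<le> norm_sq (f - K c) + gain f c"
      using gain_shift[OF assms(2) fin_supp_diff[OF d assms(2)], of f] by simp
  qed (use assms in \<open>auto simp: carrier_def\<close>)
  with carrierI(2)[OF off le] show "norm_sq (f - K c) = norm_sq f - gain f c" by simp
qed

lemma carrier_scale:
  assumes "f \<in> carrier"
  shows "scale_fun a f \<in> carrier" "norm_sq (scale_fun a f) \<le> (cmod a)\<^sup>2 * norm_sq f"
proof -
  have off: "scale_fun a f z = 0" if "z \<notin> D" for z
    using assms that by (auto simp: carrier_def scale_fun_def)
  have le: "gain (scale_fun a f) c \<le> (cmod a)\<^sup>2 * norm_sq f" if c: "c \<in> F" for c
  proof (cases "a = 0")
    case True
    then show ?thesis using psd[OF c] by (simp add: gain_def pairing_scale_left)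
  next
    case False
    define d where "d = scale_fun (inverse a) c"
    have d: "d \<in> F" unfolding d_def by (rule fin_supp_scale[OF c])
    have c_eq: "c = scale_fun a d" using False by (auto simp: d_def scale_fun_def)
    have "pairing (scale_fun a f) c = (a * cnj a) * pairing f d"
      unfolding c_eq pairing_scale_left pairing_scale_right[OF d] by simp
    then have "pairing (scale_fun a f) c = of_real ((cmod a)\<^sup>2) * pairing f d"
      by (simp only: complex_norm_square)
    then have "gain (scale_fun a f) c = (cmod a)\<^sup>2 * gain f d"
      unfolding gain_def using energy_scale[OF d, of k a, folded c_eq]
      by (simp only: Re_of_real_times right_diff_distrib mult.assoc mult.left_commute)
    also have "\<dots> \<le> (cmod a)\<^sup>2 * norm_sq f"
      by (rule mult_left_mono[OF gain_le[OF assms d]]) simp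
    finally show ?thesis .
  qed
  show "scale_fun a f \<in> carrier" "norm_sq (scale_fun a f) \<le> (cmod a)\<^sup>2 * norm_sq f"
    using carrierI[OF off le] by auto
qed

lemma carrier_add:
  assumes "f \<in> carrier" "g \<in> carrier"
  shows "f + g \<in> carrier" "norm_sq (f + g) \<le> 2 * norm_sq f + 2 * norm_sq g"
proof -
  have off: "(f + g) z = 0" if "z \<notin> D" for z
    using assms that by (auto simp: carrier_def)
  have le: "gain (f + g) c \<le> 2 * norm_sq f + 2 * norm_sq g" if c: "c \<in> F" for c
  proof -
    \<comment> \<open>halving the competitor gives the factor 2 on both norms\<close>
    let ?d = "scale_fun (1/2) c"
    have d: "?d \<in> F" by (rule fin_supp_scale[OF c])
    have "gain (f + g) c = 2 * gain f ?d + 2 * gain g ?d"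
      by (simp add: gain_def pairing_add_left pairing_scale_right[OF c] energy_scale[OF c] power2_eq_square)
    then show ?thesis using gain_le[OF assms(1) d] gain_le[OF assms(2) d] by simp
  qed
  show "f + g \<in> carrier" "norm_sq (f + g) \<le> 2 * norm_sq f + 2 * norm_sq g"
    using carrierI[OF off le] by auto
qed

lemma carrier_0: "0 \<in> carrier" "norm_sq 0 = 0"
proof -
  have "gain 0 c \<le> 0" if "c \<in> F" for c using psd[OF that] by (simp add: gain_def pairing_0_left)
  then show m: "0 \<in> carrier" using carrierI(1)[of 0] by auto
  show "norm_sq 0 = 0"
    using carrierI(2)[of 0 0] \<open>\<And>c. c \<in> F \<Longrightarrow> gain 0 c \<le> 0\<close> norm_sq_nonneg[OF m] by auto
qed

lemma carrier_diff:
  assumes "f \<in> carrier" "g \<in> carrier"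
  shows "f - g \<in> carrier" "norm_sq (f - g) \<le> 2 * norm_sq f + 2 * norm_sq g"
proof -
  have eq: "f - g = f + scale_fun (-1) g" by (auto simp: scale_fun_def fun_eq_iff)
  note s = carrier_scale[OF assms(2), of "-1"]
  show "f - g \<in> carrier" unfolding eq by (rule carrier_add(1)[OF assms(1) s(1)])
  show "norm_sq (f - g) \<le> 2 * norm_sq f + 2 * norm_sq g"
    unfolding eq using carrier_add(2)[OF assms(1) s(1)] s(2) by simp
qed

lemma norm_sq_minus_commute:
  assumes "f \<in> carrier" "g \<in> carrier"
  shows "norm_sq (f - g) = norm_sq (g - f)"
proof -
  have "norm_sq (g - f) \<le> norm_sq (f - g)" if "f \<in> carrier" "g \<in> carrier" for f g
  proof -
    have eq: "g - f = scale_fun (-1) (f - g)" by (auto simp: scale_fun_def fun_eq_iff)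
    show ?thesis using carrier_scale(2)[OF carrier_diff(1)[OF that], of "-1"] unfolding eq[symmetric] by simp
  qed
  from this[OF assms] this[OF assms(2,1)] show ?thesis by simp
qed

lemma carrier_kernel_sum:
  assumes "c \<in> F"
  shows "K c \<in> carrier" "norm_sq (K c) = E c"
proof -
  have "0 - K c \<in> carrier" by (rule carrier_minus_kernel_sum(1)[OF carrier_0(1) assms])
  from carrier_diff(1)[OF carrier_0(1) this] show m: "K c \<in> carrier" by simp
  show "norm_sq (K c) = E c"
    using norm_sq_minus_commute[OF m carrier_0(1)] carrier_minus_kernel_sum(2)[OF carrier_0(1) assms]
    by (simp add: carrier_0 gain_def pairing_0_left)
qed

lemma cauchy_schwarz:
  assumes f: "f \<in> carrier" and c: "c \<in> F"
  shows "(cmod (pairing f c))\<^sup>2 \<le> norm_sq f * E c"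
proof -
  define p where "p = pairing f c"
  \<comment> \<open>compare with the competitors \<open>t p c\<close> and optimize over \<open>t\<close>; if the energy vanishes, let \<open>t\<close> be large\<close>
  have *: "2 * t * (cmod p)\<^sup>2 - t\<^sup>2 * (cmod p)\<^sup>2 * E c \<le> norm_sq f" for t :: real
  proof -
    have "pairing f (scale_fun (of_real t * p) c) = of_real t * (cnj p * p)"
      by (simp add: pairing_scale_right[OF c] p_def)
    then have "Re (pairing f (scale_fun (of_real t * p) c)) = t * (cmod p)\<^sup>2"
      by (simp only: cnj_times_self Re_of_real_times Re_complex_of_real)
    moreover have "E (scale_fun (of_real t * p) c) = t\<^sup>2 * (cmod p)\<^sup>2 * E c"
      by (simp add: energy_scale[OF c] norm_mult power_mult_distrib)
    ultimately show ?thesis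
      using gain_le[OF f fin_supp_scale[OF c], of "of_real t * p"] by (simp add: gain_def)
  qed
  show ?thesis
  proof (cases "E c = 0")
    case True
    have "cmod p = 0"
    proof (rule ccontr)
      assume "cmod p \<noteq> 0"
      then have "2 * ((norm_sq f + 1) / (2 * (cmod p)\<^sup>2)) * (cmod p)\<^sup>2 = norm_sq f + 1" by (simp add: field_simps)
      with *[of "(norm_sq f + 1) / (2 * (cmod p)\<^sup>2)"] True show False by simp
    qed
    then show ?thesis using True by (simp add: p_def)
  next
    case False
    then have pos: "E c > 0" using psd[OF c] by simp
    have "2 * (1 / E c) * (cmod p)\<^sup>2 - (1 / E c)\<^sup>2 * (cmod p)\<^sup>2 * E c = (cmod p)\<^sup>2 / E c"
      using pos by (simp add: field_simps power2_eq_square)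
    with *[of "1 / E c"] have "(cmod p)\<^sup>2 / E c \<le> norm_sq f" by linarith
    with pos show ?thesis by (simp add: p_def field_simps)
  qed
qed

lemma approx_exists:
  assumes "f \<in> carrier" "e > 0"
  shows "\<exists>c\<in>F. norm_sq (f - K c) < e"
proof -
  have "\<exists>c\<in>F. norm_sq f - e < gain f c"
  proof (rule ccontr)
    assume "\<not> ?thesis"
    then have "gain f c \<le> norm_sq f - e" if "c \<in> F" for c using that by (meson not_le)
    then have "norm_sq f \<le> norm_sq f - e"
      by (intro carrierI(2)) (use assms in \<open>auto simp: carrier_def\<close>)
    then show False using assms by simp
  qed
  then show ?thesis using carrier_minus_kernel_sum(2)[OF assms(1)] by force
qed

definition approx :: "('a \<Rightarrow> complex) \<Rightarrow> nat \<Rightarrow> 'a \<Rightarrow> complex" where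
  "approx f n = (SOME c. c \<in> F \<and> norm_sq (f - K c) < 1 / real (Suc n))"

lemma approx:
  assumes "f \<in> carrier"
  shows "approx f n \<in> F" "norm_sq (f - K (approx f n)) < 1 / real (Suc n)"
proof -
  have "\<exists>c. c \<in> F \<and> norm_sq (f - K c) < 1 / real (Suc n)"
    using approx_exists[OF assms, of "1 / real (Suc n)"] by auto
  from someI_ex[OF this] show "approx f n \<in> F" "norm_sq (f - K (approx f n)) < 1 / real (Suc n)"
    unfolding approx_def by auto
qed

lemma approx_tendsto:
  assumes "f \<in> carrier"
  shows "(\<lambda>n. norm_sq (f - K (approx f n))) \<longlonglongrightarrow> 0"
proof (rule real_tendsto_sandwich[OF _ _ tendsto_const lim_1_over_n[THEN LIMSEQ_Suc]])
  show "\<forall>\<^sub>F n in sequentially. 0 \<le> norm_sq (f - K (approx f n))"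
    using norm_sq_nonneg carrier_minus_kernel_sum(1) approx(1) assms by simp
  show "\<forall>\<^sub>F n in sequentially. norm_sq (f - K (approx f n)) \<le> 1 / of_nat (Suc n)"
    using approx(2)[OF assms] by (simp add: less_imp_le)
qed

text \<open>
  With a fixed approximating sequence for the second argument, linearity in the first one is
  immediate; symmetry is what has to be proved.
\<close>

definition inner :: "('a \<Rightarrow> complex) \<Rightarrow> ('a \<Rightarrow> complex) \<Rightarrow> complex" where
  "inner f g = lim (\<lambda>n. pairing f (approx g n))"

lemma pairing_diff_bound:
  assumes "f \<in> carrier" "g \<in> carrier" "c \<in> F" "d \<in> F"
  shows "(cmod (pairing f c - pairing f d))\<^sup>2 \<le> norm_sq f * (2 * norm_sq (g - K c) + 2 * norm_sq (g - K d))"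
proof -
  have "E (c - d) = norm_sq (K c - K d)"
    using carrier_kernel_sum(2)[OF fin_supp_diff[OF assms(3,4)]] kernel_sum_diff[OF assms(3,4)] by simp
  also have "K c - K d = (g - K d) - (g - K c)" by simp
  also have "norm_sq \<dots> \<le> 2 * norm_sq (g - K d) + 2 * norm_sq (g - K c)"
    by (rule carrier_diff(2)) (use assms carrier_minus_kernel_sum in auto)
  finally have "E (c - d) \<le> 2 * norm_sq (g - K c) + 2 * norm_sq (g - K d)" by linarith
  from mult_left_mono[OF this norm_sq_nonneg[OF assms(1)]]
  have "norm_sq f * E (c - d) \<le> norm_sq f * (2 * norm_sq (g - K c) + 2 * norm_sq (g - K d))" .
  with cauchy_schwarz[OF assms(1) fin_supp_diff[OF assms(3,4)]] show ?thesis
    by (simp add: pairing_diff_right[OF assms(3,4)])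
qed

lemma inner_limit:
  assumes f: "f \<in> carrier" and g: "g \<in> carrier" and c: "\<And>n. c n \<in> F"
    and lim: "(\<lambda>n. norm_sq (g - K (c n))) \<longlonglongrightarrow> 0"
  shows "(\<lambda>n. pairing f (c n)) \<longlonglongrightarrow> inner f g"
proof -
  have "Cauchy (\<lambda>n. pairing f (approx g n))"
  proof (rule CauchyI)
    fix e :: real assume "e > 0"
    have "(\<lambda>n. norm_sq f * (4 * norm_sq (g - K (approx g n)))) \<longlonglongrightarrow> norm_sq f * (4 * 0)"
      by (intro tendsto_intros approx_tendsto g)
    then have "\<forall>\<^sub>F n in sequentially. norm_sq f * (4 * norm_sq (g - K (approx g n))) < e\<^sup>2"
      using \<open>e > 0\<close> by (intro order_tendstoD(2)[where y="norm_sq f * (4 * 0)"]) auto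
    then obtain N where N: "\<And>n. n \<ge> N \<Longrightarrow> norm_sq f * (4 * norm_sq (g - K (approx g n))) < e\<^sup>2"
      by (auto simp: eventually_sequentially)
    have "norm (pairing f (approx g m) - pairing f (approx g n)) < e" if "m \<ge> N" "n \<ge> N" for m n
    proof -
      have "(cmod (pairing f (approx g m) - pairing f (approx g n)))\<^sup>2 < e\<^sup>2"
        using pairing_diff_bound[OF f g approx(1)[OF g, of m] approx(1)[OF g, of n]] N[OF that(1)] N[OF that(2)]
        by (simp add: algebra_simps)
      then show ?thesis using \<open>e > 0\<close> by (simp add: power_less_imp_less_base)
    qed
    then show "\<exists>M. \<forall>m\<ge>M. \<forall>n\<ge>M. norm (pairing f (approx g m) - pairing f (approx g n)) < e" by blast
  qed
  then have conv: "(\<lambda>n. pairing f (approx g n)) \<longlonglongrightarrow> inner f g"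
    unfolding inner_def by (simp add: Cauchy_convergent convergent_LIMSEQ_iff[symmetric])
  have "(\<lambda>n. (cmod (pairing f (c n) - pairing f (approx g n)))\<^sup>2) \<longlonglongrightarrow> 0"
  proof (rule real_tendsto_sandwich[OF _ _ tendsto_const])
    show "(\<lambda>n. norm_sq f * (2 * norm_sq (g - K (c n)) + 2 * norm_sq (g - K (approx g n)))) \<longlonglongrightarrow> 0"
      using tendsto_mult[OF tendsto_const[of "norm_sq f"] tendsto_add[OF tendsto_mult[OF tendsto_const[of 2] lim] tendsto_mult[OF tendsto_const[of 2] approx_tendsto[OF g]]]]
      by simp
  qed (use pairing_diff_bound[OF f g c approx(1)[OF g]] in auto)
  then have "(\<lambda>n. pairing f (c n) - pairing f (approx g n)) \<longlonglongrightarrow> 0"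
    by (simp add: tendsto_norm_zero_iff power_tendsto_0_iff)
  from tendsto_add[OF this conv] show ?thesis by simp
qed

lemmas inner_approx = inner_limit[OF _ _ approx(1) approx_tendsto]

lemma inner_kernel_sum:
  assumes "f \<in> carrier" "c \<in> F"
  shows "inner f (K c) = pairing f c"
proof -
  have "(\<lambda>n::nat. pairing f c) \<longlonglongrightarrow> inner f (K c)"
    by (rule inner_limit) (use assms carrier_kernel_sum carrier_0 in auto)
  then show ?thesis by (simp add: LIMSEQ_const_iff)
qed

text \<open>
  Replacing \<open>f\<close> by its own approximants changes the pairings only by a null sequence, so the inner
  product is also the limit of the manifestly Hermitian quantities \<open>\<langle>k\<^sub>c, k\<^sub>d\<rangle>\<close>.
\<close>

lemma pairing_approx_diff:
  assumes f: "f \<in> carrier" and g: "g \<in> carrier"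
  shows "(\<lambda>n. pairing f (approx g n) - pairing (K (approx f n)) (approx g n)) \<longlonglongrightarrow> 0"
proof -
  let ?d = "approx g" and ?c = "approx f"
  note cF = approx(1)[OF f] and dF = approx(1)[OF g]
  have bd: "E (?d n) \<le> 2 * norm_sq g + 2" for n
  proof -
    have "K (?d n) = g - (g - K (?d n))" by simp
    then have "norm_sq (K (?d n)) \<le> 2 * norm_sq g + 2 * norm_sq (g - K (?d n))"
      using carrier_diff(2)[OF g carrier_minus_kernel_sum(1)[OF g dF[of n]]] by simp
    moreover have "1 / real (Suc n) \<le> 1" by simp
    ultimately show ?thesis
      using carrier_kernel_sum(2)[OF dF[of n]] approx(2)[OF g, of n] by linarith
  qed
  have "(\<lambda>n. (cmod (pairing f (?d n) - pairing (K (?c n)) (?d n)))\<^sup>2) \<longlonglongrightarrow> 0"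
  proof (rule real_tendsto_sandwich[OF _ _ tendsto_const])
    show "(\<lambda>n. norm_sq (f - K (?c n)) * (2 * norm_sq g + 2)) \<longlonglongrightarrow> 0"
      using tendsto_mult[OF approx_tendsto[OF f] tendsto_const[of "2 * norm_sq g + 2"]] by simp
    have "(cmod (pairing f (?d n) - pairing (K (?c n)) (?d n)))\<^sup>2 \<le> norm_sq (f - K (?c n)) * (2 * norm_sq g + 2)" for n
    proof -
      have m: "f - K (?c n) \<in> carrier" by (rule carrier_minus_kernel_sum(1)[OF f cF])
      show ?thesis
        using cauchy_schwarz[OF m dF[of n]] mult_left_mono[OF bd[of n] norm_sq_nonneg[OF m]]
        by (simp add: pairing_diff_left)
    qed
    then show "\<forall>\<^sub>F n in sequentially. (cmod (pairing f (?d n) - pairing (K (?c n)) (?d n)))\<^sup>2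
        \<le> norm_sq (f - K (?c n)) * (2 * norm_sq g + 2)" by simp
  qed auto
  then show ?thesis by (simp add: tendsto_norm_zero_iff power_tendsto_0_iff)
qed

lemma inner_limit_approx:
  assumes "f \<in> carrier" "g \<in> carrier"
  shows "(\<lambda>n. pairing (K (approx f n)) (approx g n)) \<longlonglongrightarrow> inner f g"
  using tendsto_diff[OF inner_approx[OF assms assms(2) assms(2)] pairing_approx_diff[OF assms]] by simp

lemma inner_commute:
  assumes "f \<in> carrier" "g \<in> carrier"
  shows "inner g f = cnj (inner f g)"
proof -
  have "(\<lambda>n. cnj (pairing (K (approx f n)) (approx g n))) \<longlonglongrightarrow> cnj (inner f g)"
    by (intro tendsto_cnj inner_limit_approx assms)
  moreover have "cnj (pairing (K (approx f n)) (approx g n)) = pairing (K (approx g n)) (approx f n)" for n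
    using pairing_kernel_sum_commute[OF approx(1)[OF assms(2)] approx(1)[OF assms(1)], of n n] by simp
  ultimately have "(\<lambda>n. pairing (K (approx g n)) (approx f n)) \<longlonglongrightarrow> cnj (inner f g)" by simp
  then show ?thesis by (rule LIMSEQ_unique[OF inner_limit_approx[OF assms(2,1)]])
qed

lemma inner_self:
  assumes f: "f \<in> carrier"
  shows "inner f f = of_real (norm_sq f)"
proof -
  have 1: "(\<lambda>n. 2 * Re (pairing f (approx f n)) - Re (pairing (K (approx f n)) (approx f n))) \<longlonglongrightarrow> 2 * Re (inner f f) - Re (inner f f)"
    by (intro tendsto_intros inner_limit_approx inner_approx f)
  have "(\<lambda>n. norm_sq f - gain f (approx f n)) \<longlonglongrightarrow> 0"
    using approx_tendsto[OF f] carrier_minus_kernel_sum(2)[OF f approx(1)[OF f]] by simp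
  from tendsto_diff[OF tendsto_const[of "norm_sq f"] this]
  have "(\<lambda>n. gain f (approx f n)) \<longlonglongrightarrow> norm_sq f" by simp
  from LIMSEQ_unique[OF this 1[folded energy_def gain_def]]
  have "norm_sq f = Re (inner f f)" by simp
  moreover have "Im (inner f f) = 0"
    using arg_cong[OF inner_commute[OF f f], of Im] by simp
  ultimately show ?thesis by (simp add: complex_eq_iff)
qed

definition delta :: "'a \<Rightarrow> 'a \<Rightarrow> complex" where "delta z = (\<lambda>x. if x = z then 1 else 0)"

lemma delta_supp: "{x. delta z x \<noteq> 0} = {z}" by (auto simp: delta_def)

lemma delta_in: "z \<in> D \<Longrightarrow> delta z \<in> F"
  by (simp add: fin_supp_def delta_supp)

lemma kernel_sum_delta: "K (delta z) = (\<lambda>x. if x \<in> D then k x z else 0)"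
  unfolding kernel_sum_def delta_supp by (simp add: delta_def fun_eq_iff)

lemma pairing_delta: "pairing f (delta z) = f z"
  unfolding pairing_def delta_supp by (simp add: delta_def)

lemma reproducing:
  assumes "f \<in> carrier" "z \<in> D"
  shows "inner f (\<lambda>x. if x \<in> D then k x z else 0) = f z"
  using inner_kernel_sum[OF assms(1) delta_in[OF assms(2)]]
  by (simp add: kernel_sum_delta pairing_delta)

text \<open>
  Evaluations are bounded, so a Cauchy sequence converges pointwise; each single gain passes to the
  pointwise limit, hence so do bounds on the supremum.
\<close>

lemma carrier_complete:
  assumes X: "\<And>n. X n \<in> carrier"
    and Cau: "\<And>e. 0 < e \<Longrightarrow> \<exists>N. \<forall>m\<ge>N. \<forall>n\<ge>N. sqrt (norm_sq (X m - X n)) < e"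
  shows "\<exists>f\<in>carrier. (\<lambda>n. sqrt (norm_sq (X n - f))) \<longlonglongrightarrow> 0"
proof -
  have Xd: "X m - X n \<in> carrier" for m n by (intro carrier_diff X)
  have "convergent (\<lambda>n. X n z)" for z
  proof (cases "z \<in> D")
    case False
    then have "X n z = 0" for n using X by (auto simp: carrier_def)
    then show ?thesis by (simp add: convergent_const)
  next
    case True
    have E0: "0 \<le> E (delta z)" by (rule psd[OF delta_in[OF True]])
    have "Cauchy (\<lambda>n. X n z)"
    proof (rule CauchyI)
      fix e :: real assume e: "e > 0"
      define e' where "e' = e / (1 + sqrt (E (delta z)))"
      have e': "e' > 0" using e E0 by (simp add: e'_def add_pos_nonneg)
      obtain N where N: "\<And>m n. m \<ge> N \<Longrightarrow> n \<ge> N \<Longrightarrow> sqrt (norm_sq (X m - X n)) < e'"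
        using Cau[OF e'] by blast
      have "norm (X m z - X n z) < e" if "m \<ge> N" "n \<ge> N" for m n
      proof -
        have "(cmod (X m z - X n z))\<^sup>2 \<le> norm_sq (X m - X n) * E (delta z)"
          using cauchy_schwarz[OF Xd[of m n] delta_in[OF True]] by (simp add: pairing_delta)
        then have "cmod (X m z - X n z) \<le> sqrt (norm_sq (X m - X n)) * sqrt (E (delta z))"
          by (simp add: real_le_rsqrt flip: real_sqrt_mult)
        also have "\<dots> \<le> e' * sqrt (E (delta z))"
          using N[OF that] E0 by (intro mult_right_mono) auto
        also have "\<dots> < e' * (1 + sqrt (E (delta z)))" using e' by simp
        also have "\<dots> = e"
        proof -
          have "1 + sqrt (E (delta z)) \<noteq> 0" using real_sqrt_ge_zero[OF E0] by linarith
          then show ?thesis by (simp add: e'_def)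
        qed
        finally show ?thesis .
      qed
      then show "\<exists>M. \<forall>m\<ge>M. \<forall>n\<ge>M. norm (X m z - X n z) < e" by blast
    qed
    then show ?thesis by (rule Cauchy_convergent)
  qed
  then have flim: "\<And>z. (\<lambda>n. X n z) \<longlonglongrightarrow> lim (\<lambda>n. X n z)" by (simp only: convergent_LIMSEQ_iff)
  obtain f where f: "\<And>z. (\<lambda>n. X n z) \<longlonglongrightarrow> f z"
    using that[of "\<lambda>z. lim (\<lambda>n. X n z)"] flim by blast
  have off: "f z = 0" if "z \<notin> D" for z
  proof -
    have "X n z = 0" for n using X that by (auto simp: carrier_def)
    then show ?thesis using f[of z] by (simp add: LIMSEQ_const_iff)
  qed
  have close: "X n - f \<in> carrier \<and> norm_sq (X n - f) \<le> e\<^sup>2"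
    if e: "e > 0" and N: "\<And>m. m \<ge> N \<Longrightarrow> sqrt (norm_sq (X n - X m)) < e" for n N e
  proof -
    have "gain (X n - f) c \<le> e\<^sup>2" if c: "c \<in> F" for c
    proof -
      have "(\<lambda>m. gain (X n - X m) c) \<longlonglongrightarrow> gain (X n - f) c"
        unfolding gain_def pairing_def minus_apply by (intro tendsto_intros f)
      then show ?thesis
      proof (rule LIMSEQ_le_const2)
        have "gain (X n - X m) c \<le> e\<^sup>2" if "m \<ge> N" for m
        proof -
          have "(sqrt (norm_sq (X n - X m)))\<^sup>2 \<le> e\<^sup>2" using N[OF that] norm_sq_nonneg[OF Xd]
            by (intro power_mono) auto
          then show ?thesis using gain_le[OF Xd c, of n m] norm_sq_nonneg[OF Xd, of n m] by simp
        qed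
        then show "\<exists>N. \<forall>m\<ge>N. gain (X n - X m) c \<le> e\<^sup>2" by blast
      qed
    qed
    moreover have "(X n - f) z = 0" if "z \<notin> D" for z
      using off[OF that] X[of n] that by (auto simp: carrier_def)
    ultimately show ?thesis using carrierI by blast
  qed
  obtain N1 where N1: "\<And>m n. m \<ge> N1 \<Longrightarrow> n \<ge> N1 \<Longrightarrow> sqrt (norm_sq (X m - X n)) < 1"
    using Cau[of 1] by auto
  have "X N1 - f \<in> carrier" using close[of 1 N1 N1] N1 by auto
  from carrier_diff(1)[OF X[of N1] this] have fc: "f \<in> carrier" by simp
  have "(\<lambda>n. sqrt (norm_sq (X n - f))) \<longlonglongrightarrow> 0"
  proof (rule LIMSEQ_I)
    fix r :: real assume r: "r > 0"
    obtain N where N: "\<And>m n. m \<ge> N \<Longrightarrow> n \<ge> N \<Longrightarrow> sqrt (norm_sq (X m - X n)) < r/2"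
      using Cau[of "r/2"] r by auto
    have "norm (sqrt (norm_sq (X n - f)) - 0) < r" if "n \<ge> N" for n
    proof -
      have "norm_sq (X n - f) \<le> (r/2)\<^sup>2" using close[of "r/2" N n] N that r by auto
      then have "sqrt (norm_sq (X n - f)) \<le> r/2" using r by (intro real_le_lsqrt) auto
      then show ?thesis using r norm_sq_nonneg[OF carrier_diff(1)[OF X[of n] fc]] by simp
    qed
    then show "\<exists>no. \<forall>n\<ge>no. norm (sqrt (norm_sq (X n - f)) - 0) < r" by blast
  qed
  with fc show ?thesis by blast
qed

lemma hilbert: "complex_hilbert_space scale_fun carrier inner"
proof -
  interpret vector_space "scale_fun :: complex \<Rightarrow> ('a \<Rightarrow> complex) \<Rightarrow> 'a \<Rightarrow> complex" by (rule vector_space_scale_fun)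
  show ?thesis
  proof
    show "subspace carrier"
      by (intro subspaceI carrier_0 carrier_add(1) carrier_scale(1))
    fix x y z :: "'a \<Rightarrow> complex"
    show "inner (x + y) z = inner x z + inner y z" if "x \<in> carrier" "y \<in> carrier" "z \<in> carrier"
    proof -
      have "(\<lambda>n. pairing (x + y) (approx z n)) \<longlonglongrightarrow> inner x z + inner y z"
        unfolding pairing_add_left by (intro tendsto_add inner_approx that)
      then show ?thesis using inner_approx[OF carrier_add(1)[OF that(1,2)] that(3,3,3)] LIMSEQ_unique by blast
    qed
    show "inner (scale_fun c x) y = c * inner x y" if "x \<in> carrier" "y \<in> carrier" for c
    proof -
      have "(\<lambda>n. pairing (scale_fun c x) (approx y n)) \<longlonglongrightarrow> c * inner x y"
        unfolding pairing_scale_left by (intro tendsto_mult tendsto_const inner_approx that)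
      then show ?thesis using inner_approx[OF carrier_scale(1)[OF that(1)] that(2,2,2)] LIMSEQ_unique by blast
    qed
    show "inner y x = cnj (inner x y)" if "x \<in> carrier" "y \<in> carrier"
      by (rule inner_commute[OF that])
    show "0 < inner x x" if x: "x \<in> carrier" and "x \<noteq> 0"
    proof -
      obtain z where z: "x z \<noteq> 0" using \<open>x \<noteq> 0\<close> by (auto simp: fun_eq_iff)
      then have "z \<in> D" using x by (auto simp: carrier_def)
      then have "(cmod (x z))\<^sup>2 \<le> norm_sq x * E (delta z)"
        using cauchy_schwarz[OF x delta_in[of z]] by (simp add: pairing_delta)
      moreover have "0 < (cmod (x z))\<^sup>2" using z by simp
      ultimately have "0 < norm_sq x * E (delta z)" by linarith
      then have "0 < norm_sq x" using norm_sq_nonneg[OF x] by (cases "norm_sq x = 0") auto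
      then show ?thesis by (simp add: inner_self[OF x] less_complex_def)
    qed
  next
    fix X :: "nat \<Rightarrow> 'a \<Rightarrow> complex"
    assume X: "\<And>n. X n \<in> carrier"
      and C: "\<And>e. 0 < e \<Longrightarrow> \<exists>N. \<forall>m\<ge>N. \<forall>n\<ge>N. sqrt (Re (inner (X m - X n) (X m - X n))) < e"
    have "\<exists>f\<in>carrier. (\<lambda>n. sqrt (norm_sq (X n - f))) \<longlonglongrightarrow> 0"
      by (rule carrier_complete[OF X]) (use C in \<open>simp add: inner_self carrier_diff X\<close>)
    then show "\<exists>x\<in>carrier. (\<lambda>n. sqrt (Re (inner (X n - x) (X n - x)))) \<longlonglongrightarrow> 0"
      by (auto simp: inner_self carrier_diff X)
  qed
qed

sublocale complex_hilbert_space scale_fun carrier inner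
  by (rule hilbert)

lemma hnorm_eq: "f \<in> carrier \<Longrightarrow> hnorm f = sqrt (norm_sq f)"
  by (simp add: hnorm_def inner_self)

lemma kernel_sum_in_span:
  assumes "c \<in> F"
  shows "K c \<in> span ((\<lambda>z x. if x \<in> D then k x z else 0) ` D)"
proof -
  have "K c = (\<Sum>z | c z \<noteq> 0. scale_fun (c z) (\<lambda>x. if x \<in> D then k x z else 0))"
  proof
    fix y
    have "(\<Sum>z | c z \<noteq> 0. scale_fun (c z) (\<lambda>x. if x \<in> D then k x z else 0)) y
      = (\<Sum>z | c z \<noteq> 0. scale_fun (c z) (\<lambda>x. if x \<in> D then k x z else 0) y)"
      by (induction rule: infinite_finite_induct) auto
    then show "K c y = (\<Sum>z | c z \<noteq> 0. scale_fun (c z) (\<lambda>x. if x \<in> D then k x z else 0)) y"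
      by (auto simp: kernel_sum_def scale_fun_def mult.commute)
  qed
  also have "\<dots> \<in> span ((\<lambda>z x. if x \<in> D then k x z else 0) ` D)"
    by (intro span_sum span_scale span_base) (use assms in \<open>auto simp: fin_supp_def\<close>)
  finally show ?thesis .
qed

lemma total_kernel_functions: "total ((\<lambda>z x. if x \<in> D then k x z else 0) ` D)"
  unfolding total_def
proof (intro conjI ballI allI impI subsetI)
  fix g assume "g \<in> (\<lambda>z x. if x \<in> D then k x z else 0) ` D"
  then show "g \<in> carrier" using carrier_kernel_sum(1) delta_in kernel_sum_delta by force
next
  fix f and e :: real assume f: "f \<in> carrier" and e: "e > 0"
  obtain c where c: "c \<in> F" "norm_sq (f - K c) < e\<^sup>2" using approx_exists[OF f, of "e\<^sup>2"] e by auto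
  have "hnorm (f - K c) < e"
    using c e real_sqrt_less_mono[OF c(2)] by (simp add: hnorm_eq carrier_minus_kernel_sum f)
  then show "\<exists>y\<in>span ((\<lambda>z x. if x \<in> D then k x z else 0) ` D). hnorm (f - y) < e"
    using kernel_sum_in_span[OF c(1)] by blast
qed

text \<open>
  Multiplication by \<open>q\<close> moves onto the competitor as \<open>c \<mapsto> cnj q * c\<close>, the action of its adjoint. If this
  action increases the energy at most by the factor \<open>C\<^sup>2\<close>, the operator has norm at most \<open>C\<close>.
\<close>

lemma multiplier_bound:
  assumes f: "f \<in> carrier" and C: "C > 0"
    and q: "\<And>c. c \<in> F \<Longrightarrow> E (\<lambda>x. cnj (q x) * c x) \<le> C\<^sup>2 * E c"
  shows "(\<lambda>z. q z * f z) \<in> carrier" "hnorm (\<lambda>z. q z * f z) \<le> C * hnorm f"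
proof -
  have off: "q z * f z = 0" if "z \<notin> D" for z
    using f that by (auto simp: carrier_def)
  have le: "gain (\<lambda>z. q z * f z) c \<le> C\<^sup>2 * norm_sq f" if c: "c \<in> F" for c
  proof -
    \<comment> \<open>the scaling that makes the gain of \<open>q f\<close> at \<open>c\<close> at most \<open>C\<^sup>2\<close> times the gain of \<open>f\<close> at \<open>d\<close>\<close>
    define d where "d = scale_fun (of_real (1 / C\<^sup>2)) (\<lambda>x. cnj (q x) * c x)"
    have qc: "(\<lambda>x. cnj (q x) * c x) \<in> F" by (rule fin_supp_mult[OF c])
    have "pairing (\<lambda>z. q z * f z) c = pairing f (\<lambda>x. cnj (q x) * c x)"
      using pairing_mult_right[OF c, of f "\<lambda>x. cnj (q x)"] by simp
    also have "\<dots> = of_real (C\<^sup>2) * pairing f d"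
      using C by (simp add: d_def pairing_scale_right[OF qc])
    finally have 1: "pairing (\<lambda>z. q z * f z) c = of_real (C\<^sup>2) * pairing f d" .
    have "C\<^sup>2 * E d = E (\<lambda>x. cnj (q x) * c x) / C\<^sup>2"
      unfolding d_def energy_scale[OF qc] norm_of_real using C by (simp add: power2_eq_square field_simps)
    also have "\<dots> \<le> E c" using q[OF c] C by (simp add: field_simps)
    finally have "gain (\<lambda>z. q z * f z) c \<le> C\<^sup>2 * gain f d"
      by (simp only: gain_def 1 Re_complex_of_real right_diff_distrib) simp
    also have "\<dots> \<le> C\<^sup>2 * norm_sq f"
      by (intro mult_left_mono gain_le[OF f]) (auto simp: d_def fin_supp_scale qc)
    finally show ?thesis .
  qed
  show m: "(\<lambda>z. q z * f z) \<in> carrier" using carrierI(1)[OF off le] by auto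
  have "norm_sq (\<lambda>z. q z * f z) \<le> C\<^sup>2 * norm_sq f" using carrierI(2)[OF off le] by auto
  from real_sqrt_le_mono[OF this] show "hnorm (\<lambda>z. q z * f z) \<le> C * hnorm f"
    using C by (simp add: hnorm_eq f m real_sqrt_mult)
qed

end


section \<open>Polynomial functions on the symmetrized bidisk\<close>

lemma sym_bidisk_bounds:
  assumes "z \<in> sym_bidisk"
  shows "cmod (fst z) \<le> 2" "cmod (snd z) \<le> 1"
proof -
  obtain z1 z2 where z: "z = (z1 + z2, z1 * z2)" "cmod z1 < 1" "cmod z2 < 1"
    using assms by (auto simp: sym_bidisk_def)
  show "cmod (fst z) \<le> 2" using norm_triangle_ineq[of z1 z2] z by simp
  show "cmod (snd z) \<le> 1" using z by (simp add: norm_mult mult_le_one)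
qed

definition polyfuns :: "(complex \<times> complex \<Rightarrow> complex) set" where
  "polyfuns = range eval2"

lemma polyfunsI: "(\<And>s p. g (s, p) = poly (poly f [:p:]) s) \<Longrightarrow> g \<in> polyfuns"
  unfolding polyfuns_def by (rule range_eqI[of _ _ f]) (auto simp: eval2_eq_poly fun_eq_iff)

lemma polyfunsE:
  assumes "g \<in> polyfuns"
  obtains f where "\<And>s p. g (s, p) = poly (poly f [:p:]) s" "g = eval2 f"
  using assms by (auto simp: polyfuns_def eval2_eq_poly)

lemma polyfuns_const: "(\<lambda>z. a) \<in> polyfuns"
  by (rule polyfunsI[of _ "[:[:a:]:]"]) simp

lemma polyfuns_fst: "fst \<in> polyfuns"
  by (rule polyfunsI[of _ "[:[:0, 1:]:]"]) simp

lemma polyfuns_snd: "snd \<in> polyfuns"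
  by (rule polyfunsI[of _ "[:0, 1:]"]) simp

lemma polyfuns_add: "g \<in> polyfuns \<Longrightarrow> h \<in> polyfuns \<Longrightarrow> (\<lambda>z. g z + h z) \<in> polyfuns"
  by (elim polyfunsE, rule polyfunsI[of _ "_ + _"]) simp

lemma polyfuns_mult: "g \<in> polyfuns \<Longrightarrow> h \<in> polyfuns \<Longrightarrow> (\<lambda>z. g z * h z) \<in> polyfuns"
  by (elim polyfunsE, rule polyfunsI[of _ "_ * _"]) simp

lemma polyfuns_diff: "g \<in> polyfuns \<Longrightarrow> h \<in> polyfuns \<Longrightarrow> (\<lambda>z. g z - h z) \<in> polyfuns"
  by (elim polyfunsE, rule polyfunsI[of _ "_ - _"]) simp

lemma polyfuns_sum: "(\<And>i. i \<in> I \<Longrightarrow> g i \<in> polyfuns) \<Longrightarrow> (\<lambda>z. \<Sum>i\<in>I. g i z) \<in> polyfuns"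
  by (induction I rule: infinite_finite_induct) (auto intro: polyfuns_const polyfuns_add)

lemma polyfuns_prod: "(\<And>i. i \<in> I \<Longrightarrow> g i \<in> polyfuns) \<Longrightarrow> (\<lambda>z. \<Prod>i\<in>I. g i z) \<in> polyfuns"
  by (induction I rule: infinite_finite_induct) (auto intro: polyfuns_const polyfuns_mult)

lemma polyfuns_power: "g \<in> polyfuns \<Longrightarrow> (\<lambda>z. g z ^ n) \<in> polyfuns"
  by (induction n) (auto intro: polyfuns_const polyfuns_mult)

lemma polyfuns_bounded:
  assumes "g \<in> polyfuns"
  obtains B where "B > 0" "\<And>z. z \<in> sym_bidisk \<Longrightarrow> cmod (g z) \<le> B"
proof -
  obtain f where f: "g = eval2 f" using assms by (auto simp: polyfuns_def)
  define B where "B = (\<Sum>j\<le>degree f. \<Sum>i\<le>degree (coeff f j). cmod (coeff (coeff f j) i) * (2 ^ i * 1 ^ j))"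
  have "cmod (g z) \<le> B" if z: "z \<in> sym_bidisk" for z
    unfolding f eval2_def B_def
    by (intro sum_norm_le) (auto simp: norm_mult norm_power intro!: mult_left_mono mult_mono power_mono power_le_one sym_bidisk_bounds z
        simp del: power_one)
  then have "cmod (g z) \<le> \<bar>B\<bar> + 1" if z: "z \<in> sym_bidisk" for z using that by fastforce
  then show ?thesis using that[of "\<bar>B\<bar> + 1"] by simp
qed

lemma sym_bidisk_0: "(0, 0) \<in> sym_bidisk"
  unfolding sym_bidisk_def by (rule CollectI, rule exI[of _ 0], rule exI[of _ 0]) simp

lemma sup_norm_eval2_upper:
  assumes "z \<in> sym_bidisk"
  shows "cmod (eval2 f z) \<le> sup_norm (eval2 f)"
proof -
  obtain B where "\<And>z. z \<in> sym_bidisk \<Longrightarrow> cmod (eval2 f z) \<le> B"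
    using polyfuns_bounded[of "eval2 f"] unfolding polyfuns_def by blast
  then show ?thesis unfolding sup_norm_def
    by (intro cSUP_upper bdd_aboveI2 assms)
qed

lemma sup_norm_le: "(\<And>z. z \<in> sym_bidisk \<Longrightarrow> cmod (f z) \<le> B) \<Longrightarrow> sup_norm f \<le> B"
  unfolding sup_norm_def using sym_bidisk_0 by (intro cSUP_least) auto

definition polyball :: "(complex \<times> complex \<Rightarrow> complex) set" where
  "polyball = {g \<in> polyfuns. \<forall>z\<in>sym_bidisk. cmod (g z) \<le> 1}"

section \<open>Gamma-contractions give the Pick condition for polynomials\<close>

lemma mult_s_power: "(mult_s ^^ i) f = (\<lambda>z. fst z ^ i * f z)"
  by (induction i) (auto simp: mult_s_def fun_eq_iff)

lemma mult_p_power: "(mult_p ^^ i) f = (\<lambda>z. snd z ^ i * f z)"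
  by (induction i) (auto simp: mult_p_def fun_eq_iff)

lemma fun_sum_apply: "(\<Sum>i\<in>I. g i) z = (\<Sum>i\<in>I. g i z)" for g :: "'i \<Rightarrow> 'a \<Rightarrow> complex"
  by (induction I rule: infinite_finite_induct) auto

lemma eval2_operator_mult:
  fixes H :: "(complex \<times> complex \<Rightarrow> complex) set"
  assumes "complex_hilbert_space scale_fun H ip"
  shows "complex_hilbert_space.eval2_operator scale_fun f mult_s mult_p x = (\<lambda>z. eval2 f z * x z)"
proof -
  interpret complex_hilbert_space scale_fun H ip by (rule assms)
  show ?thesis
    by (rule ext) (simp add: complex_hilbert_space.eval2_operator_def[OF assms] fun_sum_apply mult_s_power mult_p_power scale_fun_def eval2_def
      sum_distrib_right mult.assoc)
qed

context complex_hilbert_space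
begin

lemma ip_add_right: "x \<in> H \<Longrightarrow> y \<in> H \<Longrightarrow> z \<in> H \<Longrightarrow> ip z (x + y) = ip z x + ip z y"
  using ip_commute[of "x + y" z] ip_commute[of x z] ip_commute[of y z] ip_add_left[of x y z]
    subspace_add[OF subspace_carrier] by simp

lemma ip_scale_right: "x \<in> H \<Longrightarrow> z \<in> H \<Longrightarrow> ip z (c *\<^sub>C x) = cnj c * ip z x"
  using ip_commute[of "c *\<^sub>C x" z] ip_commute[of x z] ip_scale_left[of x z c]
    subspace_scale[OF subspace_carrier] by simp

lemma zero_in: "0 \<in> H" by (rule subspace_0[OF subspace_carrier])

lemma ip_0_left: "x \<in> H \<Longrightarrow> ip 0 x = 0"
  using ip_scale_left[OF zero_in, of x 0] by simp

lemma ip_0_right: "x \<in> H \<Longrightarrow> ip x 0 = 0"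
  using ip_scale_right[OF zero_in, of x 0] by simp

lemma ip_self_nonneg: "x \<in> H \<Longrightarrow> 0 \<le> Re (ip x x)"
  using ip_pos[of x] ip_0_left[of x] zero_in by (cases "x = 0") (auto simp: less_complex_def)

lemma hnorm_sq: "x \<in> H \<Longrightarrow> (hnorm x)\<^sup>2 = Re (ip x x)"
  by (simp add: hnorm_def ip_self_nonneg)

lemma hnorm_ge_0: "x \<in> H \<Longrightarrow> 0 \<le> hnorm x"
  by (simp add: hnorm_def ip_self_nonneg)

lemma ip_sum_right:
  "(\<And>i. i \<in> I \<Longrightarrow> x i \<in> H) \<Longrightarrow> z \<in> H \<Longrightarrow> ip z (\<Sum>i\<in>I. x i) = (\<Sum>i\<in>I. ip z (x i))"
  by (induction I rule: infinite_finite_induct)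
    (auto simp: ip_0_right ip_add_right subspace_sum[OF subspace_carrier])

lemma hnorm_sq_scale: "x \<in> H \<Longrightarrow> (hnorm (c *\<^sub>C x))\<^sup>2 = (cmod c)\<^sup>2 * (hnorm x)\<^sup>2"
proof -
  assume x: "x \<in> H"
  have "ip (c *\<^sub>C x) (c *\<^sub>C x) = (cnj c * c) * ip x x"
    using x by (simp add: ip_scale_left ip_scale_right subspace_scale[OF subspace_carrier])
  then show ?thesis using x
    by (simp only: hnorm_sq subspace_scale[OF subspace_carrier] cnj_times_self Re_of_real_times)
qed

lemma two_Re_ip_le:
  assumes "x \<in> H" "y \<in> H"
  shows "2 * Re (ip x y) \<le> (hnorm x)\<^sup>2 + (hnorm y)\<^sup>2"
proof -
  let ?z = "x + (-1) *\<^sub>C y"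
  have y: "(-1) *\<^sub>C y \<in> H" by (rule subspace_scale[OF subspace_carrier assms(2)])
  have z: "?z \<in> H" by (rule subspace_add[OF subspace_carrier assms(1) y])
  have "0 \<le> Re (ip ?z ?z)" by (rule ip_self_nonneg[OF z])
  also have "ip ?z ?z = ip x x - ip x y - ip y x + ip y y"
    by (simp only: ip_add_left[OF assms(1) y z] ip_add_right[OF assms(1) y assms(1)] ip_add_right[OF assms(1) y y]
        ip_scale_left[OF assms(2,1)] ip_scale_left[OF assms(2) y] ip_scale_right[OF assms(2,1)] ip_scale_right[OF assms(2,2)]) simp
  also have "ip y x = cnj (ip x y)" by (rule ip_commute[OF assms])
  finally show ?thesis using assms by (simp add: hnorm_sq)
qed

lemma hnorm_sq_add_le:
  assumes "x \<in> H" "y \<in> H"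
  shows "(hnorm (x + y))\<^sup>2 \<le> 2 * (hnorm x)\<^sup>2 + 2 * (hnorm y)\<^sup>2"
proof -
  have "ip (x + y) (x + y) = ip x x + ip x y + ip y x + ip y y"
    using assms subspace_add[OF subspace_carrier assms] by (simp add: ip_add_left ip_add_right)
  moreover have "ip y x = cnj (ip x y)" by (rule ip_commute[OF assms])
  ultimately show ?thesis using assms two_Re_ip_le[OF assms] subspace_add[OF subspace_carrier assms]
    by (simp add: hnorm_sq)
qed

text \<open>
  Boundedness of polynomials in the two operators is needed only because the operator norm is defined
  as a real supremum, which bounds its members only if it is finite. Squared norms spare the
  triangle inequality.
\<close>

definition bdd_map :: "('v \<Rightarrow> 'v) \<Rightarrow> bool" where
  "bdd_map T \<longleftrightarrow> T \<in> H \<rightarrow> H \<and> (\<exists>B. \<forall>x\<in>H. (hnorm (T x))\<^sup>2 \<le> B * (hnorm x)\<^sup>2)"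

lemma bdd_map_bounded_operator:
  assumes "bounded_operator T"
  shows "bdd_map T"
proof -
  obtain B where B: "\<And>x. x \<in> H \<Longrightarrow> hnorm (T x) \<le> B * hnorm x" and T: "T \<in> H \<rightarrow> H"
    using assms unfolding bounded_operator_def by blast
  have "(hnorm (T x))\<^sup>2 \<le> B\<^sup>2 * (hnorm x)\<^sup>2" if "x \<in> H" for x
    using power_mono[OF B[OF that] hnorm_ge_0, of 2] T that by (auto simp: power_mult_distrib)
  with T show ?thesis unfolding bdd_map_def by blast
qed

lemma bdd_map_0: "bdd_map (\<lambda>x. 0)"
  unfolding bdd_map_def using zero_in by (auto simp: hnorm_sq ip_0_left intro!: exI[of _ 0])

lemma bdd_map_comp:
  assumes "bdd_map S" "bdd_map T"
  shows "bdd_map (\<lambda>x. S (T x))"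
proof -
  obtain A B where A: "\<And>x. x \<in> H \<Longrightarrow> (hnorm (S x))\<^sup>2 \<le> A * (hnorm x)\<^sup>2"
    and B: "\<And>x. x \<in> H \<Longrightarrow> (hnorm (T x))\<^sup>2 \<le> B * (hnorm x)\<^sup>2" and ST: "S \<in> H \<rightarrow> H" "T \<in> H \<rightarrow> H"
    using assms unfolding bdd_map_def by blast
  have "(hnorm (S (T x)))\<^sup>2 \<le> (\<bar>A\<bar> * B) * (hnorm x)\<^sup>2" if x: "x \<in> H" for x
  proof -
    have "T x \<in> H" using ST x by auto
    then have "(hnorm (S (T x)))\<^sup>2 \<le> A * (hnorm (T x))\<^sup>2" by (rule A)
    also have "\<dots> \<le> \<bar>A\<bar> * (hnorm (T x))\<^sup>2" by (intro mult_right_mono) auto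
    also have "\<dots> \<le> \<bar>A\<bar> * (B * (hnorm x)\<^sup>2)" by (intro mult_left_mono B x) auto
    finally show ?thesis by (simp add: mult.assoc)
  qed
  with ST show ?thesis unfolding bdd_map_def by blast
qed

lemma bdd_map_scale:
  assumes "bdd_map T"
  shows "bdd_map (\<lambda>x. c *\<^sub>C T x)"
proof -
  have "bdd_map (\<lambda>x. c *\<^sub>C x)"
    unfolding bdd_map_def by (auto simp: hnorm_sq_scale subspace_scale[OF subspace_carrier])
  from bdd_map_comp[OF this assms] show ?thesis .
qed

lemma bdd_map_add:
  assumes "bdd_map S" "bdd_map T"
  shows "bdd_map (\<lambda>x. S x + T x)"
proof -
  obtain A B where A: "\<And>x. x \<in> H \<Longrightarrow> (hnorm (S x))\<^sup>2 \<le> A * (hnorm x)\<^sup>2"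
    and B: "\<And>x. x \<in> H \<Longrightarrow> (hnorm (T x))\<^sup>2 \<le> B * (hnorm x)\<^sup>2" and ST: "S \<in> H \<rightarrow> H" "T \<in> H \<rightarrow> H"
    using assms unfolding bdd_map_def by blast
  have "(hnorm (S x + T x))\<^sup>2 \<le> (2 * A + 2 * B) * (hnorm x)\<^sup>2" if x: "x \<in> H" for x
    using hnorm_sq_add_le[of "S x" "T x"] A[OF x] B[OF x] ST x by (auto simp: algebra_simps Pi_iff)
  with ST show ?thesis unfolding bdd_map_def
    by (auto intro!: subspace_add[OF subspace_carrier])
qed

lemma bdd_map_sum: "(\<And>i. i \<in> I \<Longrightarrow> bdd_map (T i)) \<Longrightarrow> bdd_map (\<lambda>x. \<Sum>i\<in>I. T i x)"
  by (induction I rule: infinite_finite_induct) (auto intro: bdd_map_0 bdd_map_add)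

lemma bdd_map_funpow: "bdd_map S \<Longrightarrow> bdd_map T \<Longrightarrow> bdd_map (\<lambda>x. (S ^^ i) (T x))"
  by (induction i) (auto intro: bdd_map_comp[of S])

lemma bdd_map_eval2_operator:
  assumes "bdd_map S" "bdd_map P"
  shows "bdd_map (eval2_operator f S P)"
proof -
  have "bdd_map (\<lambda>x. x)" unfolding bdd_map_def by (auto intro!: exI[of _ 1])
  then have "bdd_map (\<lambda>x. \<Sum>j\<le>degree f. \<Sum>i\<le>degree (coeff f j). coeff (coeff f j) i *\<^sub>C (S ^^ i) ((P ^^ j) x))"
    by (intro bdd_map_sum bdd_map_scale bdd_map_funpow assms)
  then show ?thesis unfolding eval2_operator_def[abs_def] .
qed

lemma Gamma_contraction_hnorm:
  assumes G: "Gamma_contraction S P" and x: "x \<in> H" "hnorm x \<le> 1"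
  shows "hnorm (eval2_operator f S P x) \<le> sup_norm (eval2 f)"
proof -
  let ?T = "eval2_operator f S P"
  have "bdd_map ?T"
    using G by (intro bdd_map_eval2_operator bdd_map_bounded_operator) (auto simp: Gamma_contraction_def)
  then obtain B where B: "\<And>x. x \<in> H \<Longrightarrow> (hnorm (?T x))\<^sup>2 \<le> B * (hnorm x)\<^sup>2"
    by (auto simp: bdd_map_def)
  have bound: "hnorm (?T y) \<le> \<bar>B\<bar> + 1" if "y \<in> {y \<in> H. hnorm y \<le> 1}" for y
  proof -
    have "(hnorm (?T y))\<^sup>2 \<le> B * (hnorm y)\<^sup>2" using B that by simp
    also have "\<dots> \<le> \<bar>B\<bar> * 1\<^sup>2" using that by (intro mult_mono power_mono) (auto simp: hnorm_ge_0)
    also have "\<dots> \<le> (\<bar>B\<bar> + 1)\<^sup>2" by (simp add: power2_eq_square algebra_simps)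
    finally show ?thesis by (rule power2_le_imp_le) simp
  qed
  have "hnorm (?T x) \<le> operator_norm ?T"
    unfolding operator_norm_def by (rule cSUP_upper) (use x bound in \<open>auto intro!: bdd_aboveI2[of _ _ "\<bar>B\<bar> + 1"]\<close>)
  also have "\<dots> \<le> sup_norm (eval2 f)" using G by (simp add: Gamma_contraction_def)
  finally show ?thesis .
qed

end

lemma Gamma_contraction_mult_hnorm:
  assumes hs: "complex_hilbert_space scale_fun H ip"
    and G: "complex_hilbert_space.Gamma_contraction scale_fun H ip mult_s mult_p"
    and g: "g \<in> polyball" and x: "x \<in> H"
  shows "(\<lambda>z. g z * x z) \<in> H"
    "complex_hilbert_space.hnorm ip (\<lambda>z. g z * x z) \<le> complex_hilbert_space.hnorm ip x"
proof -
  interpret complex_hilbert_space scale_fun H ip by (rule hs)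
  obtain f where f: "g = eval2 f" using g by (auto simp: polyball_def polyfuns_def)
  have T: "eval2_operator f mult_s mult_p y = (\<lambda>z. g z * y z)" for y
    using eval2_operator_mult[OF hs] by (simp add: f)
  have "bdd_map (eval2_operator f mult_s mult_p)"
    using G by (intro bdd_map_eval2_operator bdd_map_bounded_operator) (auto simp: Gamma_contraction_def)
  then show in_H: "(\<lambda>z. g z * x z) \<in> H"
    using x by (auto simp: bdd_map_def T)
  have g1: "sup_norm (eval2 f) \<le> 1" using g by (intro sup_norm_le) (auto simp: polyball_def f)
  show "hnorm (\<lambda>z. g z * x z) \<le> hnorm x"
  proof (cases "hnorm x = 0")
    case True
    then have "x = 0" using ip_pos[OF x] ip_self_nonneg[OF x] by (auto simp: hnorm_def less_complex_def)
    then have "(\<lambda>z. g z * x z) = x" by (auto simp: fun_eq_iff)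
    then show ?thesis by simp
  next
    case False
    then have pos: "hnorm x > 0" using hnorm_ge_0[OF x] by simp
    define y where "y = scale_fun (of_real (1 / hnorm x)) x"
    have y: "y \<in> H" unfolding y_def by (rule subspace_scale[OF subspace_carrier x])
    have "(hnorm y)\<^sup>2 = 1" unfolding y_def hnorm_sq_scale[OF x] using pos by (simp add: norm_divide power_divide)
    then have "hnorm y = 1" using hnorm_ge_0[OF y] by (simp add: power2_eq_1_iff)
    then have "hnorm (\<lambda>z. g z * y z) \<le> 1"
      using Gamma_contraction_hnorm[OF G y, of f] g1 by (simp add: T)
    moreover have "(\<lambda>z. g z * y z) = scale_fun (of_real (1 / hnorm x)) (\<lambda>z. g z * x z)"
      by (simp add: y_def scale_fun_def fun_eq_iff)
    ultimately have "hnorm (scale_fun (of_real (1 / hnorm x)) (\<lambda>z. g z * x z)) \<le> 1" by simp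
    then have "(hnorm (scale_fun (of_real (1 / hnorm x)) (\<lambda>z. g z * x z)))\<^sup>2 \<le> 1"
      using hnorm_ge_0[OF subspace_scale[OF subspace_carrier in_H]] by (simp add: power_le_one)
    then have "(hnorm (\<lambda>z. g z * x z))\<^sup>2 \<le> (hnorm x)\<^sup>2"
      unfolding hnorm_sq_scale[OF in_H] using pos by (simp add: norm_divide power_divide field_simps)
    then show ?thesis using hnorm_ge_0[OF x] by (rule power2_le_imp_le)
  qed
qed

text \<open>
  With \<open>h = \<Sum> x\<^sub>j k\<^sub>j\<close> and \<open>u = \<Sum> x\<^sub>j cnj (g (lam j)) k\<^sub>j\<close> one has \<open>\<langle>g u, h\<rangle> = \<langle>u, u\<rangle>\<close>, because \<open>u\<close> is the
  image of \<open>h\<close> under the adjoint of multiplication by \<open>g\<close>. Hence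
  \<open>2 \<parallel>u\<parallel>\<^sup>2 \<le> \<parallel>g u\<parallel>\<^sup>2 + \<parallel>h\<parallel>\<^sup>2 \<le> \<parallel>u\<parallel>\<^sup>2 + \<parallel>h\<parallel>\<^sup>2\<close>, and the quadratic form in question is \<open>\<parallel>h\<parallel>\<^sup>2 - \<parallel>u\<parallel>\<^sup>2\<close>.
\<close>

lemma pos_semidef_polyball:
  assumes k: "admissible k" and g: "g \<in> polyball" and lam: "\<And>i. i \<in> {1..n} \<Longrightarrow> lam i \<in> sym_bidisk"
  shows "pos_semidef n (\<lambda>i j. (1 - g (lam i) * cnj (g (lam j))) * k (lam i) (lam j))"
  unfolding pos_semidef_def
proof
  fix x :: "nat \<Rightarrow> complex"
  obtain H ip where rk: "is_rkhs k H ip"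
    and G: "complex_hilbert_space.Gamma_contraction scale_fun H ip mult_s mult_p"
    using k by (auto simp: admissible_def)
  have hs: "complex_hilbert_space scale_fun H ip" using rk by (simp add: is_rkhs_def)
  interpret complex_hilbert_space scale_fun H ip by (rule hs)
  let ?I = "{1..n}" let ?kf = "\<lambda>i. kernel_fun k (lam i)"
  have kf: "?kf i \<in> H" if "i \<in> ?I" for i
    using rk lam[OF that] by (auto simp: is_rkhs_def total_def)
  have rep: "ip f (?kf i) = f (lam i)" if "f \<in> H" "i \<in> ?I" for f i
    using rk lam[OF that(2)] that by (auto simp: is_rkhs_def)
  define comb where "comb a = (\<Sum>i\<in>?I. scale_fun (a i) (?kf i))" for a
  have comb_in: "comb a \<in> H" for a
    unfolding comb_def by (intro subspace_sum[OF subspace_carrier] subspace_scale[OF subspace_carrier] kf)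
  have ip_comb: "ip f (comb a) = (\<Sum>i\<in>?I. cnj (a i) * f (lam i))" if "f \<in> H" for f a
    unfolding comb_def using that
    by (subst ip_sum_right) (auto simp: ip_scale_right rep kf subspace_scale[OF subspace_carrier] intro!: sum.cong)
  have comb_apply: "comb a (lam i) = (\<Sum>j\<in>?I. a j * k (lam i) (lam j))" if "i \<in> ?I" for a i
    using lam[OF that] by (simp add: comb_def fun_sum_apply scale_fun_def kernel_fun_def)
  define h where "h = comb x"
  define u where "u = comb (\<lambda>j. x j * cnj (g (lam j)))"
  let ?Tu = "\<lambda>z. g z * u z"
  have hu: "h \<in> H" "u \<in> H" by (simp_all add: h_def u_def comb_in)
  note Tu = Gamma_contraction_mult_hnorm[OF hs G g hu(2)]
  have "ip ?Tu h = ip u u"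
    unfolding h_def ip_comb[OF Tu(1)] by (subst (2) u_def) (simp add: ip_comb[OF hu(2)] mult_ac)
  then have "2 * (hnorm u)\<^sup>2 \<le> (hnorm ?Tu)\<^sup>2 + (hnorm h)\<^sup>2"
    using two_Re_ip_le[OF Tu(1) hu(1)] hnorm_sq[OF hu(2)] by simp
  moreover have "(hnorm ?Tu)\<^sup>2 \<le> (hnorm u)\<^sup>2"
    by (intro power_mono Tu hnorm_ge_0)
  ultimately have "Re (ip u u) \<le> Re (ip h h)" using hu by (simp add: hnorm_sq)
  moreover have "Im (ip v v) = 0" if "v \<in> H" for v
    using arg_cong[OF ip_commute[OF that that], of Im] by simp
  ultimately have "0 \<le> ip h h - ip u u" using hu by (simp add: less_eq_complex_def)
  also have "ip h h - ip u u = (\<Sum>i=1..n. \<Sum>j=1..n. cnj (x i) * ((1 - g (lam i) * cnj (g (lam j))) * k (lam i) (lam j)) * x j)"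
    by (simp add: h_def u_def ip_comb comb_in comb_apply sum_distrib_left flip: sum_subtractf)
      (simp add: algebra_simps)
  finally show "0 \<le> (\<Sum>i=1..n. \<Sum>j=1..n. cnj (x i) * ((1 - g (lam i) * cnj (g (lam j))) * k (lam i) (lam j)) * x j)" .
qed


section \<open>Sufficient conditions for admissibility\<close>

lemma is_kernelI:
  assumes herm: "\<And>x y. x \<in> sym_bidisk \<Longrightarrow> y \<in> sym_bidisk \<Longrightarrow> k y x = cnj (k x y)"
    and pos: "\<And>c. c \<in> fin_supp sym_bidisk \<Longrightarrow> c \<noteq> 0 \<Longrightarrow> 0 < energy sym_bidisk k c"
  shows "is_kernel k"
  unfolding is_kernel_def
proof (intro allI impI, elim conjE bexE)
  fix m :: nat and z :: "nat \<Rightarrow> complex \<times> complex" and c :: "nat \<Rightarrow> complex" and i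
  assume z: "z ` {1..m} \<subseteq> sym_bidisk" and inj: "inj_on z {1..m}" and i: "i \<in> {1..m}" "c i \<noteq> 0"
  let ?S = "\<Sum>i=1..m. \<Sum>j=1..m. c i * cnj (c j) * k (z i) (z j)"
  define S where "S = ?S"
  define d where "d x = (if x \<in> z ` {1..m} then cnj (c (the_inv_into {1..m} z x)) else 0)" for x
  have dz: "d (z j) = cnj (c j)" if "j \<in> {1..m}" for j
    using that inj by (simp add: d_def the_inv_into_f_f)
  have supp: "{x. d x \<noteq> 0} \<subseteq> z ` {1..m}" by (auto simp: d_def)
  have "d \<in> fin_supp sym_bidisk"
    unfolding fin_supp_def using supp z finite_subset[OF supp] by auto
  moreover have "d \<noteq> 0"
  proof
    assume "d = 0"
    then show False using dz[OF i(1)] i(2) by simp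
  qed
  ultimately have "0 < energy sym_bidisk k d" by (rule pos)
  also have "energy sym_bidisk k d = Re (\<Sum>x\<in>z ` {1..m}. \<Sum>y\<in>z ` {1..m}. k x y * d y * cnj (d x))"
    by (rule energy_superset[OF _ supp z]) simp
  also have "(\<Sum>x\<in>z ` {1..m}. \<Sum>y\<in>z ` {1..m}. k x y * d y * cnj (d x)) = S"
    unfolding S_def sum.reindex[OF inj] o_def by (intro sum.cong refl) (simp add: dz)
  finally have "0 < Re S" .
  moreover have "cnj S = S"
    unfolding S_def cnj_sum
    by (subst sum.swap) (use z in \<open>auto simp: mult_ac herm[symmetric] image_subset_iff intro!: sum.cong\<close>)
  from arg_cong[OF this, of Im] have "Im S = 0" by simp
  ultimately show "0 < ?S" unfolding S_def[symmetric] by (simp add: less_complex_def)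
qed

lemma admissibleI:
  assumes herm: "\<And>x y. x \<in> sym_bidisk \<Longrightarrow> y \<in> sym_bidisk \<Longrightarrow> k y x = cnj (k x y)"
    and pos: "\<And>c. c \<in> fin_supp sym_bidisk \<Longrightarrow> c \<noteq> 0 \<Longrightarrow> 0 < energy sym_bidisk k c"
    and contr: "\<And>g c. g \<in> polyball \<Longrightarrow> c \<in> fin_supp sym_bidisk \<Longrightarrow>
      energy sym_bidisk k (\<lambda>x. cnj (g x) * c x) \<le> energy sym_bidisk k c"
  shows "admissible k"
proof -
  have e0: "energy sym_bidisk k 0 = 0" by (simp add: energy_def kernel_sum_0 pairing_0_left)
  interpret psd_kernel sym_bidisk k
  proof
    show "0 \<le> energy sym_bidisk k c" if "c \<in> fin_supp sym_bidisk" for c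
      using pos[OF that] e0 by (cases "c = 0") auto
  qed (rule herm)
  have mult: "(\<lambda>z. g z * x z) \<in> carrier" "hnorm (\<lambda>z. g z * x z) \<le> C * hnorm x"
    if g: "g \<in> polyfuns" "\<And>z. z \<in> sym_bidisk \<Longrightarrow> cmod (g z) \<le> C" and C: "C > 0" and x: "x \<in> carrier"
    for g C x
  proof -
    have "(\<lambda>z. of_real (1 / C) * g z) \<in> polyball"
      unfolding polyball_def
      by (intro CollectI conjI polyfuns_mult polyfuns_const g(1))
        (use g(2) C in \<open>auto simp: norm_divide field_simps\<close>)
    note b = contr[OF this]
    have q: "E (\<lambda>x. cnj (g x) * c x) \<le> C\<^sup>2 * E c" if c: "c \<in> F" for c
    proof -
      have "(\<lambda>x. cnj (g x) * c x) = scale_fun (of_real C) (\<lambda>x. cnj (of_real (1 / C) * g x) * c x)"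
        using C by (auto simp: scale_fun_def fun_eq_iff)
      then have "E (\<lambda>x. cnj (g x) * c x) = C\<^sup>2 * E (\<lambda>x. cnj (of_real (1 / C) * g x) * c x)"
        using energy_scale[OF fin_supp_mult[OF c, of "\<lambda>x. cnj (of_real (1 / C) * g x)"], of k "of_real C"] by simp
      then show ?thesis using b[OF c] by (simp add: mult_left_mono)
    qed
    show "(\<lambda>z. g z * x z) \<in> carrier" "hnorm (\<lambda>z. g z * x z) \<le> C * hnorm x"
      using multiplier_bound[OF x C q] by auto
  qed
  have s_eq: "mult_s = (\<lambda>x z. fst z * x z)" and p_eq: "mult_p = (\<lambda>x z. snd z * x z)"
    by (auto simp: mult_s_def mult_p_def fun_eq_iff)
  have s: "bounded_operator mult_s"
    unfolding bounded_operator_def s_eq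
    using mult[OF polyfuns_fst sym_bidisk_bounds(1)]
    by (auto simp: scale_fun_def fun_eq_iff algebra_simps intro!: exI[of _ 2])
  have p: "bounded_operator mult_p"
    unfolding bounded_operator_def p_eq
    using mult[OF polyfuns_snd sym_bidisk_bounds(2)]
    by (auto simp: scale_fun_def fun_eq_iff algebra_simps intro!: exI[of _ 1])
  have "operator_norm (eval2_operator f mult_s mult_p) \<le> sup_norm (eval2 f)" for f
    unfolding operator_norm_def
  proof (rule cSUP_least)
    show "{x \<in> carrier. hnorm x \<le> 1} \<noteq> {}"
      using carrier_0 by (auto simp: hnorm_eq intro!: exI[of _ 0])
    fix x assume x: "x \<in> {x \<in> carrier. hnorm x \<le> 1}"
    show "hnorm (eval2_operator f mult_s mult_p x) \<le> sup_norm (eval2 f)"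
    \<comment> \<open>a bound strictly above the supremum norm is positive even if the polynomial vanishes\<close>
    proof (rule dense_ge)
      fix C assume C: "sup_norm (eval2 f) < C"
      have "0 \<le> cmod (eval2 f (0, 0))" by simp
      also have "\<dots> \<le> sup_norm (eval2 f)" by (rule sup_norm_eval2_upper[OF sym_bidisk_0])
      finally have C0: "C > 0" using C by simp
      have "hnorm (\<lambda>z. eval2 f z * x z) \<le> C * hnorm x"
      proof (rule mult(2))
        show "cmod (eval2 f z) \<le> C" if "z \<in> sym_bidisk" for z
          using sup_norm_eval2_upper[OF that, of f] C by simp
      qed (use x C0 in \<open>auto simp: polyfuns_def\<close>)
      also have "\<dots> \<le> C" using x C0 by simp
      finally show "hnorm (eval2_operator f mult_s mult_p x) \<le> C"
        by (simp add: eval2_operator_mult[OF hilbert])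
    qed
  qed
  then have G: "Gamma_contraction mult_s mult_p"
    unfolding Gamma_contraction_def using s p by (auto simp: mult_s_def mult_p_def fun_eq_iff)
  have kf: "kernel_fun k = (\<lambda>z x. if x \<in> sym_bidisk then k x z else 0)"
    by (simp add: kernel_fun_def fun_eq_iff)
  have "is_rkhs k carrier inner"
    unfolding is_rkhs_def kf
    using hilbert total_kernel_functions reproducing by (auto simp: carrier_def)
  with G is_kernelI[OF herm pos] show ?thesis
    unfolding admissible_def by blast
qed

text \<open>
  The kernel of a finite matrix, made strictly positive on the whole domain by atoms of mass \<open>e\<close>. The
  space of the diagonal part is \<open>\<ell>\<^sup>2\<close> of the domain, on which multiplication by \<open>g\<close> has norm \<open>sup |g|\<close>.
\<close>

definition atomic_kernel :: "('a \<Rightarrow> 'a \<Rightarrow> complex) \<Rightarrow> real \<Rightarrow> 'a set \<Rightarrow> 'a \<Rightarrow> 'a \<Rightarrow> complex" where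
  "atomic_kernel K e L x y = (if x \<in> L \<and> y \<in> L then K x y else 0) + (if x = y then of_real e else 0)"

lemma energy_atomic_kernel:
  assumes c: "c \<in> fin_supp D" and L: "finite L" "L \<subseteq> D"
  shows "energy D (atomic_kernel K e L) c =
    Re (\<Sum>x\<in>L. \<Sum>y\<in>L. K x y * c y * cnj (c x)) + e * (\<Sum>x | c x \<noteq> 0. (cmod (c x))\<^sup>2)"
proof -
  let ?S = "{x. c x \<noteq> 0}"
  let ?A = "?S \<union> L"
  have A: "finite ?A" "?A \<subseteq> D" using c L by (auto simp: fin_supp_def)
  have "energy D (atomic_kernel K e L) c = Re (\<Sum>x\<in>?A. \<Sum>y\<in>?A. atomic_kernel K e L x y * c y * cnj (c x))"
    by (rule energy_superset) (use A in auto)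
  also have "(\<Sum>x\<in>?A. \<Sum>y\<in>?A. atomic_kernel K e L x y * c y * cnj (c x)) =
      (\<Sum>x\<in>?A. \<Sum>y\<in>?A. if x \<in> L \<and> y \<in> L then K x y * c y * cnj (c x) else 0)
      + (\<Sum>x\<in>?A. \<Sum>y\<in>?A. if x = y then of_real e * c y * cnj (c x) else 0)"
    unfolding sum.distrib[symmetric] by (intro sum.cong) (auto simp: atomic_kernel_def algebra_simps)
  also have "(\<Sum>x\<in>?A. \<Sum>y\<in>?A. if x \<in> L \<and> y \<in> L then K x y * c y * cnj (c x) else 0)
      = (\<Sum>x\<in>L. \<Sum>y\<in>?A. if x \<in> L \<and> y \<in> L then K x y * c y * cnj (c x) else 0)"
    by (rule sum.mono_neutral_right) (use A in auto)
  also have "\<dots> = (\<Sum>x\<in>L. \<Sum>y\<in>L. K x y * c y * cnj (c x))"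
    by (intro sum.cong refl sum.mono_neutral_cong_right) (use A in auto)
  also have "(\<Sum>x\<in>?A. \<Sum>y\<in>?A. if x = y then of_real e * c y * cnj (c x) else 0)
      = (\<Sum>x\<in>?A. of_real (e * (cmod (c x))\<^sup>2))"
  proof (rule sum.cong)
    fix x assume "x \<in> ?A"
    then have "(\<Sum>y\<in>?A. if x = y then of_real e * c y * cnj (c x) else 0) = of_real e * (c x * cnj (c x))"
      using A by (simp add: sum.delta)
    also have "\<dots> = of_real (e * (cmod (c x))\<^sup>2)"
      by (simp only: complex_norm_square of_real_mult)
    finally show "(\<Sum>y\<in>?A. if x = y then of_real e * c y * cnj (c x) else 0) = of_real (e * (cmod (c x))\<^sup>2)" .
  qed simp
  also have "\<dots> = (\<Sum>x\<in>?S. of_real (e * (cmod (c x))\<^sup>2))"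
    by (rule sum.mono_neutral_right) (use A in auto)
  also have "\<dots> = of_real (e * (\<Sum>x | c x \<noteq> 0. (cmod (c x))\<^sup>2))"
    by (simp add: sum_distrib_left)
  finally show ?thesis by simp
qed

text \<open>
  Being a contractive multiplier is a positivity condition on the kernel, hence inherited by sums of
  kernels; it holds for the matrix part by assumption and for the diagonal part because \<open>|g| \<le> 1\<close>.
\<close>

lemma admissible_atomic_kernel:
  assumes L: "finite L" "L \<subseteq> sym_bidisk" and e: "e > 0"
    and herm: "\<And>x y. x \<in> L \<Longrightarrow> y \<in> L \<Longrightarrow> K y x = cnj (K x y)"
    and contr: "\<And>g v. g \<in> polyball \<Longrightarrow>
      0 \<le> Re (\<Sum>x\<in>L. \<Sum>y\<in>L. (1 - g x * cnj (g y)) * K x y * v y * cnj (v x))"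
  shows "admissible (atomic_kernel K e L)"
proof (rule admissibleI)
  let ?G = sym_bidisk
  show "atomic_kernel K e L y x = cnj (atomic_kernel K e L x y)" for x y
    by (auto simp: atomic_kernel_def herm[symmetric])
  have "(\<lambda>z. 0) \<in> polyball" by (simp add: polyball_def polyfuns_const)
  from contr[OF this]
  have psd: "0 \<le> Re (\<Sum>x\<in>L. \<Sum>y\<in>L. K x y * v y * cnj (v x))" for v by simp
  fix c assume c: "c \<in> fin_supp ?G"
  show "0 < energy ?G (atomic_kernel K e L) c" if "c \<noteq> 0"
  proof -
    obtain x where "c x \<noteq> 0" using \<open>c \<noteq> 0\<close> by (auto simp: fun_eq_iff)
    then have "{x. c x \<noteq> 0} \<noteq> {}" by blast
    then have "0 < (\<Sum>x | c x \<noteq> 0. (cmod (c x))\<^sup>2)"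
      by (intro sum_pos fin_suppD(1)[OF c]) simp_all
    then show ?thesis unfolding energy_atomic_kernel[OF c L] using psd[of c] e by (simp add: add_nonneg_pos)
  qed
  fix g assume g: "g \<in> polyball"
  let ?d = "\<lambda>x. cnj (g x) * c x"
  have d: "?d \<in> fin_supp ?G" by (rule fin_supp_mult[OF c])
  have "(\<Sum>x | ?d x \<noteq> 0. (cmod (?d x))\<^sup>2) \<le> (\<Sum>x | ?d x \<noteq> 0. (cmod (c x))\<^sup>2)"
  proof (rule sum_mono)
    fix x assume "x \<in> {x. ?d x \<noteq> 0}"
    then have "x \<in> ?G" using d by (auto simp: fin_supp_def)
    then have "cmod (g x) \<le> 1" using g by (simp add: polyball_def)
    then have "cmod (?d x) \<le> cmod (c x)" by (simp add: norm_mult mult_left_le_one_le)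
    then show "(cmod (?d x))\<^sup>2 \<le> (cmod (c x))\<^sup>2" by (rule power_mono) simp
  qed
  also have "\<dots> \<le> (\<Sum>x | c x \<noteq> 0. (cmod (c x))\<^sup>2)"
    by (rule sum_mono2) (use c in \<open>auto simp: fin_supp_def\<close>)
  finally have 1: "e * (\<Sum>x | ?d x \<noteq> 0. (cmod (?d x))\<^sup>2) \<le> e * (\<Sum>x | c x \<noteq> 0. (cmod (c x))\<^sup>2)"
    using e by (simp add: mult_left_mono)
  have "0 \<le> Re (\<Sum>x\<in>L. \<Sum>y\<in>L. (1 - g x * cnj (g y)) * K x y * c y * cnj (c x))"
    by (rule contr[OF g])
  also have "(\<Sum>x\<in>L. \<Sum>y\<in>L. (1 - g x * cnj (g y)) * K x y * c y * cnj (c x))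
      = (\<Sum>x\<in>L. \<Sum>y\<in>L. K x y * c y * cnj (c x)) - (\<Sum>x\<in>L. \<Sum>y\<in>L. K x y * ?d y * cnj (?d x))"
    unfolding sum_subtractf[symmetric] by (intro sum.cong) (auto simp: algebra_simps)
  finally show "energy ?G (atomic_kernel K e L) ?d \<le> energy ?G (atomic_kernel K e L) c"
    unfolding energy_atomic_kernel[OF c L] energy_atomic_kernel[OF d L] using 1 by simp
qed


section \<open>Separating a point from a cone with an order unit\<close>

text \<open>
  The M. Riesz extension argument. Among the cones that contain \<open>C\<close> and \<open>-M\<close> but not \<open>-e\<close>, a maximal
  one \<open>P\<close> is total, i.e. contains \<open>v\<close> or \<open>-v\<close> for every \<open>v\<close>. Then \<open>\<phi> v = Inf {t. t e - v \<in> P}\<close> is linear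
  because upper and lower approximations by multiples of \<open>e\<close> agree. The order unit takes the place
  of any topology, in particular of closedness of \<open>C\<close>.
\<close>

lemma cone_functional:
  fixes sc :: "real \<Rightarrow> 'v::ab_group_add \<Rightarrow> 'v"
  assumes "vector_space sc"
    and add: "\<And>x y. x \<in> C \<Longrightarrow> y \<in> C \<Longrightarrow> x + y \<in> C"
    and scl: "\<And>t x. 0 \<le> t \<Longrightarrow> x \<in> C \<Longrightarrow> sc t x \<in> C"
    and e: "e \<in> C" and unit: "\<And>x. \<exists>t\<ge>0. sc t e + x \<in> C"
    and M: "M \<notin> C"
  shows "\<exists>\<phi> :: 'v \<Rightarrow> real. (\<forall>x y. \<phi> (x + y) = \<phi> x + \<phi> y) \<and> (\<forall>t x. \<phi> (sc t x) = t * \<phi> x) \<and>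
    (\<forall>x\<in>C. 0 \<le> \<phi> x) \<and> \<phi> M \<le> 0 \<and> \<phi> e = 1"
proof -
  interpret vs: vector_space sc by (rule assms(1))
  define cone where "cone P \<longleftrightarrow> (\<forall>x\<in>P. \<forall>y\<in>P. x + y \<in> P) \<and> (\<forall>t\<ge>0. \<forall>x\<in>P. sc t x \<in> P)" for P
  define \<A> where "\<A> = {P. C \<subseteq> P \<and> - M \<in> P \<and> cone P \<and> - e \<notin> P}"
  define P0 where "P0 = {x + sc s (- M) | x s. x \<in> C \<and> 0 \<le> s}"
  have "P0 \<in> \<A>"
  proof -
    have "0 \<in> C" using scl[of 0 e] e by simp
    have P0I: "x + sc s (- M) \<in> P0" if "x \<in> C" "0 \<le> s" for x s
      unfolding P0_def using that by auto
    have 1: "C \<subseteq> P0"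
    proof
      fix x assume "x \<in> C"
      from P0I[OF this, of 0] show "x \<in> P0" by simp
    qed
    have 2: "- M \<in> P0" using P0I[OF \<open>0 \<in> C\<close>, of 1] by simp
    have 3: "cone P0" unfolding cone_def
    proof (intro conjI ballI allI impI)
      fix x y assume "x \<in> P0" "y \<in> P0"
      then obtain x' s y' t where *: "x = x' + sc s (- M)" "y = y' + sc t (- M)" "x' \<in> C" "y' \<in> C" "0 \<le> s" "0 \<le> t"
        by (auto simp: P0_def)
      then have "x + y = (x' + y') + sc (s + t) (- M)" by (simp only: vs.scale_left_distrib add_ac)
      with P0I[OF add[OF *(3,4)] add_nonneg_nonneg[OF *(5,6)]] show "x + y \<in> P0" by simp
    next
      fix t :: real and x assume t: "0 \<le> t" and "x \<in> P0"
      then obtain x' s where *: "x = x' + sc s (- M)" "x' \<in> C" "0 \<le> s" by (auto simp: P0_def)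
      then have "sc t x = sc t x' + sc (t * s) (- M)" by (simp only: vs.scale_right_distrib vs.scale_scale)
      with P0I[OF scl[OF t *(2)] mult_nonneg_nonneg[OF t *(3)]] show "sc t x \<in> P0" by simp
    qed
    have 4: "- e \<notin> P0"
    proof
      assume "- e \<in> P0"
      then obtain x s where x: "- e = x + sc s (- M)" "x \<in> C" "0 \<le> s" by (auto simp: P0_def)
      show False
      proof (cases "s = 0")
        case True
        then have "- e \<in> C" using x by simp
        obtain t where "t \<ge> 0" "sc t e + M \<in> C" using unit by blast
        with add[OF this(2) scl[OF this(1) \<open>- e \<in> C\<close>]] M show False by simp
      next
        case False
        then have "M = sc (1 / s) (x + e)"
        proof -
          have "x + e = sc s M" 
            using x(1)[symmetric] by (simp add: add.commute add_eq_0_iff diff_eq_eq)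
          then show ?thesis using False by simp
        qed
        then show False using M scl[OF _ add[OF x(2) e], of "1/s"] x(3) by simp
      qed
    qed
    show ?thesis using 1 2 3 4 by (simp add: \<A>_def)
  qed
  have "\<exists>P\<in>\<A>. \<forall>X\<in>\<A>. P \<subseteq> X \<longrightarrow> X = P"
  proof (rule subset_Zorn_nonempty)
    show "\<A> \<noteq> {}" using \<open>P0 \<in> \<A>\<close> by blast
    fix \<C> assume ne: "\<C> \<noteq> {}" and ch: "subset.chain \<A> \<C>"
    have sub: "\<C> \<subseteq> \<A>" and lin: "\<And>X Y. X \<in> \<C> \<Longrightarrow> Y \<in> \<C> \<Longrightarrow> X \<subseteq> Y \<or> Y \<subseteq> X"
      using ch by (auto simp: subset_chain_def)
    have "x + y \<in> \<Union>\<C>" if xy: "x \<in> \<Union>\<C>" "y \<in> \<Union>\<C>" for x y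
    proof -
      obtain X Y where XY: "X \<in> \<C>" "x \<in> X" "Y \<in> \<C>" "y \<in> Y" using xy by blast
      then obtain Z where "Z \<in> \<C>" "x \<in> Z" "y \<in> Z" using lin[of X Y] by blast
      moreover have "cone Z" using \<open>Z \<in> \<C>\<close> sub by (auto simp: \<A>_def)
      ultimately show ?thesis unfolding cone_def by blast
    qed
    moreover have "sc t x \<in> \<Union>\<C>" if "0 \<le> t" "x \<in> \<Union>\<C>" for t x
      using that sub by (auto simp: \<A>_def cone_def)
    ultimately have "cone (\<Union>\<C>)" by (auto simp: cone_def)
    with sub ne show "\<Union>\<C> \<in> \<A>" by (auto simp: \<A>_def)
  qed
  then obtain P where P: "P \<in> \<A>" and max: "\<And>X. X \<in> \<A> \<Longrightarrow> P \<subseteq> X \<Longrightarrow> X = P" by blast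
  have CP: "C \<subseteq> P" and MP: "- M \<in> P" and eP: "- e \<notin> P"
    and Padd: "\<And>x y. x \<in> P \<Longrightarrow> y \<in> P \<Longrightarrow> x + y \<in> P" and Pscl: "\<And>t x. 0 \<le> t \<Longrightarrow> x \<in> P \<Longrightarrow> sc t x \<in> P"
    using P by (auto simp: \<A>_def cone_def)
  have neg: "t \<ge> 0" if "sc t e \<in> P" for t
  proof (rule ccontr)
    assume "\<not> t \<ge> 0"
    then have "sc (- 1 / t) (sc t e) \<in> P" by (intro Pscl that) (simp add: divide_nonneg_neg field_simps)
    then show False using eP \<open>\<not> t \<ge> 0\<close> by simp
  qed
  \<comment> \<open>maximality: adjoining \<open>v\<close> must bring in \<open>-e\<close>\<close>
  have grow: "\<exists>p\<in>P. \<exists>t\<ge>0. - e = p + sc t v" if "v \<notin> P" for v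
  proof -
    define X where "X = {p + sc t v | p t. p \<in> P \<and> 0 \<le> t}"
    have XI: "p + sc t v \<in> X" if "p \<in> P" "0 \<le> t" for p t
      unfolding X_def using that by auto
    have "P \<subseteq> X"
    proof
      fix x assume "x \<in> P"
      from XI[OF this, of 0] show "x \<in> X" by simp
    qed
    have "0 \<in> P" using CP e Pscl[of 0 e] by auto
    from XI[OF this, of 1] have "v \<in> X" by simp
    have "X \<notin> \<A>" using max[of X] \<open>P \<subseteq> X\<close> \<open>v \<in> X\<close> that by blast
    moreover have "cone X" unfolding cone_def
    proof (intro conjI ballI allI impI)
      fix x y assume "x \<in> X" "y \<in> X"
      then obtain x' s y' t where *: "x = x' + sc s v" "y = y' + sc t v" "x' \<in> P" "y' \<in> P" "0 \<le> s" "0 \<le> t"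
        by (auto simp: X_def)
      then have "x + y = (x' + y') + sc (s + t) v" by (simp only: vs.scale_left_distrib add_ac)
      with XI[OF Padd[OF *(3,4)] add_nonneg_nonneg[OF *(5,6)]] show "x + y \<in> X" by simp
    next
      fix t :: real and x assume t: "0 \<le> t" and "x \<in> X"
      then obtain x' s where *: "x = x' + sc s v" "x' \<in> P" "0 \<le> s" by (auto simp: X_def)
      then have "sc t x = sc t x' + sc (t * s) v" by (simp only: vs.scale_right_distrib vs.scale_scale)
      with XI[OF Pscl[OF t *(2)] mult_nonneg_nonneg[OF t *(3)]] show "sc t x \<in> X" by simp
    qed
    ultimately have "- e \<in> X" using \<open>P \<subseteq> X\<close> CP MP by (auto simp: \<A>_def)
    then show ?thesis by (auto simp: X_def)
  qed
  have total: "- v \<in> P" if v: "v \<notin> P" for v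
  proof (rule ccontr)
    assume nv: "- v \<notin> P"
    obtain p t where p: "p \<in> P" "t \<ge> 0" "- e = p + sc t v" using grow[OF v] by blast
    obtain p' t' where p': "p' \<in> P" "t' \<ge> 0" "- e = p' + sc t' (- v)" using grow[OF nv] by blast
    have "t > 0" using p eP by (cases "t = 0") auto
    have "sc t' (- e) + sc t (- e) = sc t' p + sc t p'"
      by (subst p(3), subst p'(3)) (simp add: vs.scale_right_distrib algebra_simps)
    also have "\<dots> \<in> P" by (intro Padd Pscl p p')
    finally have "sc (- (t' + t)) e \<in> P" by (simp add: algebra_simps)
    from neg[OF this] \<open>t > 0\<close> p'(2) show False by simp
  qed
  define \<phi> where "\<phi> v = Inf {t. sc t e - v \<in> P}" for v
  have bb: "bdd_below {t. sc t e - v \<in> P}" for v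
  proof -
    obtain u where u: "sc u e + v \<in> C" using unit by blast
    have "- u \<le> t" if "sc t e - v \<in> P" for t
    proof -
      have "(sc t e - v) + (sc u e + v) \<in> P" using u CP by (intro Padd[OF that]) blast
      then have "sc (t + u) e \<in> P" by (simp add: vs.scale_left_distrib algebra_simps)
      from neg[OF this] show ?thesis by simp
    qed
    then show ?thesis by (intro bdd_belowI[of _ "- u"]) simp
  qed
  have ne: "{t. sc t e - v \<in> P} \<noteq> {}" for v
    using unit[of "- v"] CP by auto
  have eP': "sc s e \<in> P" if "s \<ge> 0" for s using Pscl[OF that] CP e by blast
  have above: "sc t e - v \<in> P" if t: "\<phi> v < t" for t v
  proof -
    obtain s where s: "sc s e - v \<in> P" "s < t"
      using t cInf_less_iff[OF ne bb] unfolding \<phi>_def by auto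
    have "(sc s e - v) + sc (t - s) e \<in> P" using s by (intro Padd eP') auto
    then show ?thesis by (simp add: algebra_simps)
  qed
  have below: "v - sc t e \<in> P" if t: "t < \<phi> v" for t v
  proof -
    have "sc t e - v \<notin> P"
    proof
      assume "sc t e - v \<in> P"
      then have "\<phi> v \<le> t" unfolding \<phi>_def by (intro cInf_lower bb) simp
      with t show False by simp
    qed
    from total[OF this] show ?thesis by simp
  qed
  have uniq: "\<phi> v = a" if up: "\<And>t. t > a \<Longrightarrow> sc t e - v \<in> P" and dn: "\<And>t. t < a \<Longrightarrow> v - sc t e \<in> P" for v a
  proof (rule antisym)
    show "\<phi> v \<le> a"
    proof (rule dense_ge)
      fix t assume "a < t"
      then show "\<phi> v \<le> t" unfolding \<phi>_def by (intro cInf_lower bb) (simp add: up)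
    qed
    show "a \<le> \<phi> v"
    proof (rule ccontr)
      assume "\<not> a \<le> \<phi> v"
      then obtain s t where st: "\<phi> v < s" "s < t" "t < a" by (meson dense not_le)
      have "(sc s e - v) + (v - sc t e) \<in> P" by (intro Padd above dn st)
      then have "sc (s - t) e \<in> P" by (simp add: algebra_simps)
      from neg[OF this] st show False by simp
    qed
  qed
  have phi_add: "\<phi> (x + y) = \<phi> x + \<phi> y" for x y
  proof (rule uniq)
    fix t :: real
    { assume "t > \<phi> x + \<phi> y"
      define d where "d = (t - \<phi> x - \<phi> y) / 2"
      have d: "d > 0" "t = (\<phi> x + d) + (\<phi> y + d)" using \<open>t > \<phi> x + \<phi> y\<close> by (auto simp: d_def field_simps)
      have "(sc (\<phi> x + d) e - x) + (sc (\<phi> y + d) e - y) \<in> P" using d by (intro Padd above) auto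
      moreover have "sc t e = sc (\<phi> x + d) e + sc (\<phi> y + d) e" by (simp only: d(2) vs.scale_left_distrib)
      ultimately show "sc t e - (x + y) \<in> P" by (simp only: add_diff_add) }
    { assume "t < \<phi> x + \<phi> y"
      define d where "d = (\<phi> x + \<phi> y - t) / 2"
      have d: "d > 0" "t = (\<phi> x - d) + (\<phi> y - d)" using \<open>t < \<phi> x + \<phi> y\<close> by (auto simp: d_def field_simps)
      have "(x - sc (\<phi> x - d) e) + (y - sc (\<phi> y - d) e) \<in> P" using d by (intro Padd below) auto
      moreover have "sc t e = sc (\<phi> x - d) e + sc (\<phi> y - d) e" by (simp only: d(2) vs.scale_left_distrib)
      ultimately show "(x + y) - sc t e \<in> P" by (simp only: add_diff_add) }
  qed
  have phi_0: "\<phi> 0 = 0"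
    by (rule uniq) (use eP' in \<open>auto simp flip: vs.scale_minus_left\<close>)
  have phi_minus: "\<phi> (- x) = - \<phi> x" for x
    using phi_add[of x "- x"] phi_0 by simp
  have phi_pos: "\<phi> (sc s x) = s * \<phi> x" if s: "s > 0" for s x
  proof (rule uniq)
    fix t :: real
    { assume "t > s * \<phi> x"
      then have "sc s (sc (t / s) e - x) \<in> P" using s by (intro Pscl above) (auto simp: field_simps)
      then show "sc t e - sc s x \<in> P" using s by (simp add: vs.scale_right_diff_distrib) }
    { assume "t < s * \<phi> x"
      then have "sc s (x - sc (t / s) e) \<in> P" using s by (intro Pscl below) (auto simp: field_simps)
      then show "sc s x - sc t e \<in> P" using s by (simp add: vs.scale_right_diff_distrib) }
  qed
  have phi_scale: "\<phi> (sc s x) = s * \<phi> x" for s x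
  proof -
    consider "s > 0" | "s = 0" | "s < 0" by linarith
    then show ?thesis
    proof cases
      case 3
      then have "\<phi> (sc (- s) x) = - s * \<phi> x" by (intro phi_pos) simp
      then show ?thesis using phi_minus[of "sc s x"] by simp
    qed (auto simp: phi_pos phi_0)
  qed
  have phi_P: "0 \<le> \<phi> x" if "x \<in> P" for x
  proof (rule ccontr)
    assume "\<not> 0 \<le> \<phi> x"
    then obtain t where t: "\<phi> x < t" "t < 0" by (meson dense not_le)
    have "(sc t e - x) + x \<in> P" by (intro Padd above t that)
    then show False using neg[of t] t by simp
  qed
  have "\<phi> e = 1"
  proof (rule uniq)
    fix t :: real
    show "sc t e - e \<in> P" if "t > 1" using eP'[of "t - 1"] that by (simp add: vs.scale_left_diff_distrib)
    show "e - sc t e \<in> P" if "t < 1" using eP'[of "1 - t"] that by (simp add: vs.scale_left_diff_distrib)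
  qed
  moreover have "\<phi> M \<le> 0" using phi_P[OF MP] phi_minus[of M] by simp
  ultimately show ?thesis
    using phi_add phi_scale phi_P subsetD[OF CP] by (intro exI[of _ \<phi>]) simp
qed


section \<open>Lurking isometries\<close>

text \<open>
  The state space \<open>\<complex>\<^sup>M\<close> has a dimension that is found during the proof, so it is modelled by sequences of
  which only the first \<open>M\<close> entries count.
\<close>

definition dot :: "nat \<Rightarrow> (nat \<Rightarrow> complex) \<Rightarrow> (nat \<Rightarrow> complex) \<Rightarrow> complex" where
  "dot M x y = (\<Sum>l<M. x l * cnj (y l))"

definition nsq :: "nat \<Rightarrow> (nat \<Rightarrow> complex) \<Rightarrow> real" where
  "nsq M x = (\<Sum>l<M. (cmod (x l))\<^sup>2)"

lemma dot_self: "dot M x x = of_real (nsq M x)"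
  unfolding dot_def nsq_def of_real_sum by (simp only: complex_norm_square)

lemma nsq_eq: "nsq M x = Re (dot M x x)" by (simp add: dot_self)

lemma nsq_nonneg: "0 \<le> nsq M x" by (simp add: nsq_def sum_nonneg)

lemma nsq_le_0D: "nsq M x \<le> 0 \<Longrightarrow> l < M \<Longrightarrow> x l = 0"
proof -
  assume a: "nsq M x \<le> 0" "l < M"
  have "(cmod (x l))\<^sup>2 \<le> nsq M x" unfolding nsq_def
    by (rule member_le_sum) (use a in auto)
  from order_trans[OF this a(1)] show ?thesis by simp
qed

lemma dot_add_left: "dot M (x + y) z = dot M x z + dot M y z"
  by (simp add: dot_def sum.distrib algebra_simps)
lemma dot_add_right: "dot M z (x + y) = dot M z x + dot M z y"
  by (simp add: dot_def sum.distrib algebra_simps)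
lemma dot_diff_left: "dot M (x - y) z = dot M x z - dot M y z"
  by (simp add: dot_def sum_subtractf algebra_simps)
lemma dot_diff_right: "dot M z (x - y) = dot M z x - dot M z y"
  by (simp add: dot_def sum_subtractf algebra_simps)
lemma dot_scale_left: "dot M (scale_fun c x) z = c * dot M x z"
  by (simp add: dot_def scale_fun_def sum_distrib_left algebra_simps)
lemma dot_scale_right: "dot M z (scale_fun c x) = cnj c * dot M z x"
  by (simp add: dot_def scale_fun_def sum_distrib_left algebra_simps)
lemma dot_commute: "dot M y x = cnj (dot M x y)"
  by (simp add: dot_def mult.commute)

lemmas dot_simps = dot_add_left dot_add_right dot_diff_left dot_diff_right dot_scale_left dot_scale_right

lemma nsq_scale_add:
  assumes "dot M y x = 0"
  shows "nsq M (scale_fun c x + y) = (cmod c)\<^sup>2 * nsq M x + nsq M y"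
proof -
  have "dot M x y = 0" using dot_commute[of M x y] assms by simp
  then have "dot M (scale_fun c x + y) (scale_fun c x + y) = (c * cnj c) * dot M x x + dot M y y"
    using assms by (simp add: dot_simps)
  also have "\<dots> = of_real ((cmod c)\<^sup>2 * nsq M x + nsq M y)"
    by (simp only: complex_norm_square[symmetric] dot_self of_real_add of_real_mult)
  finally show ?thesis by (simp only: nsq_eq[of M "scale_fun c x + y"] Re_complex_of_real)
qed

definition linear_contraction :: "nat \<Rightarrow> ((nat \<Rightarrow> complex) \<Rightarrow> nat \<Rightarrow> complex) \<Rightarrow> bool" where
  "linear_contraction M U \<longleftrightarrow> (\<forall>x y. U (x + y) = U x + U y) \<and>
     (\<forall>c x. U (scale_fun c x) = scale_fun c (U x)) \<and> (\<forall>x. nsq M (U x) \<le> nsq M x)"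

text \<open>
  Equal Gram matrices are intertwined by a contraction. Induction on the number of vectors: split off
  the new pair \<open>a i0\<close>, \<open>b i0\<close>, apply the induction hypothesis to the projections of the other vectors to the
  orthogonal complements, and send \<open>a i0\<close> to \<open>b i0\<close>.
\<close>

lemma lurking_isometry:
  assumes "finite I" "\<And>i j. i \<in> I \<Longrightarrow> j \<in> I \<Longrightarrow> dot M (a i) (a j) = dot M (b i) (b j)"
  shows "\<exists>U. linear_contraction M U \<and> (\<forall>i\<in>I. \<forall>l<M. U (a i) l = b i l)"
proof -
  interpret vs: vector_space "scale_fun :: complex \<Rightarrow> (nat \<Rightarrow> complex) \<Rightarrow> nat \<Rightarrow> complex"
    by (rule vector_space_scale_fun)
  show ?thesis
    using assms
  proof (induction I arbitrary: a b rule: finite_induct)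
    case empty
    have "linear_contraction M (\<lambda>x. 0)"
      by (auto simp: linear_contraction_def scale_fun_def fun_eq_iff nsq_nonneg) (simp add: nsq_def sum_nonneg)
    then show ?case by blast
  next
    case (insert i0 I)
    define N where "N = nsq M (a i0)"
    have Nb: "nsq M (b i0) = N" unfolding N_def nsq_eq using insert.prems[of i0 i0] by simp
    show ?case
    proof (cases "N = 0")
      case True
      obtain U where U: "linear_contraction M U" "\<And>i l. i \<in> I \<Longrightarrow> l < M \<Longrightarrow> U (a i) l = b i l"
        using insert.IH[of a b] insert.prems by blast
      have "nsq M (U (a i0)) \<le> 0" using U(1) True by (metis linear_contraction_def N_def)
      then have "U (a i0) l = b i0 l" if "l < M" for l
        using nsq_le_0D[OF _ that] Nb True by (metis order_refl)
      with U show ?thesis by blast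
    next
      case False
      then have Npos: "N > 0" using nsq_nonneg[of M "a i0"] by (simp add: N_def)
      have da: "dot M (a i0) (a i0) = of_real N" and db: "dot M (b i0) (b i0) = of_real N"
        by (simp_all add: dot_self N_def Nb[unfolded N_def])
      define pa where "pa x = dot M x (a i0) / of_real N" for x
      define pb where "pb x = dot M x (b i0) / of_real N" for x
      have pab: "pa (a i) = pb (b i)" if "i \<in> insert i0 I" for i
        using insert.prems[OF that, of i0] by (simp add: pa_def pb_def)
      define a' where "a' i = a i - scale_fun (pa (a i)) (a i0)" for i
      define b' where "b' i = b i - scale_fun (pb (b i)) (b i0)" for i
      have "dot M (a' i) (a' j) = dot M (b' i) (b' j)" if "i \<in> I" "j \<in> I" for i j
        using that by (simp add: a'_def b'_def dot_simps pab insert.prems)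
      from insert.IH[of a' b', OF this] obtain U where U: "linear_contraction M U"
        and Ua: "\<And>i l. i \<in> I \<Longrightarrow> l < M \<Longrightarrow> U (a' i) l = b' i l" by blast
      have Uadd: "U (x + y) = U x + U y" and Uscale: "U (scale_fun c x) = scale_fun c (U x)"
        and Unsq: "nsq M (U x) \<le> nsq M x" for x y c
        using U by (auto simp: linear_contraction_def)
      define ra where "ra x = x - scale_fun (pa x) (a i0)" for x
      define rb where "rb x = x - scale_fun (pb x) (b i0)" for x
      define V where "V x = scale_fun (pa x) (b i0) + rb (U (ra x))" for x
      have orth: "dot M (ra x) (a i0) = 0" "dot M (rb x) (b i0) = 0" for x
        using Npos by (simp_all add: ra_def rb_def pa_def pb_def dot_simps da db)
      have na: "nsq M x = (cmod (pa x))\<^sup>2 * N + nsq M (ra x)" for x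
        using nsq_scale_add[OF orth(1)[of x], of "pa x"] by (simp add: ra_def N_def)
      have nb: "nsq M x = (cmod (pb x))\<^sup>2 * N + nsq M (rb x)" for x
        using nsq_scale_add[OF orth(2)[of x], of "pb x"] by (simp add: rb_def Nb)
      have "nsq M (V x) \<le> nsq M x" for x
      proof -
        have "nsq M (V x) = (cmod (pa x))\<^sup>2 * N + nsq M (rb (U (ra x)))"
          unfolding V_def nsq_scale_add[OF orth(2)] Nb ..
        also have "nsq M (rb (U (ra x))) \<le> nsq M (U (ra x))"
          using nb[of "U (ra x)"] Npos by simp
        also have "\<dots> \<le> nsq M (ra x)" by (rule Unsq)
        finally show ?thesis using na[of x] by simp
      qed
      moreover have "V (x + y) = V x + V y" for x y
      proof -
        have pq: "pa (x + y) = pa x + pa y" "pb (x' + y') = pb x' + pb y'" for x y x' y'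
          by (simp_all add: pa_def pb_def dot_simps add_divide_distrib)
        have "ra (x + y) = ra x + ra y" "rb (x' + y') = rb x' + rb y'" for x' y'
          by (simp_all only: ra_def rb_def pq vs.scale_left_distrib add_diff_add)
        then show ?thesis by (simp only: V_def Uadd pq vs.scale_left_distrib add_ac)
      qed
      moreover have "V (scale_fun c x) = scale_fun c (V x)" for c x
      proof -
        have pq: "pa (scale_fun c x) = c * pa x" "pb (scale_fun c x') = c * pb x'" for x x'
          by (simp_all add: pa_def pb_def dot_simps)
        have "ra (scale_fun c x) = scale_fun c (ra x)" "rb (scale_fun c x') = scale_fun c (rb x')" for x'
          by (simp_all only: ra_def rb_def pq vs.scale_right_diff_distrib vs.scale_scale)
        then show ?thesis by (simp only: V_def Uscale pq vs.scale_right_distrib vs.scale_scale)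
      qed
      ultimately have "linear_contraction M V" by (simp add: linear_contraction_def)
      moreover have "V (a i) l = b i l" if i: "i \<in> insert i0 I" and l: "l < M" for i l
      proof -
        have raa: "ra (a i) = a' i" by (simp add: ra_def a'_def)
        have Ub: "U (a' i) m = b' i m" if m: "m < M" for m
        proof (cases "i = i0")
          case True
          have 1: "a' i0 = 0" "b' i0 = 0"
            using Npos by (auto simp: a'_def b'_def pa_def pb_def da db scale_fun_def fun_eq_iff)
          have "nsq M (U (a' i0)) \<le> nsq M (a' i0)" by (rule Unsq)
          then have "nsq M (U (a' i0)) \<le> 0" by (simp add: 1 nsq_def)
          from nsq_le_0D[OF this m] show ?thesis by (simp add: True 1)
        qed (use Ua i m in auto)
        have "dot M (U (a' i)) (b i0) = dot M (b' i) (b i0)"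
          unfolding dot_def by (intro sum.cong) (auto simp: Ub)
        also have "\<dots> = 0" using orth(2)[of "b i"] by (simp add: rb_def b'_def)
        finally have "pb (U (a' i)) = 0" by (simp add: pb_def)
        then have "V (a i) l = pa (a i) * b i0 l + b' i l"
          using Ub[OF l] by (simp add: V_def raa rb_def scale_fun_def)
        also have "\<dots> = b i l" using pab[OF i] by (simp add: b'_def scale_fun_def)
        finally show ?thesis .
      qed
      ultimately show ?thesis by blast
    qed
  qed
qed

lemma linear_contraction_matrix:
  assumes U: "linear_contraction M U"
  shows "\<exists>A. \<forall>x. \<forall>l<M. U x l = (\<Sum>k<M. A l k * x k)"
proof -
  define e where "e k = (\<lambda>l. if l = k then 1 else 0 :: complex)" for k :: nat
  have Uadd: "U (x + y) = U x + U y" and Uscale: "U (scale_fun c x) = scale_fun c (U x)"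
    and Unsq: "nsq M (U x) \<le> nsq M x" for x y c
    using U by (auto simp: linear_contraction_def)
  have U0: "U 0 = 0" using Uadd[of 0 0] by simp
  have Usum: "U (\<Sum>k<n. scale_fun (x k) (e k)) = (\<Sum>k<n. scale_fun (x k) (U (e k)))" for x and n :: nat
    by (induction n) (simp_all only: lessThan_0 sum.empty U0 sum.lessThan_Suc Uadd Uscale)
  have "U x l = (\<Sum>k<M. U (e k) l * x k)" if l: "l < M" for x l
  proof -
    define y where "y = (\<Sum>k<M. scale_fun (x k) (e k))"
    define r where "r = x - y"
    have "y k = x k" if "k < M" for k
    proof -
      have "y k = (\<Sum>j<M. if j = k then x k else 0)"
        unfolding y_def fun_sum_apply by (intro sum.cong) (auto simp: scale_fun_def e_def)
      then show ?thesis using that by simp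
    qed
    then have "nsq M r = 0" by (simp add: nsq_def r_def)
    then have "nsq M (U r) \<le> 0" using Unsq[of r] by simp
    from nsq_le_0D[OF this l] have "U r l = 0" .
    moreover have "U x = U y + U r" using Uadd[of y r] by (simp add: r_def)
    ultimately have "U x l = U y l" by simp
    also have "\<dots> = (\<Sum>k<M. U (e k) l * x k)"
      unfolding y_def Usum fun_sum_apply by (simp add: scale_fun_def mult.commute)
    finally show ?thesis .
  qed
  then show ?thesis by (intro exI[of _ "\<lambda>l k. U (e k) l"]) blast
qed

section \<open>From a sum-of-squares identity to polynomials\<close>

lemma cmod_average_sq_le:
  assumes "N > 0"
  shows "(cmod ((\<Sum>n<N. f n) / of_nat N))\<^sup>2 \<le> (\<Sum>n<N. (cmod (f n))\<^sup>2) / N"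
proof -
  have "(cmod (\<Sum>n<N. f n))\<^sup>2 \<le> (\<Sum>n<N. cmod (f n))\<^sup>2"
    by (intro power_mono norm_sum) simp
  also have "\<dots> \<le> (\<Sum>n<N. (cmod (f n))\<^sup>2) * N"
    using sum_squared_le_sum_of_squares[of "\<lambda>n. cmod (f n)" "{..<N}"] by simp
  finally show ?thesis using assms
    by (simp add: norm_divide power_divide divide_simps power2_eq_square)
qed

text \<open>
  The identity says that the vectors \<open>(1, q v)\<close> and \<open>(W, v)\<close> have the same Gram matrix, so a contraction
  \<open>U\<close> maps the former to the latter. The transfer function would be obtained by solving
  \<open>U (1, q u) = (f, u)\<close> for the state \<open>u\<close>. The iteration \<open>U (1, q u\<^sub>n) = (f\<^sub>n, u\<^sub>n\<^sub>+\<^sub>1)\<close> from \<open>u\<^sub>0 = 0\<close> stays within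
  the polynomials, and contractivity of \<open>U\<close> makes two sums telescope:
  \<open>\<Sum> |f\<^sub>n|\<^sup>2 \<le> N\<close> everywhere on the domain and \<open>\<Sum> |f\<^sub>n - W|\<^sup>2 \<le> \<parallel>v\<parallel>\<^sup>2\<close> at the nodes. The averages of the \<open>f\<^sub>n\<close> are
  therefore bounded by 1 and converge to \<open>W\<close> at the nodes.
\<close>

lemma realization:
  fixes q v :: "nat \<Rightarrow> complex \<times> complex \<Rightarrow> complex" and W :: "complex \<times> complex \<Rightarrow> complex"
  assumes L: "finite L" "L \<subseteq> sym_bidisk"
    and q: "\<And>l. l < m \<Longrightarrow> q l \<in> polyball"
    and W: "\<And>x y. x \<in> L \<Longrightarrow> y \<in> L \<Longrightarrow>
      1 - W x * cnj (W y) = (\<Sum>l<m. (1 - q l x * cnj (q l y)) * (v l x * cnj (v l y)))"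
    and e: "e > 0"
  shows "\<exists>g\<in>polyball. \<forall>x\<in>L. cmod (g x - W x) < e"
proof -
  let ?M = "Suc m"
  define vec where "vec c u = (\<lambda>l. case l of 0 \<Rightarrow> c | Suc l \<Rightarrow> u l)" for c :: complex and u :: "nat \<Rightarrow> complex"
  have vec_simps [simp]: "vec c u 0 = c" "vec c u (Suc l) = u l" for c u l by (simp_all add: vec_def)
  have nsq_vec: "nsq ?M x = (cmod (x 0))\<^sup>2 + nsq m (\<lambda>l. x (Suc l))" for x
    unfolding nsq_def by (simp add: sum.lessThan_Suc_shift del: sum.lessThan_Suc)
  define a where "a x = vec 1 (\<lambda>l. q l x * v l x)" for x
  define b where "b x = vec (W x) (\<lambda>l. v l x)" for x
  have "dot ?M (a x) (a y) = dot ?M (b x) (b y)" if "x \<in> L" "y \<in> L" for x y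
  proof -
    have "dot ?M (a x) (a y) - dot ?M (b x) (b y)
        = 1 - W x * cnj (W y) - (\<Sum>l<m. (1 - q l x * cnj (q l y)) * (v l x * cnj (v l y)))"
      unfolding dot_def a_def b_def by (simp add: sum.lessThan_Suc_shift sum_subtractf algebra_simps del: sum.lessThan_Suc)
    then show ?thesis using W[OF that] by simp
  qed
  from lurking_isometry[of L _ a b, OF L(1) this] obtain U where U: "linear_contraction ?M U"
    and Uab: "\<And>x l. x \<in> L \<Longrightarrow> l < ?M \<Longrightarrow> U (a x) l = b x l" by blast
  obtain A where A: "\<And>x l. l < ?M \<Longrightarrow> U x l = (\<Sum>k<?M. A l k * x k)"
    using linear_contraction_matrix[OF U] by blast
  have Unsq: "nsq ?M (U x) \<le> nsq ?M x" and Uadd: "U (x + y) = U x + U y" for x y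
    using U by (auto simp: linear_contraction_def)
  have Udiff: "U (x - y) = U x - U y" for x y using Uadd[of "x - y" y] by simp
  define X where "X u z = vec 1 (\<lambda>l. q l z * u l)" for u z
  define u where "u = rec_nat (\<lambda>z l. 0) (\<lambda>n u z l. U (X (u z) z) (Suc l))"
  have u_0: "u 0 z = (\<lambda>l. 0)" and u_Suc: "u (Suc n) z = (\<lambda>l. U (X (u n z) z) (Suc l))" for n z
    by (simp_all add: u_def)
  define f where "f n z = U (X (u n z) z) 0" for n z
  have poly: "(\<lambda>z. X (u n z) z k) \<in> polyfuns" if "k < ?M" for n k
    using that
  proof (induction n arbitrary: k)
    case 0
    then show ?case by (cases k) (simp_all add: X_def u_0 polyfuns_const)
  next
    case (Suc n)
    show ?case
    proof (cases k)
      case 0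
      then show ?thesis by (simp add: X_def polyfuns_const)
    next
      case (Suc l)
      then have l: "l < m" using Suc.prems by simp
      have "(\<lambda>z. q l z * (\<Sum>j<?M. A (Suc l) j * X (u n z) z j)) \<in> polyfuns"
        using q[OF l] unfolding polyball_def
        by (intro polyfuns_mult polyfuns_sum polyfuns_const Suc.IH) auto
      moreover have "X (u (Suc n) z) z k = q l z * (\<Sum>j<?M. A (Suc l) j * X (u n z) z j)" for z
        unfolding u_Suc using A[of "Suc l" "X (u n z) z"] l by (simp add: X_def Suc del: sum.lessThan_Suc)
      ultimately show ?thesis by simp
    qed
  qed
  have f_poly: "f n \<in> polyfuns" for n
  proof -
    have "(\<lambda>z. \<Sum>k<?M. A 0 k * X (u n z) z k) \<in> polyfuns"
      by (intro polyfuns_sum polyfuns_mult polyfuns_const poly) auto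
    moreover have "f n = (\<lambda>z. \<Sum>k<?M. A 0 k * X (u n z) z k)"
      unfolding f_def using A[of 0] by auto
    ultimately show ?thesis by simp
  qed
  have contract: "nsq m (\<lambda>l. q l z * w l) \<le> nsq m w" if z: "z \<in> sym_bidisk" for z w
    unfolding nsq_def
  proof (rule sum_mono)
    fix l assume "l \<in> {..<m}"
    then have "cmod (q l z) \<le> 1" using q[of l] z by (simp add: polyball_def)
    then have "cmod (q l z * w l) \<le> cmod (w l)" by (simp add: norm_mult mult_left_le_one_le)
    then show "(cmod (q l z * w l))\<^sup>2 \<le> (cmod (w l))\<^sup>2" by (rule power_mono) simp
  qed
  have step: "(cmod (f n z))\<^sup>2 + nsq m (u (Suc n) z) \<le> 1 + nsq m (u n z)" if z: "z \<in> sym_bidisk" for n z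
  proof -
    have "(cmod (f n z))\<^sup>2 + nsq m (u (Suc n) z) = nsq ?M (U (X (u n z) z))"
      unfolding nsq_vec f_def u_Suc ..
    also have "\<dots> \<le> nsq ?M (X (u n z) z)" by (rule Unsq)
    also have "\<dots> \<le> 1 + nsq m (u n z)" unfolding nsq_vec using contract[OF z] by (simp add: X_def)
    finally show ?thesis .
  qed
  have total: "(\<Sum>n<N. (cmod (f n z))\<^sup>2) \<le> N - nsq m (u N z)" if z: "z \<in> sym_bidisk" for N z
  proof (induction N)
    case 0
    show ?case by (simp add: u_0 nsq_def)
  next
    case (Suc N)
    then show ?case using step[OF z, of N] by simp
  qed
  have step': "(cmod (f n x - W x))\<^sup>2 + nsq m (u (Suc n) x - (\<lambda>l. v l x)) \<le> nsq m (u n x - (\<lambda>l. v l x))"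
    if x: "x \<in> L" for n x
  proof -
    let ?d = "X (u n x) x - a x"
    have "(cmod (f n x - W x))\<^sup>2 + nsq m (u (Suc n) x - (\<lambda>l. v l x)) = nsq ?M (U ?d)"
      unfolding nsq_vec Udiff by (simp add: Uab[OF x] f_def u_Suc b_def nsq_def)
    also have "\<dots> \<le> nsq ?M ?d" by (rule Unsq)
    also have "\<dots> = nsq m (\<lambda>l. q l x * (u n x - (\<lambda>l. v l x)) l)"
      unfolding nsq_vec by (simp add: X_def a_def algebra_simps)
    also have "\<dots> \<le> nsq m (u n x - (\<lambda>l. v l x))" using contract x L by blast
    finally show ?thesis .
  qed
  have total': "(\<Sum>n<N. (cmod (f n x - W x))\<^sup>2) \<le> nsq m (\<lambda>l. v l x) - nsq m (u N x - (\<lambda>l. v l x))" if x: "x \<in> L" for N x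
  proof (induction N)
    case 0
    show ?case by (simp add: u_0 nsq_def)
  next
    case (Suc N)
    then show ?case using step'[OF x, of N] unfolding sum.lessThan_Suc by linarith
  qed
  define B where "B = (\<Sum>x\<in>L. nsq m (\<lambda>l. v l x))"
  have B: "nsq m (\<lambda>l. v l x) \<le> B" if "x \<in> L" for x
    unfolding B_def by (rule member_le_sum) (use that L nsq_nonneg in auto)
  obtain N :: nat where N: "N > 0" "B / N < e\<^sup>2"
  proof -
    obtain N :: nat where "B / e\<^sup>2 < N" using reals_Archimedean2 by blast
    then have "B / e\<^sup>2 < Suc N" by simp
    then have "B / Suc N < e\<^sup>2" using e by (simp add: field_simps)
    then show ?thesis using that by blast
  qed
  define g where "g z = (\<Sum>n<N. f n z) / of_nat N" for z
  have "g \<in> polyball" unfolding polyball_def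
  proof (intro CollectI conjI ballI)
    have "(\<lambda>z. (1 / of_nat N) * (\<Sum>n<N. f n z)) \<in> polyfuns"
      by (intro polyfuns_mult polyfuns_const polyfuns_sum f_poly)
    then show "g \<in> polyfuns" by (simp add: g_def[abs_def])
    fix z assume z: "z \<in> sym_bidisk"
    have "(cmod (g z))\<^sup>2 \<le> (\<Sum>n<N. (cmod (f n z))\<^sup>2) / N"
      unfolding g_def by (rule cmod_average_sq_le[OF N(1)])
    also have "\<dots> \<le> N / N" using total[OF z, of N] nsq_nonneg[of m "u N z"] by (intro divide_right_mono) auto
    finally show "cmod (g z) \<le> 1" using N(1) by (simp add: power_le_one_iff)
  qed
  moreover have "cmod (g x - W x) < e" if x: "x \<in> L" for x
  proof -
    have "g x - W x = (\<Sum>n<N. (f n x - W x)) / of_nat N"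
      using N(1) by (simp add: g_def sum_subtractf field_simps)
    then have "(cmod (g x - W x))\<^sup>2 \<le> (\<Sum>n<N. (cmod (f n x - W x))\<^sup>2) / N"
      using cmod_average_sq_le[OF N(1), of "\<lambda>n. f n x - W x"] by simp
    also have "\<dots> \<le> B / N"
      using total'[OF x, of N] nsq_nonneg[of m "u N x - (\<lambda>l. v l x)"] B[OF x] by (intro divide_right_mono) auto
    also have "\<dots> < e\<^sup>2" by (rule N)
    finally show ?thesis using e by (simp add: power_less_imp_less_base)
  qed
  ultimately show ?thesis by blast
qed


section \<open>The Pick condition yields approximate interpolation by polynomials\<close>

lemma lagrange_polyfun:
  assumes "finite L"
  shows "\<exists>h\<in>polyfuns. h x0 = 1 \<and> (\<forall>x\<in>L - {x0}. h x = 0)"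
proof -
  define h where "h z = (\<Prod>x\<in>L - {x0}. if fst x \<noteq> fst x0 then (1 / (fst x0 - fst x)) * (fst z - fst x)
    else (1 / (snd x0 - snd x)) * (snd z - snd x))" for z :: "complex \<times> complex"
  have "(\<lambda>z. if fst x \<noteq> fst x0 then (1 / (fst x0 - fst x)) * (fst z - fst x)
      else (1 / (snd x0 - snd x)) * (snd z - snd x)) \<in> polyfuns" for x
    by (cases "fst x \<noteq> fst x0")
      (simp_all only: if_True if_False polyfuns_mult polyfuns_diff polyfuns_const polyfuns_fst polyfuns_snd not_not simp_thms)
  then have "h \<in> polyfuns" unfolding h_def[abs_def] by (rule polyfuns_prod)
  moreover have "h x0 = 1" unfolding h_def
    by (rule prod.neutral) (auto simp: prod_eq_iff)
  moreover have "h x = 0" if "x \<in> L - {x0}" for x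
    unfolding h_def using that assms by (auto simp: prod_zero_iff intro!: bexI[of _ x])
  ultimately show ?thesis by blast
qed

lemma sum_diag:
  fixes f :: "'a \<Rightarrow> complex"
  assumes "finite L"
  shows "(\<Sum>x\<in>L. \<Sum>y\<in>L. (if x = y then f x else 0) * K x y) = (\<Sum>x\<in>L. f x * K x x)"
proof (rule sum.cong)
  fix x assume "x \<in> L"
  have "(\<Sum>y\<in>L. (if x = y then f x else 0) * K x y) = (\<Sum>y\<in>L. if x = y then f x * K x y else 0)"
    by (rule sum.cong) auto
  then show "(\<Sum>y\<in>L. (if x = y then f x else 0) * K x y) = f x * K x x"
    using assms \<open>x \<in> L\<close> by simp
qed simp

text \<open>
  Suppose \<open>1 - r\<^sup>2 W W\<^sup>*\<close> is not in the cone of the matrices \<open>\<Sum> (1 - q q\<^sup>*) v v\<^sup>*\<close>. A separating functional is a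
  positive matrix \<open>K\<close> that yields admissible kernels, so the Pick condition gives \<open>\<langle>1 - W W\<^sup>*, K\<rangle> \<ge> 0\<close>. As
  \<open>1 - r\<^sup>2 W W\<^sup>* = r\<^sup>2 (1 - W W\<^sup>*) + (1 - r\<^sup>2) 1 1\<^sup>*\<close>, the sum of all entries of \<open>K\<close> is at most 0. Contractivity
  of a multiple of a Lagrange polynomial then makes every diagonal entry of \<open>K\<close> nonpositive,
  contradicting that \<open>K\<close> has trace 1. Shrinking \<open>W\<close> to \<open>r W\<close> avoids the question whether the cone is closed.
  
  Matrices are functions on pairs of points, and the cone constrains only the Hermitian part
  \<open>X + X\<^sup>*\<close> of the block indexed by \<open>L\<close>; so functionals that are nonnegative on it vanish on
  skew-Hermitian matrices.
\<close>

lemma polyball_approx_of_psd: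
  fixes W :: "complex \<times> complex \<Rightarrow> complex"
  assumes L: "finite L" "L \<subseteq> sym_bidisk" and \<epsilon>: "\<epsilon> > 0"
    and psd: "\<And>k. admissible k \<Longrightarrow> 0 \<le> Re (\<Sum>x\<in>L. \<Sum>y\<in>L. (1 - W x * cnj (W y)) * k x y)"
  shows "\<exists>g\<in>polyball. \<forall>x\<in>L. cmod (g x - W x) < \<epsilon>"
proof -
  define w0 where "w0 = (\<Sum>x\<in>L. cmod (W x)) + 1"
  have w0: "cmod (W x) < w0" if "x \<in> L" for x
    using member_le_sum[of x L "\<lambda>x. cmod (W x)"] L that unfolding w0_def by simp
  have w0pos: "w0 > 0" unfolding w0_def by (simp add: sum_nonneg add_nonneg_pos)
  define r where "r = max 0 (1 - \<epsilon> / (2 * w0))"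
  have r: "0 \<le> r" "r < 1" "(1 - r) * w0 \<le> \<epsilon> / 2" using \<epsilon> w0pos by (auto simp: r_def max_def field_simps)
  define sc where "sc t X = (\<lambda>p. complex_of_real t * X p)" for t and X :: "(complex \<times> complex) \<times> (complex \<times> complex) \<Rightarrow> complex"
  have vs: "vector_space sc"
    by unfold_locales (auto simp: sc_def fun_eq_iff algebra_simps)
  define rep where "rep qs X \<longleftrightarrow> (\<forall>x\<in>L. \<forall>y\<in>L. X (x, y) + cnj (X (y, x)) =
      (\<Sum>(q, v)\<leftarrow>qs. (1 - q x * cnj (q y)) * (v x * cnj (v y))))"
    for qs :: "((complex \<times> complex \<Rightarrow> complex) \<times> (complex \<times> complex \<Rightarrow> complex)) list"
      and X :: "(complex \<times> complex) \<times> (complex \<times> complex) \<Rightarrow> complex"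
  define C where "C = {X. \<exists>qs. (\<forall>(q, v)\<in>set qs. q \<in> polyball) \<and> rep qs X}"
  have CI: "X \<in> C" if "\<And>q v. (q, v) \<in> set qs \<Longrightarrow> q \<in> polyball" "rep qs X" for qs X
    using that by (auto simp: C_def)
  have Cadd: "X + Y \<in> C" if XY: "X \<in> C" "Y \<in> C" for X Y
  proof -
    obtain qs ps where *: "\<And>q v. (q, v) \<in> set qs \<Longrightarrow> q \<in> polyball" "rep qs X"
      "\<And>q v. (q, v) \<in> set ps \<Longrightarrow> q \<in> polyball" "rep ps Y"
      using XY unfolding C_def by blast
    show ?thesis
    proof (rule CI[of "qs @ ps"])
      show "rep (qs @ ps) (X + Y)" unfolding rep_def
      proof (intro ballI)
        fix x y assume xy: "x \<in> L" "y \<in> L"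
        have "(X + Y) (x, y) + cnj ((X + Y) (y, x)) = (X (x, y) + cnj (X (y, x))) + (Y (x, y) + cnj (Y (y, x)))"
          by simp
        also have "\<dots> = (\<Sum>(q, v)\<leftarrow>qs. (1 - q x * cnj (q y)) * (v x * cnj (v y))) + (\<Sum>(q, v)\<leftarrow>ps. (1 - q x * cnj (q y)) * (v x * cnj (v y)))"
          by (simp only: *(2)[unfolded rep_def, rule_format, OF xy] *(4)[unfolded rep_def, rule_format, OF xy])
        finally show "(X + Y) (x, y) + cnj ((X + Y) (y, x)) = (\<Sum>(q, v)\<leftarrow>qs @ ps. (1 - q x * cnj (q y)) * (v x * cnj (v y)))"
          by simp
      qed
    qed (use * in auto)
  qed
  have Cscl: "sc t X \<in> C" if t: "0 \<le> t" and X: "X \<in> C" for t X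
  proof -
    obtain qs where *: "\<And>q v. (q, v) \<in> set qs \<Longrightarrow> q \<in> polyball" "rep qs X"
      using X unfolding C_def by blast
    let ?qs = "map (\<lambda>(q, v). (q, \<lambda>x. complex_of_real (sqrt t) * v x)) qs"
    have tt: "complex_of_real (sqrt t) * complex_of_real (sqrt t) = of_real t"
      using t by (simp flip: of_real_mult)
    have sum: "(\<Sum>(q, v)\<leftarrow>?qs. (1 - q x * cnj (q y)) * (v x * cnj (v y)))
        = of_real t * (\<Sum>(q, v)\<leftarrow>qs. (1 - q x * cnj (q y)) * (v x * cnj (v y)))" for x y
      by (induction qs) (auto simp: algebra_simps tt[symmetric])
    show ?thesis
    proof (rule CI[of ?qs])
      show "rep ?qs (sc t X)" unfolding rep_def
      proof (intro ballI)
        fix x y assume xy: "x \<in> L" "y \<in> L"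
        have "sc t X (x, y) + cnj (sc t X (y, x)) = of_real t * (X (x, y) + cnj (X (y, x)))"
          by (simp add: sc_def algebra_simps)
        then show "sc t X (x, y) + cnj (sc t X (y, x)) = (\<Sum>(q, v)\<leftarrow>?qs. (1 - q x * cnj (q y)) * (v x * cnj (v y)))"
          unfolding sum by (simp only: *(2)[unfolded rep_def, rule_format, OF xy])
      qed
    qed (use * in auto)
  qed
  have Cnull: "X \<in> C" if "\<And>x y. x \<in> L \<Longrightarrow> y \<in> L \<Longrightarrow> X (x, y) + cnj (X (y, x)) = 0" for X
    by (rule CI[of "[]"]) (use that in \<open>auto simp: rep_def\<close>)
  have zero_ball: "(\<lambda>z. 0) \<in> polyball" by (simp add: polyball_def polyfuns_const)
  have Cone: "X \<in> C" if g: "g \<in> polyball" and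
    X: "\<And>x y. x \<in> L \<Longrightarrow> y \<in> L \<Longrightarrow> X (x, y) + cnj (X (y, x)) = (1 - g x * cnj (g y)) * (v x * cnj (v y))" for g v X
    by (rule CI[of "[(g, v)]"]) (use that in \<open>auto simp: rep_def\<close>)
  have Cdiag: "X \<in> C" if d: "\<And>x. x \<in> L \<Longrightarrow> 0 \<le> d x"
    and X: "\<And>x y. x \<in> L \<Longrightarrow> y \<in> L \<Longrightarrow> X (x, y) + cnj (X (y, x)) = (if x = y then complex_of_real (d x) else 0)" for d X
  proof -
    obtain xs where xs: "set xs = L" "distinct xs" using finite_distinct_list[OF L(1)] by blast
    let ?v = "\<lambda>z x. if x = z then complex_of_real (sqrt (d z)) else 0"
    let ?qs = "map (\<lambda>z. (\<lambda>_. 0, ?v z)) xs"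
    show ?thesis
    proof (rule CI[of ?qs])
      show "rep ?qs X" unfolding rep_def
      proof (intro ballI)
        fix x y assume xy: "x \<in> L" "y \<in> L"
        have "(\<Sum>(q, v)\<leftarrow>?qs. (1 - q x * cnj (q y)) * (v x * cnj (v y))) = (\<Sum>z\<leftarrow>xs. ?v z x * cnj (?v z y))"
          by (simp add: o_def)
        also have "\<dots> = (\<Sum>z\<in>L. ?v z x * cnj (?v z y))"
          using xs by (simp only: sum_list_distinct_conv_sum_set)
        also have "\<dots> = (\<Sum>z\<in>L. if z = x then (if x = y then complex_of_real (d x) else 0) else 0)"
          by (intro sum.cong) (use d in \<open>auto simp flip: of_real_mult\<close>)
        also have "\<dots> = (if x = y then complex_of_real (d x) else 0)"
          using L(1) xy by (subst sum.delta) auto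
        finally show "X (x, y) + cnj (X (y, x)) = (\<Sum>(q, v)\<leftarrow>?qs. (1 - q x * cnj (q y)) * (v x * cnj (v y)))"
          using X[OF xy] by simp
      qed
    qed (use zero_ball in auto)
  qed
  define e where "e = (\<lambda>p::(complex \<times> complex) \<times> (complex \<times> complex). if fst p = snd p then 1 else 0 :: complex)"
  have eC: "e \<in> C" by (rule Cdiag[of "\<lambda>_. 2"]) (auto simp: e_def)
  define El where "El a x0 y0 = (\<lambda>p. if p = (x0, y0) then a else 0)" for a :: complex and x0 y0 :: "complex \<times> complex"
  define T where "T = {X. \<exists>t\<ge>0. sc t e + X \<in> C}"
  have Tadd: "X + Y \<in> T" if XY: "X \<in> T" "Y \<in> T" for X Y
  proof -
    obtain s t where st: "s \<ge> 0" "t \<ge> 0" "sc s e + X \<in> C" "sc t e + Y \<in> C" using XY by (auto simp: T_def)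
    have "sc (s + t) e + (X + Y) = (sc s e + X) + (sc t e + Y)" by (auto simp: sc_def fun_eq_iff algebra_simps)
    with Cadd[OF st(3,4)] have "sc (s + t) e + (X + Y) \<in> C" by (simp only:)
    with st(1,2) show ?thesis unfolding T_def by (intro CollectI exI[of _ "s + t"] conjI add_nonneg_nonneg)
  qed
  have TEl: "El a x0 y0 \<in> T" if xy0: "x0 \<in> L" "y0 \<in> L" for a x0 y0
  proof -
    define t where "t = 1 + (cmod a)\<^sup>2"
    \<comment> \<open>\<open>v v\<^sup>*\<close> has the off-diagonal entries \<open>a\<close> and \<open>cnj a\<close>; its diagonal is absorbed by \<open>t e\<close>\<close>
    define v where "v z = (if z = x0 then 1 else 0) + (if z = y0 then cnj a else 0)" for z
    define Y where "Y p = (1/2) * (v (fst p) * cnj (v (snd p)))" for p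
    define d where "d z = 2 * t - (if z = x0 then 1 else 0) - (if z = y0 then (cmod a)\<^sup>2 else 0)" for z
    have aa: "complex_of_real ((cmod a)\<^sup>2) = a * cnj a" by (rule complex_norm_square)
    have "Y \<in> C" by (rule Cone[OF zero_ball, of _ v]) (simp add: Y_def)
    moreover have "sc t e + El a x0 y0 - Y \<in> C"
    proof (rule Cdiag[of d])
      show "0 \<le> d z" for z by (auto simp: d_def t_def)
      fix x y
      define ax ay bx ry i where "ax = (of_bool (x = x0) :: complex)" and "ay = (of_bool (y = x0) :: complex)"
        and "bx = (of_bool (x = y0) :: complex)" and "ry = (of_bool (y = y0) :: complex)"
        and "i = (of_bool (x = y) :: complex)"
      note defs = ax_def ay_def bx_def ry_def i_def
      have real: "cnj ax = ax" "cnj ay = ay" "cnj bx = bx" "cnj ry = ry" "cnj i = i"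
        by (simp_all add: defs)
      have prods: "ax * ay = i * ax" "bx * ry = i * bx"
        by (auto simp: defs)
      have v: "v x = ax + cnj a * bx" "v y = ay + cnj a * ry" by (auto simp: v_def defs)
      have e: "e (x, y) = i" "e (y, x) = i" by (auto simp: e_def defs)
      have El: "El a x0 y0 (x, y) = a * (ax * ry)" "El a x0 y0 (y, x) = a * (ay * bx)"
        by (auto simp: El_def defs)
      have "complex_of_real (if x = y0 then (cmod a)\<^sup>2 else 0) = (a * cnj a) * bx"
        using aa by (auto simp: defs)
      then have d: "(if x = y then complex_of_real (d x) else 0) = i * (2 * of_real t - ax - (a * cnj a) * bx)"
        by (auto simp: d_def defs)
      have "(sc t e + El a x0 y0 - Y) (x, y) + cnj ((sc t e + El a x0 y0 - Y) (y, x))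
          = 2 * of_real t * i - ax * ay - (a * cnj a) * (bx * ry)"
        by (simp add: sc_def Y_def e El v real field_simps)
      also have "\<dots> = (if x = y then complex_of_real (d x) else 0)"
        unfolding prods d by (simp add: algebra_simps)
      finally show "(sc t e + El a x0 y0 - Y) (x, y) + cnj ((sc t e + El a x0 y0 - Y) (y, x)) = (if x = y then complex_of_real (d x) else 0)" .
    qed
    ultimately have "Y + (sc t e + El a x0 y0 - Y) \<in> C" by (rule Cadd)
    moreover have "t \<ge> 0" by (simp add: t_def)
    ultimately show ?thesis unfolding T_def by auto
  qed
  define XL where "XL X = (\<Sum>p\<in>L \<times> L. El (X p) (fst p) (snd p))" for X
  have finLL: "finite (L \<times> L)" using L by simp
  have XL_app: "XL X (x, y) = X (x, y)" if "x \<in> L" "y \<in> L" for X x y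
  proof -
    have "XL X (x, y) = (\<Sum>p\<in>L \<times> L. if p = (x, y) then X (x, y) else 0)"
      unfolding XL_def fun_sum_apply by (intro sum.cong) (auto simp: El_def)
    then show ?thesis using that finLL by (simp add: sum.delta)
  qed
  have rest: "X - XL X \<in> C" "- (X - XL X) \<in> C" for X
    by (rule Cnull; simp add: XL_app)+
  have unit: "\<exists>t\<ge>0. sc t e + X \<in> C" for X
  proof -
    have "0 \<in> T" unfolding T_def by (auto intro!: exI[of _ 0] Cnull simp: sc_def)
    have "(\<Sum>p\<in>A. El (X p) (fst p) (snd p)) \<in> T" if "A \<subseteq> L \<times> L" for A
      using finite_subset[OF that finLL] that
    proof (induction A rule: finite_induct)
      case empty
      then show ?case using \<open>0 \<in> T\<close> by (simp only: sum.empty)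
    next
      case (insert p A)
      have "El (X p) (fst p) (snd p) \<in> T" using insert.prems by (intro TEl) auto
      moreover have "(\<Sum>p\<in>A. El (X p) (fst p) (snd p)) \<in> T" using insert by auto
      ultimately show ?case unfolding sum.insert[OF insert(1,2)] by (rule Tadd)
    qed
    then have "XL X \<in> T" unfolding XL_def by simp
    moreover have "X - XL X \<in> T"
      unfolding T_def using rest(1)[of X] by (auto intro!: exI[of _ 0] simp: sc_def simp flip: zero_fun_def)
    ultimately have "XL X + (X - XL X) \<in> T" by (rule Tadd)
    then show ?thesis by (simp add: T_def)
  qed
  define M where "M p = (1/2) * (1 - of_real (r\<^sup>2) * (W (fst p) * cnj (W (snd p))))" for p
  have "M \<in> C"
  proof (rule ccontr)
    assume "M \<notin> C"
    have "\<exists>\<phi>. (\<forall>X Y. \<phi> (X + Y) = \<phi> X + \<phi> Y) \<and> (\<forall>t X. \<phi> (sc t X) = t * \<phi> X) \<and>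
        (\<forall>X\<in>C. 0 \<le> \<phi> X) \<and> \<phi> M \<le> 0 \<and> \<phi> e = 1"
      by (rule cone_functional[OF vs]) (fact Cadd Cscl eC unit \<open>M \<notin> C\<close>)+
    then obtain \<phi> where phi: "(\<forall>X Y. \<phi> (X + Y) = \<phi> X + \<phi> Y) \<and> (\<forall>t X. \<phi> (sc t X) = t * \<phi> X) \<and>
        (\<forall>X\<in>C. 0 \<le> \<phi> X) \<and> \<phi> M \<le> 0 \<and> \<phi> e = 1" ..
    have phi_add: "\<phi> (X + Y) = \<phi> X + \<phi> Y" for X Y using phi by blast
    have phi_sc: "\<phi> (sc t X) = t * \<phi> X" for t X using phi by blast
    have phi_C: "0 \<le> \<phi> X" if "X \<in> C" for X using phi that by blast
    have phi_M: "\<phi> M \<le> 0" and phi_e: "\<phi> e = 1" using phi by blast+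
    have phi_0: "\<phi> 0 = 0" using phi_add[of 0 0] by simp
    have phi_minus: "\<phi> (- X) = - \<phi> X" for X using phi_add[of X "- X"] phi_0 by simp
    have phi_null: "\<phi> X = 0" if "X \<in> C" "- X \<in> C" for X
      using phi_C[OF that(1)] phi_C[OF that(2)] phi_minus[of X] by simp
    have phi_skew: "\<phi> X = 0" if "\<And>x y. X (x, y) + cnj (X (y, x)) = 0" for X
    proof (rule phi_null; rule Cnull)
      fix x y
      show "X (x, y) + cnj (X (y, x)) = 0" by (rule that)
      have "(- X) (x, y) + cnj ((- X) (y, x)) = - (X (x, y) + cnj (X (y, x)))" by simp
      then show "(- X) (x, y) + cnj ((- X) (y, x)) = 0" by (simp only: that minus_zero)
    qed
    have El_app: "El a x y (u, w) = (if u = x \<and> w = y then a else 0)" for a x y u w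
      by (simp only: El_def prod.inject)
    \<comment> \<open>the matrix that represents \<open>\<phi>\<close> by \<open>X \<mapsto> Re (\<Sum> X K)\<close>\<close>
    define K where "K x y = of_real (\<phi> (El 1 x y)) - \<i> * of_real (\<phi> (El \<i> x y))" for x y
    have phi_El: "\<phi> (El a x y) = Re (a * K x y)" for a x y
    proof -
      have "El a x y = sc (Re a) (El 1 x y) + sc (Im a) (El \<i> x y)"
        by (auto simp: El_def sc_def fun_eq_iff complex_eq_iff)
      then show ?thesis by (simp add: phi_add phi_sc K_def)
    qed
    have phi_sum: "\<phi> (\<Sum>p\<in>A. F p) = (\<Sum>p\<in>A. \<phi> (F p))" if "finite A" for A and F :: "_ \<Rightarrow> _"
      using that by (induction A rule: finite_induct) (simp_all only: sum.empty sum.insert phi_0 phi_add not_False_eq_True simp_thms)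
    have phi_eq: "\<phi> X = Re (\<Sum>x\<in>L. \<Sum>y\<in>L. X (x, y) * K x y)" for X
    proof -
      have "\<phi> X = \<phi> (XL X) + \<phi> (X - XL X)" using phi_add[of "XL X" "X - XL X"] by simp
      also have "\<phi> (X - XL X) = 0" by (intro phi_null rest)
      also have "\<phi> (XL X) = (\<Sum>p\<in>L \<times> L. Re (X p * K (fst p) (snd p)))"
        unfolding XL_def phi_sum[OF finLL] phi_El ..
      also have "\<dots> = Re (\<Sum>x\<in>L. \<Sum>y\<in>L. X (x, y) * K x y)"
        by (simp only: sum.cartesian_product Re_sum case_prod_unfold prod.collapse)
      finally show ?thesis by simp
    qed
    have herm: "K y x = cnj (K x y)" if "x \<in> L" "y \<in> L" for x y
    proof -
      have "\<phi> (El a x y + El (- cnj a) y x) = 0" for a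
      proof (rule phi_skew)
        fix u w
        show "(El a x y + El (- cnj a) y x) (u, w) + cnj ((El a x y + El (- cnj a) y x) (w, u)) = 0"
          unfolding plus_fun_apply El_app
          by (cases "u = x"; cases "w = y"; cases "w = x"; cases "u = y") simp_all
      qed
      from this[of 1] this[of \<i>]
      have "\<phi> (El 1 x y) = \<phi> (El 1 y x)" "\<phi> (El \<i> x y) = - \<phi> (El \<i> y x)"
        unfolding phi_add phi_El by (simp_all add: K_def)
      then show ?thesis by (simp add: K_def)
    qed
    have contr: "0 \<le> Re (\<Sum>x\<in>L. \<Sum>y\<in>L. (1 - g x * cnj (g y)) * K x y * v y * cnj (v x))"
      if g: "g \<in> polyball" for g v
    proof -
      define X where "X p = (1/2) * ((1 - g (fst p) * cnj (g (snd p))) * (cnj (v (fst p)) * v (snd p)))" for p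
      have "X \<in> C" by (rule Cone[OF g, of _ "\<lambda>x. cnj (v x)"]) (simp add: X_def algebra_simps)
      then have "0 \<le> \<phi> X" by (rule phi_C)
      also have "\<phi> X = Re (of_real (1/2) * (\<Sum>x\<in>L. \<Sum>y\<in>L. (1 - g x * cnj (g y)) * K x y * v y * cnj (v x)))"
        unfolding phi_eq sum_distrib_left by (intro arg_cong[of _ _ Re] sum.cong refl) (simp add: X_def)
      finally show ?thesis unfolding Re_of_real_times by simp
    qed
    define S where "S F = Re (\<Sum>x\<in>L. \<Sum>y\<in>L. F x y * K x y)" for F :: "complex \<times> complex \<Rightarrow> complex \<times> complex \<Rightarrow> complex"
    have contr1: "0 \<le> S (\<lambda>x y. 1 - g x * cnj (g y))" if "g \<in> polyball" for g
      using contr[OF that, of "\<lambda>_. 1"] by (simp only: S_def complex_cnj_one mult_1_right)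
    have S_lin: "S (\<lambda>x y. of_real s * F x y + of_real t * H x y) = s * S F + t * S H" for s t F H
    proof -
      have "(\<Sum>x\<in>L. \<Sum>y\<in>L. (of_real s * F x y + of_real t * H x y) * K x y)
        = of_real s * (\<Sum>x\<in>L. \<Sum>y\<in>L. F x y * K x y) + of_real t * (\<Sum>x\<in>L. \<Sum>y\<in>L. H x y * K x y)"
        unfolding sum_distrib_left sum.distrib[symmetric] by (intro sum.cong refl) (simp add: algebra_simps)
      then show ?thesis unfolding S_def by (simp only: plus_complex.sel Re_of_real_times)
    qed
    have SW: "0 \<le> S (\<lambda>x y. 1 - W x * cnj (W y))"
    proof -
      define B where "B = Re (\<Sum>x\<in>L. 1 - W x * cnj (W x))"
      have *: "0 \<le> S (\<lambda>x y. 1 - W x * cnj (W y)) + \<delta> * B" if "\<delta> > 0" for \<delta>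
      proof -
        have "0 \<le> Re (\<Sum>x\<in>L. \<Sum>y\<in>L. (1 - W x * cnj (W y)) * atomic_kernel K \<delta> L x y)"
          by (intro psd admissible_atomic_kernel L that herm contr)
        also have "(\<Sum>x\<in>L. \<Sum>y\<in>L. (1 - W x * cnj (W y)) * atomic_kernel K \<delta> L x y) =
          (\<Sum>x\<in>L. \<Sum>y\<in>L. (1 - W x * cnj (W y)) * K x y) +
          (\<Sum>x\<in>L. \<Sum>y\<in>L. (if x = y then of_real \<delta> else 0) * (1 - W x * cnj (W y)))"
          unfolding sum.distrib[symmetric] by (intro sum.cong refl) (auto simp: atomic_kernel_def algebra_simps)
        also have "(\<Sum>x\<in>L. \<Sum>y\<in>L. (if x = y then of_real \<delta> else 0) * (1 - W x * cnj (W y)))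
          = of_real \<delta> * (\<Sum>x\<in>L. 1 - W x * cnj (W x))"
          using sum_diag[OF L(1), of "\<lambda>_. of_real \<delta>" "\<lambda>x y. 1 - W x * cnj (W y)"] by (simp only: sum_distrib_left)
        finally show ?thesis by (simp only: S_def B_def plus_complex.sel Re_of_real_times)
      qed
      show ?thesis
      proof (rule ccontr)
        assume neg: "\<not> ?thesis"
        define A where "A = S (\<lambda>x y. 1 - W x * cnj (W y))"
        have A: "A < 0" using neg by (simp add: A_def)
        define \<delta> where "\<delta> = - A / (2 * (\<bar>B\<bar> + 1))"
        have "\<delta> > 0" unfolding \<delta>_def using A by (intro divide_pos_pos) auto
        have "\<delta> * B \<le> \<delta> * (\<bar>B\<bar> + 1)" using \<open>\<delta> > 0\<close> by (intro mult_left_mono) auto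
        also have "\<dots> = - A / 2" by (simp add: \<delta>_def field_simps)
        finally show False using *[OF \<open>\<delta> > 0\<close>] A by (simp add: A_def)
      qed
    qed
    have S1: "0 \<le> S (\<lambda>x y. 1)" using contr1[OF zero_ball] by simp
    have "\<phi> M = (1/2) * S (\<lambda>x y. 1 - of_real (r\<^sup>2) * (W x * cnj (W y)))"
      using S_lin[of "1/2" "\<lambda>x y. 1 - of_real (r\<^sup>2) * (W x * cnj (W y))" 0 "\<lambda>x y. 0"]
      unfolding phi_eq S_def M_def by simp
    then have "S (\<lambda>x y. 1 - of_real (r\<^sup>2) * (W x * cnj (W y))) \<le> 0" using phi_M by simp
    moreover have "(\<lambda>x y. 1 - of_real (r\<^sup>2) * (W x * cnj (W y)))
        = (\<lambda>x y. of_real (r\<^sup>2) * (1 - W x * cnj (W y)) + of_real (1 - r\<^sup>2) * 1)"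
      by (simp add: fun_eq_iff algebra_simps)
    ultimately have "r\<^sup>2 * S (\<lambda>x y. 1 - W x * cnj (W y)) + (1 - r\<^sup>2) * S (\<lambda>x y. 1) \<le> 0"
      using S_lin[of "r\<^sup>2" "\<lambda>x y. 1 - W x * cnj (W y)" "1 - r\<^sup>2" "\<lambda>x y. 1"] by simp
    moreover have "0 \<le> r\<^sup>2 * S (\<lambda>x y. 1 - W x * cnj (W y))" using SW by simp
    ultimately have "(1 - r\<^sup>2) * S (\<lambda>x y. 1) \<le> 0" by linarith
    moreover have "1 - r\<^sup>2 > 0" using r by (simp add: power_less_one_iff abs_square_less_1)
    ultimately have S0: "S (\<lambda>x y. 1) \<le> 0" by (simp add: mult_le_0_iff)
    have diag: "Re (K x0 x0) \<le> 0" if x0: "x0 \<in> L" for x0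
    proof -
      obtain h where h: "h \<in> polyfuns" "h x0 = 1" "\<And>x. x \<in> L - {x0} \<Longrightarrow> h x = 0"
        using lagrange_polyfun[OF L(1), of x0] by blast
      obtain B where B: "B > 0" "\<And>z. z \<in> sym_bidisk \<Longrightarrow> cmod (h z) \<le> B"
        using polyfuns_bounded[OF h(1)] by blast
      define g where "g z = of_real (1 / B) * h z" for z
      have "g \<in> polyball" unfolding polyball_def g_def
        by (intro CollectI conjI polyfuns_mult polyfuns_const h(1))
          (use B in \<open>auto simp: norm_divide field_simps\<close>)
      then have "0 \<le> S (\<lambda>x y. 1 - g x * cnj (g y))" by (rule contr1)
      moreover have "(\<lambda>x y. 1 - g x * cnj (g y)) = (\<lambda>x y. of_real 1 * 1 + of_real (- (1 / B\<^sup>2)) * (h x * cnj (h y)))"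
        by (simp add: g_def fun_eq_iff power2_eq_square)
      ultimately have "0 \<le> 1 * S (\<lambda>x y. 1) + (- (1 / B\<^sup>2)) * S (\<lambda>x y. h x * cnj (h y))"
        by (simp only: S_lin)
      moreover have "S (\<lambda>x y. h x * cnj (h y)) = Re (K x0 x0)"
      proof -
        have "h x * cnj (h y) * K x y = (if x = y then (if x = x0 then 1 else 0) else 0) * K x y"
          if "x \<in> L" "y \<in> L" for x y
          using h(2) h(3)[of x] h(3)[of y] that by (cases "x = x0"; cases "y = x0") simp_all
        then have "(\<Sum>x\<in>L. \<Sum>y\<in>L. h x * cnj (h y) * K x y) = (\<Sum>x\<in>L. \<Sum>y\<in>L. (if x = y then (if x = x0 then 1 else 0) else 0) * K x y)"
          by (intro sum.cong refl)
        also have "\<dots> = (\<Sum>x\<in>L. (if x = x0 then 1 else 0) * K x x)" by (rule sum_diag[OF L(1)])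
        also have "\<dots> = (\<Sum>x\<in>L. if x = x0 then K x x else 0)" by (intro sum.cong) auto
        also have "\<dots> = K x0 x0" using L(1) x0 by simp
        finally show ?thesis by (simp only: S_def)
      qed
      ultimately have "0 \<le> S (\<lambda>x y. 1) - 1 / B\<^sup>2 * Re (K x0 x0)" by simp
      then have "1 / B\<^sup>2 * Re (K x0 x0) \<le> 0" using S0 by linarith
      then show ?thesis using B(1) by (simp add: divide_le_0_iff)
    qed
    have "\<phi> e = Re (\<Sum>x\<in>L. \<Sum>y\<in>L. (if x = y then 1 else 0) * K x y)"
      unfolding phi_eq e_def by simp
    also have "\<dots> = (\<Sum>x\<in>L. Re (K x x))"
      by (simp add: sum_diag[OF L(1), of "\<lambda>_. 1", simplified])
    also have "\<dots> \<le> 0" by (intro sum_nonpos diag)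
    finally show False using phi_e by simp
  qed
  then obtain qs where qs: "\<And>q v. (q, v) \<in> set qs \<Longrightarrow> q \<in> polyball" "rep qs M"
    unfolding C_def by blast
  have "\<exists>g\<in>polyball. \<forall>x\<in>L. cmod (g x - of_real r * W x) < \<epsilon> / 2"
  proof (rule realization[OF L, where m = "length qs" and q = "\<lambda>l. fst (qs ! l)" and v = "\<lambda>l. snd (qs ! l)"])
    show "fst (qs ! l) \<in> polyball" if "l < length qs" for l
      using qs(1)[of "fst (qs ! l)" "snd (qs ! l)"] that by simp
    fix x y assume xy: "x \<in> L" "y \<in> L"
    have "1 - of_real r * W x * cnj (of_real r * W y) = M (x, y) + cnj (M (y, x))"
      by (simp add: M_def power2_eq_square algebra_simps)
    also have "\<dots> = (\<Sum>(q, v)\<leftarrow>qs. (1 - q x * cnj (q y)) * (v x * cnj (v y)))"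
      using qs(2) xy unfolding rep_def by blast
    also have "\<dots> = (\<Sum>l<length qs. (1 - fst (qs ! l) x * cnj (fst (qs ! l) y)) * (snd (qs ! l) x * cnj (snd (qs ! l) y)))"
      by (simp add: sum_list_sum_nth case_prod_unfold atLeast0LessThan)
    finally show "1 - of_real r * W x * cnj (of_real r * W y) =
      (\<Sum>l<length qs. (1 - fst (qs ! l) x * cnj (fst (qs ! l) y)) * (snd (qs ! l) x * cnj (snd (qs ! l) y)))" .
  qed (use \<epsilon> in auto)
  then obtain g where g: "g \<in> polyball" "\<And>x. x \<in> L \<Longrightarrow> cmod (g x - of_real r * W x) < \<epsilon> / 2" by blast
  have "cmod (g x - W x) < \<epsilon>" if x: "x \<in> L" for x
  proof -
    have "cmod (of_real r * W x - W x) = (1 - r) * cmod (W x)"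
    proof -
      have "of_real r * W x - W x = - (of_real (1 - r) * W x)" by (simp add: algebra_simps)
      then show ?thesis using r by (simp only: norm_minus_cancel norm_mult norm_of_real)
    qed
    also have "\<dots> \<le> (1 - r) * w0" using w0[OF x] r by (intro mult_left_mono) auto
    finally have "cmod (of_real r * W x - W x) \<le> \<epsilon> / 2" using r(3) by simp
    then show ?thesis using g(2)[OF x] norm_triangle_ineq[of "g x - of_real r * W x" "of_real r * W x - W x"] by simp
  qed
  with g(1) show ?thesis by blast
qed


section \<open>Geometry of the symmetrized bidisk\<close>

text \<open>
  The points \<open>z1\<close>, \<open>z2\<close> of the bidisk are the reciprocals of the roots \<open>w\<close> of the reversed polynomial.
  In this form the complement is a projection along a compact set, which shows that the symmetrized
  bidisk is open.
\<close>

lemma mem_sym_bidisk_iff: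
  "z \<in> sym_bidisk \<longleftrightarrow> (\<forall>w. cmod w \<le> 1 \<longrightarrow> 1 - fst z * w + snd z * w\<^sup>2 \<noteq> 0)"
proof
  assume "z \<in> sym_bidisk"
  then obtain z1 z2 where z: "z = (z1 + z2, z1 * z2)" "cmod z1 < 1" "cmod z2 < 1"
    by (auto simp: sym_bidisk_def)
  show "\<forall>w. cmod w \<le> 1 \<longrightarrow> 1 - fst z * w + snd z * w\<^sup>2 \<noteq> 0"
  proof (intro allI impI)
    fix w assume w: "cmod w \<le> 1"
    have ne: "1 - u * w \<noteq> 0" if "cmod u < 1" for u
    proof
      assume "1 - u * w = 0"
      then have "cmod (u * w) = 1" by (metis eq_iff_diff_eq_0 norm_one)
      moreover have "cmod (u * w) \<le> cmod u * 1"
        unfolding norm_mult using w by (intro mult_left_mono) auto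
      ultimately show False using that by simp
    qed
    have "1 - fst z * w + snd z * w\<^sup>2 = (1 - z1 * w) * (1 - z2 * w)"
      by (simp add: z power2_eq_square algebra_simps)
    then show "1 - fst z * w + snd z * w\<^sup>2 \<noteq> 0" using ne[OF z(2)] ne[OF z(3)] by simp
  qed
next
  assume *: "\<forall>w. cmod w \<le> 1 \<longrightarrow> 1 - fst z * w + snd z * w\<^sup>2 \<noteq> 0"
  define d where "d = csqrt ((fst z)\<^sup>2 - 4 * snd z)"
  define z1 z2 where "z1 = (fst z + d) / 2" and "z2 = (fst z - d) / 2"
  have "d\<^sup>2 = (fst z)\<^sup>2 - 4 * snd z" by (simp add: d_def)
  then have z: "fst z = z1 + z2" "snd z = z1 * z2"
    by (auto simp: z1_def z2_def field_simps power2_eq_square)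
  have small: "cmod u < 1" if u: "u = z1 \<or> u = z2" for u
  proof (rule ccontr)
    assume "\<not> cmod u < 1"
    then have "cmod u \<ge> 1" by simp
    then have "u \<noteq> 0" "cmod (1 / u) \<le> 1" by (auto simp: norm_divide divide_le_eq_1)
    then have "1 - fst z * (1 / u) + snd z * (1 / u)\<^sup>2 = (1 - z1 / u) * (1 - z2 / u)"
      by (simp add: z field_simps power2_eq_square)
    also have "\<dots> = 0" using u \<open>u \<noteq> 0\<close> by auto
    finally show False using * \<open>cmod (1 / u) \<le> 1\<close> by blast
  qed
  have "z = (z1 + z2, z1 * z2)" by (simp add: prod_eq_iff z)
  then show "z \<in> sym_bidisk" unfolding sym_bidisk_def using small by blast
qed

lemma open_sym_bidisk: "open sym_bidisk"
proof -
  have "- sym_bidisk = {y. \<exists>w. w \<in> cball 0 1 \<and> (w, y) \<in> {x. 1 - fst (snd x) * fst x + snd (snd x) * (fst x)\<^sup>2 = (0::complex)}}"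
    by (auto simp: mem_sym_bidisk_iff)
  also have "closed \<dots>"
    by (intro closed_compact_projection closed_Collect_eq continuous_intros) auto
  finally show ?thesis by (simp add: open_closed)
qed

text \<open>
  The weighted dilation induced by \<open>(z1, z2) \<mapsto> (c z1, c z2)\<close>.
\<close>

definition wdil :: "complex \<Rightarrow> complex \<times> complex \<Rightarrow> complex \<times> complex" where
  "wdil c z = (c * fst z, c\<^sup>2 * snd z)"

lemma wdil_in: 
  assumes "z \<in> sym_bidisk" "cmod c \<le> 1"
  shows "wdil c z \<in> sym_bidisk"
proof -
  obtain z1 z2 where z: "z = (z1 + z2, z1 * z2)" "cmod z1 < 1" "cmod z2 < 1"
    using assms by (auto simp: sym_bidisk_def)
  have "cmod (c * u) < 1" if "cmod u < 1" for u
    using that assms(2) mult_right_mono[of "cmod c" 1 "cmod u"] by (simp add: norm_mult)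
  moreover have "wdil c z = (c * z1 + c * z2, (c * z1) * (c * z2))"
    by (simp add: wdil_def z algebra_simps power2_eq_square)
  ultimately show ?thesis using z(2,3) unfolding sym_bidisk_def by blast
qed

lemma wdil_wdil: "wdil c (wdil d z) = wdil (d * c) z"
  by (simp add: wdil_def power_mult_distrib)

lemma polydisc_sub:
  assumes "cmod s \<le> 1/2" "cmod p < 1/4"
  shows "(s, p) \<in> sym_bidisk"
  unfolding mem_sym_bidisk_iff
proof (intro allI impI notI)
  fix w assume w: "cmod w \<le> 1" and eq: "1 - fst (s, p) * w + snd (s, p) * w\<^sup>2 = 0"
  have "cmod (s * w) \<le> 1/2 * 1" unfolding norm_mult using assms w by (intro mult_mono) auto
  moreover have "cmod (p * w\<^sup>2) \<le> 1/4 * 1" unfolding norm_mult norm_power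
    using assms w by (intro mult_mono power_le_one) auto
  moreover have "1 = s * w - p * w\<^sup>2" using eq by (simp add: algebra_simps)
  then have "1 \<le> cmod (s * w) + cmod (p * w\<^sup>2)" using norm_triangle_ineq4[of "s * w" "p * w\<^sup>2"] by (metis norm_one)
  ultimately show False by simp
qed

section \<open>Bounded holomorphic functions of two variables\<close>

lemma holomorphic2_compose:
  assumes f: "holomorphic2_on f A" and S: "open S" and g: "g1 holomorphic_on S" "g2 holomorphic_on S"
    and gA: "\<And>t. t \<in> S \<Longrightarrow> (g1 t, g2 t) \<in> A"
  shows "(\<lambda>t. f (g1 t, g2 t)) holomorphic_on S"
  unfolding holomorphic_on_def
proof
  fix t assume t: "t \<in> S"
  obtain a b where ab: "(f has_derivative (\<lambda>h. a * fst h + b * snd h)) (at (g1 t, g2 t))"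
    using f gA[OF t] unfolding holomorphic2_on_def by blast
  have d: "(g1 has_field_derivative deriv g1 t) (at t)" "(g2 has_field_derivative deriv g2 t) (at t)"
    using holomorphic_derivI[OF g(1) S t] holomorphic_derivI[OF g(2) S t] by auto
  have "((\<lambda>t. (g1 t, g2 t)) has_derivative (\<lambda>h. (deriv g1 t * h, deriv g2 t * h))) (at t)"
    by (intro has_derivative_Pair d[unfolded has_field_derivative_def])
  from has_derivative_compose[OF this ab]
  have "((\<lambda>t. f (g1 t, g2 t)) has_derivative (\<lambda>h. a * (deriv g1 t * h) + b * (deriv g2 t * h))) (at t)"
    by simp
  moreover have "(\<lambda>h. a * (deriv g1 t * h) + b * (deriv g2 t * h)) = (*) (a * deriv g1 t + b * deriv g2 t)"
    by (auto simp: algebra_simps)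
  ultimately have "((\<lambda>t. f (g1 t, g2 t)) has_field_derivative (a * deriv g1 t + b * deriv g2 t)) (at t)"
    by (simp add: has_field_derivative_def)
  then show "(\<lambda>t. f (g1 t, g2 t)) field_differentiable at t within S"
    using field_differentiable_at_within field_differentiable_def by blast
qed

lemma holomorphic2_continuous_on:
  assumes "holomorphic2_on f A"
  shows "continuous_on A f"
  using assms has_derivative_continuous continuous_at_imp_continuous_on
  unfolding holomorphic2_on_def by blast

lemma polyfuns_holomorphic2:
  assumes "g \<in> polyfuns"
  shows "holomorphic2_on g A"
proof -
  define hd where "hd g \<longleftrightarrow> (\<forall>z. \<exists>a b. (g has_derivative (\<lambda>h. a * fst h + b * snd h)) (at z))"
    for g :: "complex \<times> complex \<Rightarrow> complex"
  have hd_const: "hd (\<lambda>z. c)" for c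
    unfolding hd_def by (auto intro!: exI[of _ 0] derivative_eq_intros)
  have hd_fst: "hd fst" unfolding hd_def
    by (intro allI exI[of _ 1] exI[of _ 0]) (auto intro!: derivative_eq_intros)
  have hd_snd: "hd snd" unfolding hd_def
    by (intro allI exI[of _ 0] exI[of _ 1]) (auto intro!: derivative_eq_intros)
  have hd_add: "hd (\<lambda>z. g z + h z)" if gh: "hd g" "hd h" for g h
    unfolding hd_def
  proof
    fix z
    obtain a b c d where "(g has_derivative (\<lambda>h. a * fst h + b * snd h)) (at z)"
      "(h has_derivative (\<lambda>h. c * fst h + d * snd h)) (at z)" using gh unfolding hd_def by blast
    from has_derivative_add[OF this]
    show "\<exists>a b. ((\<lambda>z. g z + h z) has_derivative (\<lambda>h. a * fst h + b * snd h)) (at z)"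
      by (intro exI[of _ "a + c"] exI[of _ "b + d"]) (simp add: algebra_simps)
  qed
  have hd_mult: "hd (\<lambda>z. g z * h z)" if gh: "hd g" "hd h" for g h
    unfolding hd_def
  proof
    fix z
    obtain a b c d where "(g has_derivative (\<lambda>h. a * fst h + b * snd h)) (at z)"
      "(h has_derivative (\<lambda>h. c * fst h + d * snd h)) (at z)" using gh unfolding hd_def by blast
    from has_derivative_mult[OF this]
    show "\<exists>a b. ((\<lambda>z. g z * h z) has_derivative (\<lambda>h. a * fst h + b * snd h)) (at z)"
      by (intro exI[of _ "g z * c + a * h z"] exI[of _ "g z * d + b * h z"]) (simp add: algebra_simps)
  qed
  have hd_sum: "hd (\<lambda>z. \<Sum>i\<in>I. u i z)" if "\<And>i. i \<in> I \<Longrightarrow> hd (u i)" for I :: "nat set" and u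
    using that by (induction I rule: infinite_finite_induct) (auto intro: hd_const hd_add)
  have hd_power: "hd (\<lambda>z. u z ^ i)" if "hd u" for u i
    using that by (induction i) (auto intro: hd_const hd_mult)
  obtain f where f: "g = eval2 f" using assms by (auto simp: polyfuns_def)
  have "hd g" unfolding f eval2_def[abs_def]
    by (intro hd_sum hd_mult hd_const hd_power hd_fst hd_snd)
  then show ?thesis by (auto simp: hd_def holomorphic2_on_def)
qed

lemma taylor_tail_bound:
  assumes hol: "\<phi> holomorphic_on ball 0 R" and cont: "continuous_on (cball 0 R) \<phi>"
    and bd: "\<And>t. cmod t \<le> R \<Longrightarrow> cmod (\<phi> t) \<le> 1" and t: "cmod t < R"
  shows "cmod (\<phi> t - (\<Sum>l<m. (deriv ^^ l) \<phi> 0 / fact l * t ^ l)) \<le> (cmod t / R) ^ m / (1 - cmod t / R)"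
proof -
  have R: "R > 0" using t by (meson le_less_trans norm_ge_zero)
  let ?a = "\<lambda>n. (deriv ^^ n) \<phi> 0 / fact n * t ^ n"
  have "?a sums \<phi> t" using holomorphic_power_series[OF hol, of t] t by simp
  then have 1: "(\<lambda>n. ?a (n + m)) sums (\<phi> t - (\<Sum>l<m. ?a l))"
    by (rule sums_split_initial_segment)
  have x: "cmod t / R < 1" using t R by simp
  then have "(\<lambda>n. (cmod t / R) ^ m * (cmod t / R) ^ n) sums ((cmod t / R) ^ m * (1 / (1 - cmod t / R)))"
    using R by (intro sums_mult geometric_sums) simp
  then have 2: "(\<lambda>n. (cmod t / R) ^ (n + m)) sums ((cmod t / R) ^ m / (1 - cmod t / R))"
    by (simp add: power_add mult.commute)
  have "norm (?a n) \<le> (cmod t / R) ^ n" for n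
  proof -
    have "norm ((deriv ^^ n) \<phi> 0) \<le> fact n * 1 / R ^ n"
      by (rule Cauchy_inequality[OF hol cont R]) (use bd in auto)
    from divide_right_mono[OF this, of "fact n"]
    have "norm ((deriv ^^ n) \<phi> 0 / fact n) \<le> 1 / R ^ n"
      by (simp add: norm_divide)
    then have "norm ((deriv ^^ n) \<phi> 0 / fact n) * cmod t ^ n \<le> 1 / R ^ n * cmod t ^ n"
      by (intro mult_right_mono) auto
    then show ?thesis by (simp add: norm_mult norm_power norm_divide power_divide)
  qed
  then show ?thesis using norm_sums_le[OF 1 2] by blast
qed

text \<open>
  Restriction to the complex line through \<open>z\<close> in direction \<open>h\<close> reduces both bounds to the Taylor remainder
  in one variable. They are uniform over all functions bounded by 1, which is what compactness needs.
\<close>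

lemma holomorphic2_increment_bounds:
  fixes f :: "complex \<times> complex \<Rightarrow> complex"
  assumes f: "holomorphic2_on f A" and bd: "\<And>z. z \<in> A \<Longrightarrow> cmod (f z) \<le> 1"
    and R: "R > 0" "cball z R \<subseteq> A" and h: "norm h \<le> R / 2"
    and ab: "(f has_derivative (\<lambda>h. a * fst h + b * snd h)) (at z)"
  shows "cmod (f (z + h) - f z) \<le> 2 * (norm h / R)"
    "cmod (f (z + h) - f z - (a * fst h + b * snd h)) \<le> 2 * (norm h / R)\<^sup>2"
proof -
  have "cmod (f (z + h) - f z) \<le> 2 * (norm h / R) \<and>
    cmod (f (z + h) - f z - (a * fst h + b * snd h)) \<le> 2 * (norm h / R)\<^sup>2"
  proof (cases "h = 0")
    case False
    define N where "N = norm h"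
    have N: "N > 0" "N \<le> R / 2" using False h by (auto simp: N_def)
    define u1 u2 where "u1 = fst h / of_real N" and "u2 = snd h / of_real N"
    have hu: "fst h = of_real N * u1" "snd h = of_real N * u2" using N by (auto simp: u1_def u2_def)
    have nu: "norm (u1, u2) = 1"
    proof -
      have "(u1, u2) = (1 / N) *\<^sub>R h" using N by (auto simp: prod_eq_iff u1_def u2_def scaleR_conv_of_real)
      then show ?thesis using N by (simp add: N_def)
    qed
    have nt: "norm (t * u1, t * u2) = cmod t" for t
    proof -
      have "norm (t * u1, t * u2) = cmod t * norm (u1, u2)"
        by (simp add: norm_Pair norm_mult power_mult_distrib real_sqrt_mult flip: distrib_left)
      then show ?thesis by (simp add: nu)
    qed
    define g where "g t = (fst z + t * u1, snd z + t * u2)" for t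
    have gA: "g t \<in> A" if "cmod t \<le> R" for t
    proof -
      have "g t = z + (t * u1, t * u2)" by (simp add: g_def prod_eq_iff)
      then have "dist (g t) z = cmod t" by (simp add: dist_norm nt)
      then have "dist z (g t) = cmod t" by (simp only: dist_commute)
      then show ?thesis using that R by auto
    qed
    define \<phi> where "\<phi> t = f (g t)" for t
    have hol: "\<phi> holomorphic_on ball 0 R"
      unfolding \<phi>_def g_def
      by (rule holomorphic2_compose[OF f]) (use gA in \<open>auto simp: g_def intro!: holomorphic_intros\<close>)
    have cont: "continuous_on (cball 0 R) \<phi>"
      unfolding \<phi>_def
      by (rule continuous_on_compose2[OF holomorphic2_continuous_on[OF f]])
        (use gA in \<open>auto simp: g_def intro!: continuous_intros\<close>)
    have bd\<phi>: "cmod (\<phi> t) \<le> 1" if "cmod t \<le> R" for t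
      unfolding \<phi>_def by (rule bd[OF gA[OF that]])
    have "((\<lambda>t. g t) has_derivative (\<lambda>k. (k * u1, k * u2))) (at 0)"
      unfolding g_def by (auto intro!: derivative_eq_intros)
    moreover have "(f has_derivative (\<lambda>h. a * fst h + b * snd h)) (at (g 0))"
      using ab by (simp add: g_def)
    ultimately have "(\<phi> has_derivative (\<lambda>k. a * (k * u1) + b * (k * u2))) (at 0)"
      unfolding \<phi>_def using has_derivative_compose by fastforce
    moreover have "(\<lambda>k. a * (k * u1) + b * (k * u2)) = (*) (a * u1 + b * u2)"
      by (auto simp: algebra_simps)
    ultimately have "(\<phi> has_field_derivative (a * u1 + b * u2)) (at 0)"
      by (simp add: has_field_derivative_def)
    then have d: "deriv \<phi> 0 = a * u1 + b * u2" by (rule DERIV_imp_deriv)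
    have tN: "cmod (of_real N) < R" using N R by simp
    note tail = taylor_tail_bound[OF hol cont bd\<phi> tN]
    have p: "\<phi> (of_real N) = f (z + h)" "\<phi> 0 = f z"
    proof -
      have "g (of_real N) = z + h" using hu by (simp add: g_def prod_eq_iff)
      then show "\<phi> (of_real N) = f (z + h)" by (simp add: \<phi>_def)
    qed (simp add: \<phi>_def g_def)
    have x: "0 \<le> N / R" "N / R \<le> 1/2" using N R by (auto simp: field_simps)
    have bound: "(N / R) ^ m / (1 - N / R) \<le> 2 * (N / R) ^ m" for m
    proof -
      have "(N / R) ^ m / (1 - N / R) \<le> (N / R) ^ m / (1/2)"
      proof (rule divide_left_mono)
        show "0 < (1 - N / R) * (1 / 2)" using x(2) by (intro mult_pos_pos) linarith+
      qed (use x in \<open>linarith | simp\<close>)+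
      then show ?thesis by simp
    qed
    have "cmod (f (z + h) - f z) \<le> 2 * (N / R)"
      using tail[of 1] bound[of 1] N by (simp add: p)
    moreover have "cmod (f (z + h) - f z - (a * fst h + b * snd h)) \<le> 2 * (N / R)\<^sup>2"
      using tail[of 2] bound[of 2] N by (simp add: p d hu numeral_2_eq_2 algebra_simps)
    ultimately show ?thesis by (simp add: N_def)
  qed simp
  then show "cmod (f (z + h) - f z) \<le> 2 * (norm h / R)"
    "cmod (f (z + h) - f z - (a * fst h + b * snd h)) \<le> 2 * (norm h / R)\<^sup>2" by auto
qed

text \<open>
  The first-order bound gives equicontinuity, so convergence on a countable dense set spreads to the
  whole domain. The quadratic bound makes the limit differentiable at each point: the differentials
  are bounded there, hence converge along a further subsequence, and the bound survives the limit.
\<close>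

lemma montel_two_variables:
  fixes F :: "nat \<Rightarrow> complex \<times> complex \<Rightarrow> complex"
  assumes A: "open A" and F: "\<And>n. holomorphic2_on (F n) A"
    and bd: "\<And>n z. z \<in> A \<Longrightarrow> cmod (F n z) \<le> 1"
  shows "\<exists>k f. strict_mono k \<and> (\<forall>z\<in>A. (\<lambda>n. F (k n) z) \<longlonglongrightarrow> f z) \<and> holomorphic2_on f A"
proof -
  obtain D where D: "countable D" "D \<subseteq> A" "A \<subseteq> closure D" using separable[of A] by blast
  obtain k where k: "strict_mono k" "\<And>x. x \<in> D \<Longrightarrow> \<exists>l. (\<lambda>n. F (k n) x) \<longlonglongrightarrow> l"
    by (rule function_convergent_subsequence[OF D(1), of F 1]) (use bd D in blast)+
  have inc: "cmod (F n (z + h) - F n z) \<le> 2 * (norm h / R)"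
    if "R > 0" "cball z R \<subseteq> A" "norm h \<le> R / 2" for n z h R
  proof -
    have "z \<in> A" using that(1,2) by auto
    then obtain a b where "(F n has_derivative (\<lambda>h. a * fst h + b * snd h)) (at z)"
      using F[of n] unfolding holomorphic2_on_def by blast
    then show ?thesis using holomorphic2_increment_bounds(1)[OF F bd that(1,2,3)] by blast
  qed
  have "convergent (\<lambda>n. F (k n) z)" if z: "z \<in> A" for z
  proof (rule Cauchy_convergent, rule CauchyI)
    fix e :: real assume e: "e > 0"
    obtain R where R: "R > 0" "cball z R \<subseteq> A" using A z open_contains_cball by blast
    define \<delta> where "\<delta> = min (R / 2) (e * R / 8)"
    have \<delta>: "\<delta> > 0" "\<delta> \<le> R / 2" "2 * (\<delta> / R) \<le> e / 4" using R e by (auto simp: \<delta>_def min_def field_simps)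
    obtain x where x: "x \<in> D" "dist x z < \<delta>" using D(3) z \<delta>(1) closure_approachable by blast
    have close: "cmod (F n x - F n z) \<le> e / 4" for n
    proof -
      have n: "norm (x - z) \<le> \<delta>" using x(2) by (simp add: dist_norm)
      have "cmod (F n (z + (x - z)) - F n z) \<le> 2 * (norm (x - z) / R)"
        by (rule inc[OF R]) (use n \<delta> in simp)
      also have "\<dots> \<le> 2 * (\<delta> / R)" using n R by (intro mult_left_mono divide_right_mono) auto
      finally show ?thesis using \<delta>(3) by simp
    qed
    obtain l where "(\<lambda>n. F (k n) x) \<longlonglongrightarrow> l" using k(2)[OF x(1)] by blast
    then have "Cauchy (\<lambda>n. F (k n) x)" by (rule LIMSEQ_imp_Cauchy)
    then obtain N where N: "\<And>m n. m \<ge> N \<Longrightarrow> n \<ge> N \<Longrightarrow> norm (F (k m) x - F (k n) x) < e / 4"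
      using e CauchyD[of _ "e / 4"] by (metis zero_less_divide_iff zero_less_numeral)
    have "norm (F (k m) z - F (k n) z) < e" if "m \<ge> N" "n \<ge> N" for m n
    proof -
      have "F (k m) z - F (k n) z = (F (k n) x - F (k n) z) - (F (k m) x - F (k m) z) + (F (k m) x - F (k n) x)"
        by simp
      also have "norm \<dots> \<le> norm (F (k n) x - F (k n) z) + norm (F (k m) x - F (k m) z) + norm (F (k m) x - F (k n) x)"
        by (intro order_trans[OF norm_triangle_ineq] add_mono norm_triangle_ineq4 order_refl)
      also have "\<dots> < e" using close[of "k n"] close[of "k m"] N[OF that] e by linarith
      finally show ?thesis .
    qed
    then show "\<exists>M. \<forall>m\<ge>M. \<forall>n\<ge>M. norm (F (k m) z - F (k n) z) < e" by blast
  qed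
  then have lim: "(\<lambda>n. F (k n) z) \<longlonglongrightarrow> lim (\<lambda>n. F (k n) z)" if "z \<in> A" for z
    using that by (simp only: convergent_LIMSEQ_iff)
  define f where "f z = lim (\<lambda>n. F (k n) z)" for z
  have f: "(\<lambda>n. F (k n) z) \<longlonglongrightarrow> f z" if "z \<in> A" for z
    unfolding f_def by (rule lim[OF that])
  have "holomorphic2_on f A" unfolding holomorphic2_on_def
  proof
    fix z assume z: "z \<in> A"
    obtain R where R: "R > 0" "cball z R \<subseteq> A" using A z open_contains_cball by blast
    have "\<forall>n. \<exists>a b. (F (k n) has_derivative (\<lambda>h. a * fst h + b * snd h)) (at z)"
      using F z unfolding holomorphic2_on_def by blast
    then obtain a b where ab: "\<And>n. (F (k n) has_derivative (\<lambda>h. a n * fst h + b n * snd h)) (at z)"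
      by metis
    have est: "cmod (F (k n) (z + h) - F (k n) z) \<le> 2 * (norm h / R)"
      "cmod (F (k n) (z + h) - F (k n) z - (a n * fst h + b n * snd h)) \<le> 2 * (norm h / R)\<^sup>2"
      if "norm h \<le> R / 2" for h n
      using holomorphic2_increment_bounds[OF F[of "k n"] _ R that ab[of n]] bd by blast+
    have coeff: "cmod (a n * fst h + b n * snd h) \<le> 2" if "norm h = R / 2" for h n
    proof -
      have half: "norm h / R = 1/2" using that R by simp
      then have e: "cmod (F (k n) (z + h) - F (k n) z) \<le> 1" "cmod (F (k n) (z + h) - F (k n) z - (a n * fst h + b n * snd h)) \<le> 1"
        using est[of h n] that unfolding half by (simp_all add: power2_eq_square)
      have "a n * fst h + b n * snd h = (F (k n) (z + h) - F (k n) z) - (F (k n) (z + h) - F (k n) z - (a n * fst h + b n * snd h))"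
        by simp
      then have "cmod (a n * fst h + b n * snd h) \<le> cmod (F (k n) (z + h) - F (k n) z) + cmod (F (k n) (z + h) - F (k n) z - (a n * fst h + b n * snd h))"
        by (metis norm_triangle_ineq4)
      then show ?thesis using e by linarith
    qed
    have "cmod (a n) * (R / 2) \<le> 2" "cmod (b n) * (R / 2) \<le> 2" for n
      using coeff[of "(of_real (R / 2), 0)" n] coeff[of "(0, of_real (R / 2))" n] R
      by (simp_all add: norm_Pair norm_mult norm_divide)
    then have "cmod (a n) \<le> 4 / R" "cmod (b n) \<le> 4 / R" for n
      using R by (simp_all add: field_simps)
    then have "norm (a n, b n) \<le> 4 / R + 4 / R" for n
      using norm_Pair_le[of "a n" "b n"] by (meson add_mono order_trans)
    then have "bounded (range (\<lambda>n. (a n, b n)))" unfolding bounded_iff by blast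
    from bounded_imp_convergent_subsequence[OF this]
    obtain r c where r: "strict_mono r" "((\<lambda>n. (a n, b n)) \<circ> r) \<longlonglongrightarrow> c" by blast
    have lima: "(\<lambda>n. a (r n)) \<longlonglongrightarrow> fst c" and limb: "(\<lambda>n. b (r n)) \<longlonglongrightarrow> snd c"
      using tendsto_fst[OF r(2)] tendsto_snd[OF r(2)] by (simp_all add: o_def)
    have fr: "(\<lambda>n. F (k (r n)) w) \<longlonglongrightarrow> f w" if "w \<in> A" for w
      using LIMSEQ_subseq_LIMSEQ[OF f[OF that] r(1)] by (simp add: o_def)
    have quad: "cmod (f (z + h) - f z - (fst c * fst h + snd c * snd h)) \<le> 2 * (norm h / R)\<^sup>2"
      if h: "norm h \<le> R / 2" for h
    proof (rule LIMSEQ_le_const2)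
      have "z + h \<in> A" using R h by (auto intro!: subsetD[OF R(2)] simp: dist_norm)
      then show "(\<lambda>n. cmod (F (k (r n)) (z + h) - F (k (r n)) z - (a (r n) * fst h + b (r n) * snd h)))
          \<longlonglongrightarrow> cmod (f (z + h) - f z - (fst c * fst h + snd c * snd h))"
        by (intro tendsto_intros fr z lima limb)
    qed (use est(2)[OF h] in blast)
    have "(f has_derivative (\<lambda>h. fst c * fst h + snd c * snd h)) (at z)"
      unfolding has_derivative_at_alt
    proof (intro conjI allI impI)
      show "bounded_linear (\<lambda>h. fst c * fst h + snd c * snd h)"
        by (intro bounded_linear_add bounded_linear_const_mult bounded_linear_fst bounded_linear_snd)
      fix e :: real assume e: "e > 0"
      define d where "d = min (R / 2) (e * R\<^sup>2 / 2)"
      have d: "d > 0" using R e by (simp add: d_def)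
      have "norm (f y - f z - (fst c * fst (y - z) + snd c * snd (y - z))) \<le> e * norm (y - z)" if y: "norm (y - z) < d" for y
      proof -
        have "cmod (f (z + (y - z)) - f z - (fst c * fst (y - z) + snd c * snd (y - z))) \<le> 2 * (norm (y - z) / R)\<^sup>2"
          by (rule quad) (use y in \<open>simp add: d_def\<close>)
        also have "\<dots> = (2 * norm (y - z) / R\<^sup>2) * norm (y - z)" by (simp add: power2_eq_square)
        also have "\<dots> \<le> e * norm (y - z)"
        proof (rule mult_right_mono)
          have "norm (y - z) \<le> e * R\<^sup>2 / 2" using y by (simp add: d_def)
          then show "2 * norm (y - z) / R\<^sup>2 \<le> e" using R by (simp add: field_simps)
        qed simp
        finally show ?thesis by simp
      qed
      with d show "\<exists>d>0. \<forall>y. norm (y - z) < d \<longrightarrow>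
          norm (f y - f z - (fst c * fst (y - z) + snd c * snd (y - z))) \<le> e * norm (y - z)" by blast
    qed
    then show "\<exists>a b. (f has_derivative (\<lambda>h. a * fst h + b * snd h)) (at z)" by blast
  qed
  with k(1) f show ?thesis by blast
qed


section \<open>Approximation by polynomials\<close>

text \<open>
  The part of \<open>f\<close> that is homogeneous of degree \<open>m\<close> when \<open>s\<close> has weight 1 and \<open>p\<close> has weight 2.
\<close>

definition homog :: "(complex \<times> complex \<Rightarrow> complex) \<Rightarrow> nat \<Rightarrow> complex \<times> complex \<Rightarrow> complex" where
  "homog f m z = (deriv ^^ m) (\<lambda>c. f (wdil c z)) 0 / fact m"

locale unit_ball_function =
  fixes f :: "complex \<times> complex \<Rightarrow> complex"
  assumes hol2: "holomorphic2_on f sym_bidisk"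
    and bd: "z \<in> sym_bidisk \<Longrightarrow> cmod (f z) \<le> 1"
begin

lemma slice_holomorphic: "z \<in> sym_bidisk \<Longrightarrow> (\<lambda>c. f (wdil c z)) holomorphic_on ball 0 1"
  unfolding wdil_def
  by (rule holomorphic2_compose[OF hol2])
    (use wdil_in in \<open>auto simp: wdil_def intro!: holomorphic_intros\<close>)

lemma slice_continuous: "z \<in> sym_bidisk \<Longrightarrow> continuous_on (cball 0 1) (\<lambda>c. f (wdil c z))"
  by (rule continuous_on_compose2[OF holomorphic2_continuous_on[OF hol2]])
    (use wdil_in in \<open>auto simp: wdil_def intro!: continuous_intros\<close>)

lemma slice_bound: "z \<in> sym_bidisk \<Longrightarrow> cmod c \<le> 1 \<Longrightarrow> cmod (f (wdil c z)) \<le> 1"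
  by (intro bd wdil_in)

lemma slice_tail:
  assumes z: "z \<in> sym_bidisk" and c: "cmod c < 1"
  shows "cmod (f (wdil c z) - (\<Sum>l<m. homog f l z * c ^ l)) \<le> cmod c ^ m / (1 - cmod c)"
  using taylor_tail_bound[OF slice_holomorphic[OF z] slice_continuous[OF z] slice_bound[OF z] c, of m]
  by (simp add: homog_def)

lemma homog_bound:
  assumes z: "z \<in> sym_bidisk"
  shows "cmod (homog f m z) \<le> 1"
proof -
  have "norm ((deriv ^^ m) (\<lambda>c. f (wdil c z)) 0) \<le> fact m * 1 / 1 ^ m"
    by (rule Cauchy_inequality[OF slice_holomorphic[OF z] slice_continuous[OF z]])
      (use slice_bound[OF z] in auto)
  then show ?thesis by (simp add: homog_def norm_divide)
qed

lemma homog_wdil: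
  assumes z: "z \<in> sym_bidisk" and c: "cmod c \<le> 1"
  shows "homog f m (wdil c z) = c ^ m * homog f m z"
proof -
  have "(deriv ^^ m) (\<lambda>d. f (wdil (c * d) z)) 0 = c ^ m * (deriv ^^ m) (\<lambda>d. f (wdil d z)) (c * 0)"
  proof (rule higher_deriv_compose_linear[OF slice_holomorphic[OF z]])
    show "c * w \<in> ball 0 1" if "w \<in> ball 0 1" for w
      using that c mult_right_mono[of "cmod c" 1 "cmod w"] by (simp add: norm_mult)
  qed auto
  then show ?thesis by (simp add: homog_def wdil_wdil)
qed

text \<open>
  The degree \<open>m\<close> part is the uniform limit, as \<open>c \<rightarrow> 0\<close>, of \<open>f\<close> minus its parts of lower degree, dilated
  by \<open>c\<close> and divided by \<open>c\<^sup>m\<close>; so holomorphy passes from the lower degrees to degree \<open>m\<close>.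
\<close>

lemma homog_holomorphic:
  assumes S: "open S" and g: "g1 holomorphic_on S" "g2 holomorphic_on S"
    and gG: "\<And>t. t \<in> S \<Longrightarrow> (g1 t, g2 t) \<in> sym_bidisk"
  shows "(\<lambda>t. homog f m (g1 t, g2 t)) holomorphic_on S"
proof (induction m rule: less_induct)
  case (less m)
  define c where "c n = complex_of_real (1 / real (n + 2))" for n
  have c: "cmod (c n) = 1 / real (n + 2)" "cmod (c n) < 1" "c n \<noteq> 0" for n
    unfolding c_def norm_of_real of_real_eq_0_iff by auto
  define Q where "Q n t = (f (wdil (c n) (g1 t, g2 t)) - (\<Sum>l<m. homog f l (g1 t, g2 t) * c n ^ l)) / c n ^ m" for n t
  have close: "cmod (Q n t - homog f m (g1 t, g2 t)) \<le> 1 / real (n + 1)" if t: "t \<in> S" for n t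
  proof -
    let ?z = "(g1 t, g2 t)"
    have "Q n t - homog f m ?z = (f (wdil (c n) ?z) - (\<Sum>l<Suc m. homog f l ?z * c n ^ l)) / c n ^ m"
      using c(3)[of n] by (simp add: Q_def field_simps)
    then have "cmod (Q n t - homog f m ?z) \<le> (cmod (c n) ^ Suc m / (1 - cmod (c n))) / cmod (c n) ^ m"
      using slice_tail[OF gG[OF t] c(2)[of n], of "Suc m"]
      by (simp only: norm_divide norm_power divide_right_mono zero_le_power norm_ge_zero)
    also have "\<dots> = cmod (c n) / (1 - cmod (c n))" using c(3)[of n] by simp
    also have "\<dots> = 1 / real (n + 1)" unfolding c(1) by (simp add: field_simps)
    finally show ?thesis .
  qed
  show ?case
  proof (rule holomorphic_uniform_sequence[OF S])
    show "Q n holomorphic_on S" for n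
    proof -
      have "(\<lambda>t. f (c n * g1 t, (c n)\<^sup>2 * g2 t)) holomorphic_on S"
      proof (rule holomorphic2_compose[OF hol2 S])
        show "(c n * g1 t, (c n)\<^sup>2 * g2 t) \<in> sym_bidisk" if "t \<in> S" for t
          using wdil_in[OF gG[OF that], of "c n"] c(2)[of n] by (simp add: wdil_def)
      qed (intro holomorphic_intros g)+
      then show ?thesis unfolding Q_def wdil_def fst_conv snd_conv
        by (intro holomorphic_intros less.IH) (use c(3) in auto)
    qed
    fix x assume "x \<in> S"
    then obtain d where d: "d > 0" "cball x d \<subseteq> S" using S open_contains_cball by blast
    have "uniform_limit (cball x d) Q (\<lambda>t. homog f m (g1 t, g2 t)) sequentially"
    proof (rule uniform_limitI)
      fix e :: real assume "e > 0"
      then obtain N where N: "inverse (real (Suc N)) < e" using reals_Archimedean by blast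
      have "dist (Q n t) (homog f m (g1 t, g2 t)) < e" if "n \<ge> N" "t \<in> cball x d" for n t
      proof -
        have "dist (Q n t) (homog f m (g1 t, g2 t)) \<le> 1 / real (n + 1)"
          using close[of t n] that d by (auto simp: dist_norm)
        also have "\<dots> \<le> 1 / real (Suc N)" using that by (intro divide_left_mono) auto
        also have "\<dots> < e" using N by (simp add: inverse_eq_divide)
        finally show ?thesis .
      qed
      then show "\<forall>\<^sub>F n in sequentially. \<forall>t\<in>cball x d. dist (Q n t) (homog f m (g1 t, g2 t)) < e"
        unfolding eventually_sequentially by blast
    qed
    with d show "\<exists>d>0. cball x d \<subseteq> S \<and> uniform_limit (cball x d) Q (\<lambda>t. homog f m (g1 t, g2 t)) sequentially"
      by blast
  qed
qed

definition pcoeff :: "nat \<Rightarrow> nat \<Rightarrow> complex \<Rightarrow> complex" where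
  "pcoeff m j s = (deriv ^^ j) (\<lambda>p. homog f m (s, p)) 0 / fact j"

lemma homog_holomorphic_snd:
  assumes "cmod s \<le> 1/2"
  shows "(\<lambda>p. homog f m (s, p)) holomorphic_on ball 0 (1/4)"
  by (rule homog_holomorphic) (use assms polydisc_sub in \<open>auto intro!: holomorphic_intros\<close>)

lemma pcoeff_sums:
  assumes "cmod s \<le> 1/2" "cmod p < 1/4"
  shows "(\<lambda>j. pcoeff m j s * p ^ j) sums homog f m (s, p)"
  using holomorphic_power_series[OF homog_holomorphic_snd[OF assms(1)], of p m] assms(2)
  by (simp add: pcoeff_def)

lemma pcoeff_bound:
  assumes "cmod s \<le> 1/2"
  shows "cmod (pcoeff m j s) \<le> 8 ^ j"
proof -
  have "norm ((deriv ^^ j) (\<lambda>p. homog f m (s, p)) 0) \<le> fact j * 1 / (1/8) ^ j"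
  proof (rule Cauchy_inequality)
    show "(\<lambda>p. homog f m (s, p)) holomorphic_on ball 0 (1/8)"
      by (rule holomorphic_on_subset[OF homog_holomorphic_snd[OF assms]]) auto
    show "continuous_on (cball 0 (1/8)) (\<lambda>p. homog f m (s, p))"
      by (rule holomorphic_on_imp_continuous_on, rule holomorphic_on_subset[OF homog_holomorphic_snd[OF assms]]) auto
    show "norm (homog f m (s, p)) \<le> 1" if "norm (0 - p) = 1/8" for p
      using that assms by (intro homog_bound polydisc_sub) auto
  qed simp
  then show ?thesis by (simp add: pcoeff_def norm_divide power_divide field_simps)
qed

lemma pcoeff_scale:
  assumes s: "cmod s \<le> 1/2" and c: "cmod c \<le> 1"
  shows "pcoeff m j (c * s) * c ^ (2 * j) = c ^ m * pcoeff m j s"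
proof -
  have cs: "cmod (c * s) \<le> 1/2"
    using mult_mono[of "cmod c" 1 "cmod s" "1/2"] c s by (simp add: norm_mult)
  have c2: "cmod (c\<^sup>2) \<le> 1" using c by (simp add: norm_power power_le_one)
  have small: "c\<^sup>2 * p \<in> ball 0 (1/4)" if "p \<in> ball 0 (1/4)" for p
    using that mult_right_mono[OF c2, of "cmod p"] by (simp add: norm_mult)
  have "(deriv ^^ j) (\<lambda>p. homog f m (c * s, c\<^sup>2 * p)) 0 = (c\<^sup>2) ^ j * (deriv ^^ j) (\<lambda>p. homog f m (c * s, p)) (c\<^sup>2 * 0)"
    by (rule higher_deriv_compose_linear[OF homog_holomorphic_snd[OF cs], of "ball 0 (1/4)"]) (use small in auto)
  moreover have "(deriv ^^ j) (\<lambda>p. homog f m (c * s, c\<^sup>2 * p)) 0 = (deriv ^^ j) (\<lambda>p. c ^ m * homog f m (s, p)) 0"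
  proof (rule higher_deriv_transform_within_open[of _ "ball 0 (1/4)"])
    show "(\<lambda>p. homog f m (c * s, c\<^sup>2 * p)) holomorphic_on ball 0 (1/4)"
      by (rule homog_holomorphic) (use cs small polydisc_sub in \<open>auto intro!: holomorphic_intros\<close>)
    show "(\<lambda>p. c ^ m * homog f m (s, p)) holomorphic_on ball 0 (1/4)"
      by (intro holomorphic_intros homog_holomorphic_snd s)
    show "homog f m (c * s, c\<^sup>2 * p) = c ^ m * homog f m (s, p)" if "p \<in> ball 0 (1/4)" for p
      using homog_wdil[OF polydisc_sub[OF s] c, of p m] that by (simp add: wdil_def)
  qed auto
  moreover have "(deriv ^^ j) (\<lambda>p. c ^ m * homog f m (s, p)) 0 = c ^ m * (deriv ^^ j) (\<lambda>p. homog f m (s, p)) 0"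
    by (rule higher_deriv_cmult[OF homog_holomorphic_snd[OF s]]) auto
  ultimately have "c ^ (2 * j) * (deriv ^^ j) (\<lambda>p. homog f m (c * s, p)) 0 = c ^ m * (deriv ^^ j) (\<lambda>p. homog f m (s, p)) 0"
    by (simp only: power_mult mult_zero_right)
  then show ?thesis by (simp add: pcoeff_def mult.commute)
qed

text \<open>
  By homogeneity the coefficient of \<open>p\<^sup>j\<close> scales like \<open>c\<^bsup>m - 2j\<^esup>\<close> in \<open>s\<close>, but it is bounded as \<open>s \<rightarrow> 0\<close>. Thus
  the power series in \<open>p\<close> is finite.
\<close>

lemma pcoeff_eq_0:
  assumes s: "cmod s \<le> 1/2" and j: "2 * j > m"
  shows "pcoeff m j s = 0"
proof -
  have "cmod (pcoeff m j s) \<le> 8 ^ j * (1 / real (n + 1))" for n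
  proof -
    define c where "c = complex_of_real (1 / real (n + 1))"
    have c: "cmod c = 1 / real (n + 1)" "cmod c \<le> 1" "c \<noteq> 0"
      unfolding c_def norm_of_real of_real_eq_0_iff by auto
    obtain i where i: "2 * j = m + Suc i" using j less_imp_Suc_add[of m "2 * j"] by auto
    have "c ^ m * (pcoeff m j (c * s) * c ^ Suc i) = c ^ m * pcoeff m j s"
      using pcoeff_scale[OF s c(2), of m j] unfolding i by (simp only: power_add mult_ac)
    then have "c ^ m = 0 \<or> pcoeff m j (c * s) * c ^ Suc i = pcoeff m j s" by (simp only: mult_cancel_left)
    moreover have "c ^ m \<noteq> 0" using c(3) by simp
    ultimately have "pcoeff m j s = pcoeff m j (c * s) * c ^ Suc i" by metis
    then have "cmod (pcoeff m j s) = cmod (pcoeff m j (c * s)) * cmod c ^ Suc i" by (simp add: norm_mult norm_power)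
    also have "\<dots> \<le> 8 ^ j * cmod c"
    proof (rule mult_mono)
      have "cmod (c * s) \<le> 1/2"
        using mult_mono[of "cmod c" 1 "cmod s" "1/2"] c s by (simp add: norm_mult)
      then show "cmod (pcoeff m j (c * s)) \<le> 8 ^ j" by (rule pcoeff_bound)
      show "cmod c ^ Suc i \<le> cmod c"
        using c(2) mult_left_le[of "cmod c ^ i" "cmod c"] by (simp add: power_le_one)
    qed auto
    finally show ?thesis by (simp only: c(1))
  qed
  moreover have "(\<lambda>n. 8 ^ j * (1 / real (n + 1))) \<longlonglongrightarrow> 8 ^ j * 0"
    by (intro tendsto_mult tendsto_const LIMSEQ_Suc[OF lim_1_over_n, unfolded Suc_eq_plus1])
  ultimately have "cmod (pcoeff m j s) \<le> 8 ^ j * 0"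
    by (intro LIMSEQ_le_const) blast+
  then show ?thesis by simp
qed

text \<open>
  Homogeneity determines the coefficients from their values at \<open>s = 1/2\<close>.
\<close>

definition homog_poly :: "nat \<Rightarrow> complex \<times> complex \<Rightarrow> complex" where
  "homog_poly m z = (\<Sum>j\<le>m div 2. pcoeff m j (1/2) * (2 * fst z) ^ (m - 2 * j) * snd z ^ j)"

lemma homog_poly_polyfun: "homog_poly m \<in> polyfuns"
  unfolding homog_poly_def[abs_def]
  by (intro polyfuns_sum polyfuns_mult polyfuns_power polyfuns_const polyfuns_fst polyfuns_snd)

lemma homog_poly_wdil: "homog_poly m (wdil c z) = c ^ m * homog_poly m z"
  unfolding homog_poly_def sum_distrib_left
proof (rule sum.cong)
  fix j assume "j \<in> {..m div 2}"
  then have "c ^ m = c ^ (m - 2 * j) * (c\<^sup>2) ^ j" by (simp flip: power_mult power_add)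
  then show "pcoeff m j (1/2) * (2 * fst (wdil c z)) ^ (m - 2 * j) * snd (wdil c z) ^ j
    = c ^ m * (pcoeff m j (1/2) * (2 * fst z) ^ (m - 2 * j) * snd z ^ j)"
    by (simp only: wdil_def fst_conv snd_conv power_mult_distrib mult_ac)
qed simp

lemma homog_eq_poly_small:
  assumes s: "cmod s \<le> 1/2" "s \<noteq> 0" and p: "cmod p < 1/4"
  shows "homog f m (s, p) = homog_poly m (s, p)"
proof -
  have "(\<lambda>j. pcoeff m j s * p ^ j) sums (\<Sum>j\<le>m div 2. pcoeff m j s * p ^ j)"
    by (rule sums_finite) (auto simp: pcoeff_eq_0[OF s(1)])
  then have "homog f m (s, p) = (\<Sum>j\<le>m div 2. pcoeff m j s * p ^ j)"
    using pcoeff_sums[OF s(1) p, of m] sums_unique2 by blast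
  also have "\<dots> = homog_poly m (s, p)" unfolding homog_poly_def
  proof (rule sum.cong)
    fix j assume "j \<in> {..m div 2}"
    then have m: "m = (m - 2 * j) + 2 * j" by simp
    have "cmod (2 * s) \<le> 1" using s by (simp add: norm_mult)
    from pcoeff_scale[of "1/2", OF _ this, of m j]
    have "pcoeff m j s * (2 * s) ^ (2 * j) = (2 * s) ^ m * pcoeff m j (1/2)" by simp
    also have "(2 * s) ^ m = (2 * s) ^ (m - 2 * j) * (2 * s) ^ (2 * j)"
      by (subst m) (simp only: power_add)
    finally have "pcoeff m j s = (2 * s) ^ (m - 2 * j) * pcoeff m j (1/2)" using s(2) by simp
    then show "pcoeff m j s * p ^ j = pcoeff m j (1/2) * (2 * fst (s, p)) ^ (m - 2 * j) * snd (s, p) ^ j" by simp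
  qed simp
  finally show ?thesis .
qed

text \<open>
  Scaling from \<open>s = 1/2\<close> does not reach \<open>s = 0\<close>; there continuity in \<open>s\<close> is used.
\<close>

lemma homog_eq_poly_polydisc:
  assumes s: "cmod s \<le> 1/2" and p: "cmod p < 1/4"
  shows "homog f m (s, p) = homog_poly m (s, p)"
proof (cases "s = 0")
  case True
  let ?d = "\<lambda>t. homog f m (t, p) - homog_poly m (t, p)"
  have "(\<lambda>t. homog f m (t, p)) holomorphic_on ball 0 (1/2)"
    by (rule homog_holomorphic) (use p polydisc_sub in \<open>auto intro!: holomorphic_intros\<close>)
  moreover have "(\<lambda>t. homog_poly m (t, p)) holomorphic_on ball 0 (1/2)"
    unfolding homog_poly_def by (auto intro!: holomorphic_intros)
  ultimately have "continuous_on (ball 0 (1/2)) ?d"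
    by (intro holomorphic_on_imp_continuous_on holomorphic_intros)
  then have "isCont ?d 0" by (simp add: continuous_on_eq_continuous_at)
  then have "?d \<midarrow>0\<rightarrow> ?d 0" by (simp add: isCont_def)
  moreover have "?d \<midarrow>0\<rightarrow> 0"
  proof (rule Lim_transform_eventually[OF tendsto_const])
    show "\<forall>\<^sub>F t in at 0. 0 = ?d t"
      unfolding eventually_at using homog_eq_poly_small[OF _ _ p, of _ m]
      by (intro exI[of _ "1/2"]) (auto simp: dist_norm)
  qed
  ultimately have "?d 0 = 0" using LIM_unique by blast
  then show ?thesis by (simp add: True)
next
  case False
  then show ?thesis by (intro homog_eq_poly_small s p)
qed

lemma homog_eq_poly:
  assumes z: "z \<in> sym_bidisk"
  shows "homog f m z = homog_poly m z"
proof -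
  \<comment> \<open>dilation by 1/4 maps the symmetrized bidisk into the polydisc treated above\<close>
  let ?c = "1/4 :: complex"
  have "homog f m (wdil ?c z) = homog_poly m (wdil ?c z)"
    unfolding wdil_def
    by (rule homog_eq_poly_polydisc) (use sym_bidisk_bounds[OF z] in \<open>auto simp: norm_mult norm_divide norm_power power_divide\<close>)
  moreover have "cmod ?c \<le> 1" by (simp add: norm_divide)
  ultimately have "?c ^ m * homog f m z = ?c ^ m * homog_poly m z"
    using homog_wdil[OF z, of ?c m] homog_poly_wdil[of m ?c z] by simp
  then show ?thesis by simp
qed

text \<open>
  A dilation by \<open>r < 1\<close> makes the homogeneous expansion converge uniformly at a geometric rate. The partial
  sums are bounded by \<open>1 + d\<close>, and dividing by \<open>1 + d\<close> puts them into \<open>polyball\<close>.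
\<close>

lemma polyball_approx:
  assumes L: "finite L" "L \<subseteq> sym_bidisk" and e: "e > 0"
  shows "\<exists>g\<in>polyball. \<forall>x\<in>L. cmod (g x - f x) < e"
proof -
  define d where "d = e / 4"
  have d: "d > 0" using e by (simp add: d_def)
  define r where "r n = 1 - 1 / real (n + 2)" for n
  have r: "0 < r n" "r n < 1" for n by (auto simp: r_def field_simps)
  have "(\<lambda>n. f (wdil (of_real (r n)) x)) \<longlonglongrightarrow> f x" if x: "x \<in> L" for x
  proof -
    have xG: "x \<in> sym_bidisk" using x L by blast
    have "isCont f x"
      using holomorphic2_continuous_on[OF hol2] xG by (simp add: continuous_on_eq_continuous_at[OF open_sym_bidisk])
    moreover have "(\<lambda>n. 1 / real (n + 2)) \<longlonglongrightarrow> 0"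
      using LIMSEQ_ignore_initial_segment[OF lim_1_over_n, of 2] by simp
    then have "r \<longlonglongrightarrow> 1 - 0" unfolding r_def by (intro tendsto_diff tendsto_const)
    then have "(\<lambda>n. wdil (of_real (r n)) x) \<longlonglongrightarrow> (of_real 1 * fst x, (of_real 1)\<^sup>2 * snd x)"
      unfolding wdil_def by (intro tendsto_intros) simp_all
    ultimately show ?thesis by (intro isCont_tendsto_compose[where g = f and l = x]) simp_all
  qed
  then have "\<forall>x\<in>L. \<forall>\<^sub>F n in sequentially. cmod (f (wdil (of_real (r n)) x) - f x) < d"
    using d by (auto simp: tendsto_iff dist_norm)
  then have "\<forall>\<^sub>F n in sequentially. \<forall>x\<in>L. cmod (f (wdil (of_real (r n)) x) - f x) < d"
    using L(1) by (simp add: eventually_ball_finite_distrib)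
  from eventually_happens'[OF sequentially_bot this]
  obtain n where n: "\<And>x. x \<in> L \<Longrightarrow> cmod (f (wdil (of_real (r n)) x) - f x) < d" by blast
  define c where "c = complex_of_real (r n)"
  have c: "cmod c = r n" using r[of n] by (simp add: c_def)
  have "(\<lambda>m. r n ^ m) \<longlonglongrightarrow> 0" using r[of n] by (intro LIMSEQ_realpow_zero) auto
  then have "(\<lambda>m. r n ^ m / (1 - r n)) \<longlonglongrightarrow> 0 / (1 - r n)"
    by (intro tendsto_divide tendsto_const) (use r[of n] in auto)
  then have "(\<lambda>m. r n ^ m / (1 - r n)) \<longlonglongrightarrow> 0" by simp
  from eventually_happens'[OF sequentially_bot order_tendstoD(2)[OF this d]]
  obtain m where m: "r n ^ m / (1 - r n) < d" by blast
  define q where "q z = (\<Sum>l<m. homog_poly l z * c ^ l)" for z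
  have q_close: "cmod (f (wdil c z) - q z) \<le> d" if z: "z \<in> sym_bidisk" for z
  proof -
    have "q z = (\<Sum>l<m. homog f l z * c ^ l)" by (simp add: q_def homog_eq_poly[OF z])
    then show ?thesis using slice_tail[OF z, of c m] m r[of n] by (simp add: c)
  qed
  have q_bound: "cmod (q z) \<le> 1 + d" if z: "z \<in> sym_bidisk" for z
  proof -
    have "cmod (f (wdil c z)) \<le> 1" using slice_bound[OF z, of c] r[of n] by (simp add: c)
    moreover have "cmod (q z) \<le> cmod (f (wdil c z)) + cmod (f (wdil c z) - q z)"
      using norm_triangle_ineq4[of "f (wdil c z)" "f (wdil c z) - q z"] by simp
    ultimately show ?thesis using q_close[OF z] by linarith
  qed
  define g where "g z = of_real (1 / (1 + d)) * q z" for z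
  have "q \<in> polyfuns" unfolding q_def[abs_def]
    by (intro polyfuns_sum polyfuns_mult polyfuns_const homog_poly_polyfun)
  then have "g \<in> polyfuns" unfolding g_def[abs_def] by (intro polyfuns_mult polyfuns_const)
  moreover have "cmod (g z) \<le> 1" if "z \<in> sym_bidisk" for z
  proof -
    have "cmod (g z) = cmod (q z) / (1 + d)" unfolding g_def norm_mult norm_of_real using d by simp
    then show ?thesis using q_bound[OF that] d by simp
  qed
  ultimately have "g \<in> polyball" by (simp add: polyball_def)
  moreover have "cmod (g x - f x) < e" if x: "x \<in> L" for x
  proof -
    have xG: "x \<in> sym_bidisk" using x L by blast
    have "g x - q x = (of_real (1 / (1 + d)) - of_real 1) * q x"
      by (simp only: g_def left_diff_distrib of_real_1 mult_1)
    also have "\<dots> = of_real (1 / (1 + d) - 1) * q x" by (simp only: of_real_diff)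
    also have "1 / (1 + d) - 1 = - (d / (1 + d))" using d by (simp add: field_simps)
    finally have "cmod (g x - q x) = \<bar>- (d / (1 + d))\<bar> * cmod (q x)" by (simp only: norm_mult norm_of_real)
    also have "\<bar>- (d / (1 + d))\<bar> = d / (1 + d)" using d by simp
    finally have "cmod (g x - q x) = d / (1 + d) * cmod (q x)" .
    moreover have "d / (1 + d) * cmod (q x) \<le> d / (1 + d) * (1 + d)"
      by (rule mult_left_mono[OF q_bound[OF xG]]) (use d in simp)
    moreover have "d / (1 + d) * (1 + d) = d" using d by simp
    ultimately have "cmod (g x - q x) \<le> d" by (simp only:)
    moreover have "cmod (g x - f x) \<le> cmod (g x - q x) + cmod (f (wdil c x) - q x) + cmod (f (wdil c x) - f x)"
      using norm_triangle_ineq[of "(g x - q x) - (f (wdil c x) - q x)" "f (wdil c x) - f x"]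
        norm_triangle_ineq4[of "g x - q x" "f (wdil c x) - q x"] by simp
    ultimately show ?thesis using q_close[OF xG] n[OF x, folded c_def] e by (simp add: d_def)
  qed
  ultimately show ?thesis by blast
qed

end


section \<open>The interpolation theorem\<close>

lemma pos_semidef_of_interpolant:
  assumes f: "f \<in> H_infinity" "sup_norm f \<le> 1" and k: "admissible k"
    and lam: "\<And>i. i \<in> {1..n} \<Longrightarrow> lam i \<in> sym_bidisk" and w: "\<And>i. i \<in> {1..n} \<Longrightarrow> f (lam i) = w i"
  shows "pos_semidef n (\<lambda>i j. (1 - w i * cnj (w j)) * k (lam i) (lam j))"
  unfolding pos_semidef_def
proof
  fix x :: "nat \<Rightarrow> complex"
  have "cmod (f z) \<le> 1" if "z \<in> sym_bidisk" for z
  proof -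
    obtain B where "\<And>z. z \<in> sym_bidisk \<Longrightarrow> cmod (f z) \<le> B"
      using f(1) unfolding H_infinity_def bounded_iff by blast
    then have "bdd_above ((\<lambda>z. cmod (f z)) ` sym_bidisk)" by (rule bdd_aboveI2)
    then have "cmod (f z) \<le> sup_norm f" unfolding sup_norm_def by (rule cSUP_upper[OF that])
    with f(2) show ?thesis by simp
  qed
  then interpret unit_ball_function f
    using f(1) by unfold_locales (auto simp: H_infinity_def)
  have "\<exists>g\<in>polyball. \<forall>x\<in>lam ` {1..n}. cmod (g x - f x) < 1 / real (Suc m)" for m
    by (rule polyball_approx) (use lam in auto)
  then obtain g where g: "\<And>m. g m \<in> polyball"
    "\<And>m x. x \<in> lam ` {1..n} \<Longrightarrow> cmod (g m x - f x) < 1 / real (Suc m)" by metis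
  have lim: "(\<lambda>m. g m (lam i)) \<longlonglongrightarrow> w i" if i: "i \<in> {1..n}" for i
  proof -
    have "(\<lambda>m. g m (lam i) - w i) \<longlonglongrightarrow> 0"
    proof (rule Lim_null_comparison)
      show "\<forall>\<^sub>F m in sequentially. norm (g m (lam i) - w i) \<le> 1 / real (Suc m)"
        using g(2)[of "lam i"] i w[OF i] by (intro always_eventually allI less_imp_le) auto
    qed (rule LIMSEQ_Suc[OF lim_1_over_n])
    then show ?thesis by (simp add: LIM_zero_iff)
  qed
  define S where "S v = (\<Sum>i=1..n. \<Sum>j=1..n. cnj (x i) * ((1 - v i * cnj (v j)) * k (lam i) (lam j)) * x j)" for v
  have "0 \<le> S (\<lambda>i. g m (lam i))" for m
    using pos_semidef_polyball[OF k g(1), of n lam m] lam unfolding pos_semidef_def S_def by blast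
  then have S: "0 \<le> Re (S (\<lambda>i. g m (lam i)))" "Im (S (\<lambda>i. g m (lam i))) = 0" for m
    by (auto simp: less_eq_complex_def)
  have limS: "(\<lambda>m. S (\<lambda>i. g m (lam i))) \<longlonglongrightarrow> S w"
    unfolding S_def by (intro tendsto_sum tendsto_intros lim)
  have "0 \<le> Re (S w)"
    by (rule LIMSEQ_le_const[OF tendsto_Re[OF limS]]) (use S in auto)
  moreover have "Im (S w) = 0"
    using tendsto_Im[OF limS] unfolding S(2) by (simp add: LIMSEQ_const_iff)
  ultimately have "0 \<le> S w" by (simp add: less_eq_complex_def)
  then show "0 \<le> (\<Sum>i=1..n. \<Sum>j=1..n. cnj (x i) * ((1 - w i * cnj (w j)) * k (lam i) (lam j)) * x j)"
    unfolding S_def .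
qed

lemma interpolant_of_polyball_approx:
  fixes W :: "complex \<times> complex \<Rightarrow> complex"
  assumes L: "L \<subseteq> sym_bidisk"
    and approx: "\<And>e. e > 0 \<Longrightarrow> \<exists>g\<in>polyball. \<forall>x\<in>L. cmod (g x - W x) < e"
  shows "\<exists>f\<in>H_infinity. sup_norm f \<le> 1 \<and> (\<forall>x\<in>L. f x = W x)"
proof -
  have "\<exists>g\<in>polyball. \<forall>x\<in>L. cmod (g x - W x) < 1 / real (Suc m)" for m
    by (rule approx) simp
  then obtain g where g: "\<And>m. g m \<in> polyball"
    "\<And>m x. x \<in> L \<Longrightarrow> cmod (g m x - W x) < 1 / real (Suc m)" by metis
  have gbd: "cmod (g m z) \<le> 1" if "z \<in> sym_bidisk" for m z
    using g(1)[of m] that by (simp add: polyball_def)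
  have gpoly: "g m \<in> polyfuns" for m using g(1)[of m] by (simp add: polyball_def)
  have "\<exists>r f. strict_mono r \<and> (\<forall>z\<in>sym_bidisk. (\<lambda>n. g (r n) z) \<longlonglongrightarrow> f z) \<and> holomorphic2_on f sym_bidisk"
    using open_sym_bidisk polyfuns_holomorphic2[OF gpoly] gbd by (rule montel_two_variables[of sym_bidisk g])
  then obtain r f where r: "strict_mono r" "\<And>z. z \<in> sym_bidisk \<Longrightarrow> (\<lambda>n. g (r n) z) \<longlonglongrightarrow> f z"
    and f: "holomorphic2_on f sym_bidisk" by blast
  have fbd: "cmod (f z) \<le> 1" if "z \<in> sym_bidisk" for z
    by (rule LIMSEQ_le_const2[OF tendsto_norm[OF r(2)[OF that]]]) (use gbd[OF that] in auto)
  have "f x = W x" if x: "x \<in> L" for x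
  proof -
    have "(\<lambda>m. g m x - W x) \<longlonglongrightarrow> 0"
    proof (rule Lim_null_comparison)
      show "\<forall>\<^sub>F m in sequentially. norm (g m x - W x) \<le> 1 / real (Suc m)"
        using g(2)[OF x] by (intro always_eventually allI less_imp_le)
    qed (rule LIMSEQ_Suc[OF lim_1_over_n])
    then have "(\<lambda>m. g m x) \<longlonglongrightarrow> W x" by (simp add: LIM_zero_iff)
    from LIMSEQ_subseq_LIMSEQ[OF this r(1)] have "(\<lambda>n. g (r n) x) \<longlonglongrightarrow> W x" by (simp add: o_def)
    moreover have "(\<lambda>n. g (r n) x) \<longlonglongrightarrow> f x" using r(2) x L by blast
    ultimately show ?thesis using LIMSEQ_unique by blast
  qed
  moreover have "f \<in> H_infinity"
    unfolding H_infinity_def bounded_iff using f fbd by blast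
  moreover have "sup_norm f \<le> 1" by (rule sup_norm_le[OF fbd])
  ultimately show ?thesis by blast
qed

text \<open>
  Nodes may coincide. The identity kernel then forces equal targets: on two equal nodes its Pick matrix
  has determinant \<open>-|w i - w j|\<^sup>2\<close>.
\<close>

lemma targets_consistent:
  assumes lam: "\<And>i. i \<in> {1..n} \<Longrightarrow> lam i \<in> sym_bidisk"
    and psd: "\<And>k. admissible k \<Longrightarrow> pos_semidef n (\<lambda>i j. (1 - w i * cnj (w j)) * k (lam i) (lam j))"
    and ij: "i \<in> {1..n}" "j \<in> {1..n}" "lam i = lam j"
  shows "w i = w j"
proof (cases "i = j")
  case False
  let ?k = "atomic_kernel (\<lambda>x y. 0) 1 {} :: kernel"
  have "admissible ?k" by (rule admissible_atomic_kernel) auto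
  note p = psd[OF this]
  define x where "x l = (if l = i then 1 else if l = j then - 1 else 0 :: complex)" for l
  have x0: "x l = 0" if "l \<notin> {i, j}" for l using that by (simp add: x_def)
  let ?T = "\<lambda>a b. cnj (x a) * ((1 - w a * cnj (w b)) * ?k (lam a) (lam b)) * x b"
  have "0 \<le> Re (\<Sum>a=1..n. \<Sum>b=1..n. ?T a b)"
    using p[unfolded pos_semidef_def, rule_format, of x] by (simp add: less_eq_complex_def)
  also have "(\<Sum>a=1..n. \<Sum>b=1..n. ?T a b) = (\<Sum>a\<in>{i, j}. \<Sum>b=1..n. ?T a b)"
    by (rule sum.mono_neutral_right) (use ij x0 in auto)
  also have "\<dots> = (\<Sum>a\<in>{i, j}. \<Sum>b\<in>{i, j}. ?T a b)"
    by (rule sum.cong[OF refl], rule sum.mono_neutral_right) (use ij x0 in auto)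
  also have "\<dots> = - ((w i - w j) * cnj (w i - w j))"
    using False ij(3) by (simp add: x_def atomic_kernel_def algebra_simps)
  also have "\<dots> = of_real (- (cmod (w i - w j))\<^sup>2)"
    by (simp only: complex_norm_square[symmetric] of_real_minus)
  finally show ?thesis by simp
qed simp

theorem mainTheorem2:
  fixes n :: nat
    and lam :: "nat \<Rightarrow> complex \<times> complex"
    and w :: "nat \<Rightarrow> complex"
  assumes "1 \<le> n"
    and "\<And>i. i \<in> {1..n} \<Longrightarrow> lam i \<in> sym_bidisk"
    and "\<And>i. i \<in> {1..n} \<Longrightarrow> w i \<in> cball 0 1"
  shows "(\<exists>f\<in>H_infinity. sup_norm f \<le> 1 \<and> (\<forall>i\<in>{1..n}. f (lam i) = w i)) \<longleftrightarrow>
    (\<forall>k. admissible k \<longrightarrow>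
       pos_semidef n (\<lambda>i j. (1 - w i * cnj (w j)) * k (lam i) (lam j)))"
proof
  assume "\<exists>f\<in>H_infinity. sup_norm f \<le> 1 \<and> (\<forall>i\<in>{1..n}. f (lam i) = w i)"
  then obtain f where f: "f \<in> H_infinity" "sup_norm f \<le> 1" "\<And>i. i \<in> {1..n} \<Longrightarrow> f (lam i) = w i" by blast
  show "\<forall>k. admissible k \<longrightarrow> pos_semidef n (\<lambda>i j. (1 - w i * cnj (w j)) * k (lam i) (lam j))"
  proof (intro allI impI)
    fix k assume "admissible k"
    from f(1,2) this assms(2) f(3)
    show "pos_semidef n (\<lambda>i j. (1 - w i * cnj (w j)) * k (lam i) (lam j))"
      by (rule pos_semidef_of_interpolant)
  qed
next
  assume "\<forall>k. admissible k \<longrightarrow> pos_semidef n (\<lambda>i j. (1 - w i * cnj (w j)) * k (lam i) (lam j))"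
  then have psd: "pos_semidef n (\<lambda>i j. (1 - w i * cnj (w j)) * k (lam i) (lam j))" if "admissible k" for k
    using that by blast
  define L where "L = lam ` {1..n}"
  \<comment> \<open>choose one index for every node\<close>
  obtain I where I: "I \<subseteq> {1..n}" "inj_on lam I" "L = lam ` I"
    using subset_image_inj[of L lam "{1..n}"] unfolding L_def by blast
  have L: "finite L" "L \<subseteq> sym_bidisk" using assms(2) by (auto simp: L_def)
  define W where "W x = w (the_inv_into I lam x)" for x
  have WI: "W (lam i) = w i" if "i \<in> I" for i using that I by (simp add: W_def the_inv_into_f_f)
  have W: "W (lam i) = w i" if i: "i \<in> {1..n}" for i
  proof -
    have "lam i \<in> lam ` I" using i I(3) unfolding L_def by blast
    then obtain j where j: "j \<in> I" "lam i = lam j" by blast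
    then have "j \<in> {1..n}" using I(1) by blast
    from assms(2) psd i this j(2) have "w i = w j" by (rule targets_consistent)
    then show ?thesis using WI[OF j(1)] j(2) by simp
  qed
  have psdL: "0 \<le> Re (\<Sum>x\<in>L. \<Sum>y\<in>L. (1 - W x * cnj (W y)) * k x y)" if k: "admissible k" for k
  proof -
    let ?x = "\<lambda>i. of_bool (i \<in> I) :: complex"
    let ?T = "\<lambda>a b. cnj (?x a) * ((1 - w a * cnj (w b)) * k (lam a) (lam b)) * ?x b"
    have "0 \<le> Re (\<Sum>a=1..n. \<Sum>b=1..n. ?T a b)"
      using psd[OF k, unfolded pos_semidef_def, rule_format, of ?x] by (simp add: less_eq_complex_def)
    also have "(\<Sum>a=1..n. \<Sum>b=1..n. ?T a b) = (\<Sum>a\<in>I. \<Sum>b=1..n. ?T a b)"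
      by (rule sum.mono_neutral_right) (use I in auto)
    also have "\<dots> = (\<Sum>a\<in>I. \<Sum>b\<in>I. ?T a b)"
      by (rule sum.cong[OF refl], rule sum.mono_neutral_right) (use I in auto)
    also have "\<dots> = (\<Sum>x\<in>L. \<Sum>y\<in>L. (1 - W x * cnj (W y)) * k x y)"
      unfolding I(3) sum.reindex[OF I(2)] o_def by (intro sum.cong) (auto simp: WI)
    finally show ?thesis .
  qed
  have "\<exists>g\<in>polyball. \<forall>x\<in>L. cmod (g x - W x) < e" if "e > 0" for e
    using L that psdL by (rule polyball_approx_of_psd)
  with L(2) have "\<exists>f\<in>H_infinity. sup_norm f \<le> 1 \<and> (\<forall>x\<in>L. f x = W x)"
    by (rule interpolant_of_polyball_approx)
  then obtain f where "f \<in> H_infinity" "sup_norm f \<le> 1" "\<forall>x\<in>L. f x = W x" by blast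
  then show "\<exists>f\<in>H_infinity. sup_norm f \<le> 1 \<and> (\<forall>i\<in>{1..n}. f (lam i) = w i)"
    using W by (auto simp: L_def)
qed

end
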